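(* Let $(L,\mathbb{F})$ be a Lévy process on the filtered probability space $(\Omega,\mathscr{F},\mathbb{P};\mathbb{F})$ with finite horizon $T>0$, and assume that $L$ is not monotone, i.e. neither $L$ nor $-L$ is a subordinator. Then the minimal entropy martingale measure (MEMM) $\mathbb{P}^*$ in the class $\hat{\mathscr{M}}^{\rm loc}_a$ coincides with the Esscher martingale measure (EMM) $\mathbb{P}^E$ for $(L,\mathbb{F})$: $\mathbb{P}^*$ exists if and only if $\mathbb{P}^E$ exists, and in this case $\mathbb{P}^*=\mathbb{P}^E$.
   Context: Time runs over $[0,T]$, $\mathbb{F}=(\mathscr{F}_t)_{t\in[0,T]}$ is the filtration, and $(L,\mathbb{F})$ is a real-valued Lévy process with respect to $\mathbb{F}$ under $\mathbb{P}$ (càdlàg, $L_0=0$, $\mathbb{F}$-adapted, with stationary increments $L_t-L_s$ independent of $\mathscr{F}_s$). Probability measures below are considered on $\mathscr{F}_T$. Relative entropy: $I_T(\mathbb{Q},\mathbb{P})=\mathbb{E}_{\mathbb{P}}\big[\frac{d\mathbb{Q}}{d\mathbb{P}}|_{\mathscr{F}_T}\log\frac{d\mathbb{Q}}{d\mathbb{P}}|_{\mathscr{F}_T}\big]$ if $\mathbb{Q}|_{\mathscr{F}_T}\ll\mathbb{P}|_{\mathscr{F}_T}$, and $+\infty$ otherwise. Classes of probability measures: - $\mathscr{M}^{\rm loc}_a=\{\mathbb{Q}:\ \mathbb{Q}|_{\mathscr{F}_T}\ll\mathbb{P}|_{\mathscr{F}_T},\ (L,\mathbb{F})\text{ is a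 }\mathbb{Q}\text{-local martingale}\}$. - $\tilde{\mathscr{M}}^{\rm loc}_a$ is the set of $\mathbb{Q}$ with $\mathbb{Q}|_{\mathscr{F}_T}\ll\mathbb{P}|_{\mathscr{F}_T}$ that satisfy the local moment condition: there is a sequence $(\tau_k)_{k\ge1}$ of $\mathbb{F}$-stopping times such that $\{\tau_k=T\}\uparrow\Omega$ as $k\to\infty$ and $\mathbb{E}_{\mathbb{Q}}[L_{\tau_k\wedge T}]=0$ (in particular this expectation exists) for all $k\ge1$. - $\tilde{\mathscr{M}}^{\rm loc,0}_a=\{\mathbb{Q}\in\tilde{\mathscr{M}}^{\rm loc}_a:\ \mathbb{E}_{\mathbb{Q}}[|L_T|]<+\infty\}$. - $\hat{\mathscr{M}}^{\rm loc}_a=\mathscr{M}^{\rm loc}_a\cup\tilde{\mathscr{M}}^{\rm loc,0}_a$. A MEMM in a class $\mathscr{C}$ is a $\mathbb{P}^*\in\mathscr{C}$ with $I_T(\mathbb{P}^*,\mathbb{P})=\inf_{\mathbb{Q}\in\mathscr{C}}I_T(\mathbb{Q},\mathbb{P})$. For $\kappa\in\mathbb{R}$ with $\mathbb{E}_{\mathbb{P}}[\exp(\kappa L_T)]<\infty$, the Esscher measure $\mathbb{P}^\kappa$ is defined by $d\mathbb{P}^\kappa=\frac{\exp(\kappa L_T)}{\mathbb{E}_{\mathbb{P}}[\exp(\kappa L_T)]}\,d\mathbb{P}$. If $(L,\mathbb{F})$ is a martingale under $\mathbb{P}^{\kappa}$ for some such $\kappa$, then $\mathbb{P}^\kappa$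 is called the Esscher martingale measure (EMM) and denoted $\mathbb{P}^E$ (it is unique as a measure). *)

theory Defs
  imports "HOL-Probability.Probability"
begin

text \<open>
  Time runs over the interval from \<open>0\<close> to \<open>T\<close>, rendered as \<open>{0..T} :: real set\<close>. Processes and
  filtrations are functions on all reals, but only their values on \<open>{0..T}\<close> matter. In particular,
  asking for the library's \<^locale>\<open>filtration\<close> on all of \<open>real\<close> is no restriction: a filtration on
  \<open>{0..T}\<close> extends to \<open>real\<close> by freezing it at both ends. A stopping time with values in
  \<open>{0..T} \<union> {\<infinity>}\<close> is represented by a nonnegative real-valued one, any number above \<open>T\<close> playing the
  role of \<open>\<infinity>\<close>; the \<open>\<sigma>\<close>-algebras \<open>F t\<close> with \<open>t > T\<close> then impose no additional condition.

  As usual in the library, \<open>F t\<close> is of type \<open>'a measure\<close> but is only used as a \<open>\<sigma>\<close>-algebra.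
\<close>

subsection \<open>Levy processes\<close>

definition cadlag_on :: "real \<Rightarrow> (real \<Rightarrow> real) \<Rightarrow> bool" where
  "cadlag_on T x \<longleftrightarrow>
     (\<forall>t\<in>{0..<T}. continuous (at_right t) x) \<and>
     (\<forall>t\<in>{0<..T}. \<exists>l. (x \<longlongrightarrow> l) (at_left t))"

definition levy_process ::
    "'a measure \<Rightarrow> (real \<Rightarrow> 'a measure) \<Rightarrow> real \<Rightarrow> (real \<Rightarrow> 'a \<Rightarrow> real) \<Rightarrow> bool" where
  "levy_process P F T L \<longleftrightarrow>
     (\<forall>\<omega>\<in>space P. cadlag_on T (\<lambda>t. L t \<omega>)) \<and>
     (\<forall>\<omega>\<in>space P. L 0 \<omega> = 0) \<and>
     (\<forall>t\<in>{0..T}. L t \<in> borel_measurable (F t)) \<and>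
     (\<forall>s\<in>{0..T}. \<forall>t\<in>{s..T}.
        distr P borel (\<lambda>\<omega>. L t \<omega> - L s \<omega>) = distr P borel (L (t - s)) \<and>
        prob_space.indep_set P (sets (F s))
          {(\<lambda>\<omega>. L t \<omega> - L s \<omega>) -` B \<inter> space P | B. B \<in> sets borel})"

definition subordinator ::
    "'a measure \<Rightarrow> (real \<Rightarrow> 'a measure) \<Rightarrow> real \<Rightarrow> (real \<Rightarrow> 'a \<Rightarrow> real) \<Rightarrow> bool" where
  "subordinator P F T L \<longleftrightarrow>
     levy_process P F T L \<and> (AE \<omega> in P. mono_on {0..T} (\<lambda>t. L t \<omega>))"

subsection \<open>Martingales and local martingales\<close>

definition martingale_on ::
    "'a measure \<Rightarrow> (real \<Rightarrow> 'a measure) \<Rightarrow> real \<Rightarrow> (real \<Rightarrow> 'a \<Rightarrow> real) \<Rightarrow> bool" where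
  "martingale_on Q F T X \<longleftrightarrow>
     (\<forall>t\<in>{0..T}. X t \<in> borel_measurable (F t) \<and> integrable Q (X t)) \<and>
     (\<forall>s\<in>{0..T}. \<forall>t\<in>{s..T}. AE \<omega> in Q. real_cond_exp Q (F s) (X t) \<omega> = X s \<omega>)"

text \<open>
  On a finite horizon that includes \<open>T\<close>, a localizing sequence has to reach \<open>T\<close> after finitely many
  steps almost surely; converging to \<open>T\<close> would not be enough. All processes localized here start
  at \<open>0\<close>, so no initial value needs to be subtracted.
\<close>

definition local_martingale_on ::
    "'a measure \<Rightarrow> (real \<Rightarrow> 'a measure) \<Rightarrow> real \<Rightarrow> (real \<Rightarrow> 'a \<Rightarrow> real) \<Rightarrow> bool" where
  "local_martingale_on Q F T X \<longleftrightarrow>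
     (\<exists>\<tau> :: nat \<Rightarrow> 'a \<Rightarrow> real.
        (\<forall>k. stopping_time F (\<tau> k) \<and> (\<forall>\<omega>\<in>space Q. 0 \<le> \<tau> k \<omega>)) \<and>
        (AE \<omega> in Q. incseq (\<lambda>k. \<tau> k \<omega>)) \<and>
        (AE \<omega> in Q. \<exists>k. T \<le> \<tau> k \<omega>) \<and>
        (\<forall>k. martingale_on Q F T (\<lambda>t \<omega>. X (min t (\<tau> k \<omega>)) \<omega>)))"

subsection \<open>Relative entropy\<close>

text \<open>
  Both measures are meant to live on the same \<open>\<sigma>\<close>-algebra. Since \<open>z * ln z\<close> is bounded from below
  on \<open>z \<ge> 0\<close> (with value \<open>0\<close> at \<open>0\<close>, as \<open>0 * ln 0 = 0\<close> here), the expectation of \<open>Z * ln Z\<close> always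
  exists in \<open>(-\<infinity>, \<infinity>]\<close>, and it is \<open>\<infinity>\<close> exactly if \<open>Z * ln Z\<close> is not integrable.
\<close>

definition rel_entropy :: "'a measure \<Rightarrow> 'a measure \<Rightarrow> ereal" where
  "rel_entropy Q P =
     (let Z = (\<lambda>\<omega>. enn2real (RN_deriv P Q \<omega>)) in
      if absolutely_continuous P Q \<and> integrable P (\<lambda>\<omega>. Z \<omega> * ln (Z \<omega>))
      then ereal (\<integral>\<omega>. Z \<omega> * ln (Z \<omega>) \<partial>P) else \<infinity>)"

subsection \<open>Classes of probability measures\<close>

text \<open>
  All measures \<open>Q\<close> below live on \<open>F T\<close>, and \<open>P\<close> is compared with them through its restriction
  \<^term>\<open>restr_to_subalg P (F T)\<close>.
\<close>

definition ac_measures :: "'a measure \<Rightarrow> (real \<Rightarrow> 'a measure) \<Rightarrow> real \<Rightarrow> 'a measure set" where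
  "ac_measures P F T =
     {Q. prob_space Q \<and> sets Q = sets (F T) \<and> absolutely_continuous (restr_to_subalg P (F T)) Q}"

definition M_loc ::
    "'a measure \<Rightarrow> (real \<Rightarrow> 'a measure) \<Rightarrow> real \<Rightarrow> (real \<Rightarrow> 'a \<Rightarrow> real) \<Rightarrow> 'a measure set" where
  "M_loc P F T L = {Q \<in> ac_measures P F T. local_martingale_on Q F T L}"

definition local_moment_condition ::
    "'a measure \<Rightarrow> (real \<Rightarrow> 'a measure) \<Rightarrow> real \<Rightarrow> (real \<Rightarrow> 'a \<Rightarrow> real) \<Rightarrow> bool" where
  "local_moment_condition Q F T L \<longleftrightarrow>
     (\<exists>\<tau> :: nat \<Rightarrow> 'a \<Rightarrow> real.
        (\<forall>k. stopping_time F (\<tau> k) \<and> (\<forall>\<omega>\<in>space Q. 0 \<le> \<tau> k \<omega>)) \<and>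
        incseq (\<lambda>k. {\<omega>\<in>space Q. \<tau> k \<omega> = T}) \<and>
        (\<Union>k. {\<omega>\<in>space Q. \<tau> k \<omega> = T}) = space Q \<and>
        (\<forall>k. integrable Q (\<lambda>\<omega>. L (min (\<tau> k \<omega>) T) \<omega>) \<and>
             (\<integral>\<omega>. L (min (\<tau> k \<omega>) T) \<omega> \<partial>Q) = 0))"

definition M_tilde_loc ::
    "'a measure \<Rightarrow> (real \<Rightarrow> 'a measure) \<Rightarrow> real \<Rightarrow> (real \<Rightarrow> 'a \<Rightarrow> real) \<Rightarrow> 'a measure set" where
  "M_tilde_loc P F T L = {Q \<in> ac_measures P F T. local_moment_condition Q F T L}"

definition M_tilde_loc0 ::
    "'a measure \<Rightarrow> (real \<Rightarrow> 'a measure) \<Rightarrow> real \<Rightarrow> (real \<Rightarrow> 'a \<Rightarrow> real) \<Rightarrow> 'a measure set" where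
  "M_tilde_loc0 P F T L = {Q \<in> M_tilde_loc P F T L. integrable Q (L T)}"

definition M_hat_loc ::
    "'a measure \<Rightarrow> (real \<Rightarrow> 'a measure) \<Rightarrow> real \<Rightarrow> (real \<Rightarrow> 'a \<Rightarrow> real) \<Rightarrow> 'a measure set" where
  "M_hat_loc P F T L = M_loc P F T L \<union> M_tilde_loc0 P F T L"

subsection \<open>Minimal entropy and Esscher martingale measures\<close>

definition is_MEMM_in ::
    "'a measure set \<Rightarrow> 'a measure \<Rightarrow> (real \<Rightarrow> 'a measure) \<Rightarrow> real \<Rightarrow> 'a measure \<Rightarrow> bool" where
  "is_MEMM_in C P F T Pmin \<longleftrightarrow>
     Pmin \<in> C \<and>
     rel_entropy Pmin (restr_to_subalg P (F T)) =
       (INF Q\<in>C. rel_entropy Q (restr_to_subalg P (F T)))"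

definition esscher_measure ::
    "'a measure \<Rightarrow> (real \<Rightarrow> 'a measure) \<Rightarrow> real \<Rightarrow> (real \<Rightarrow> 'a \<Rightarrow> real) \<Rightarrow> real \<Rightarrow> 'a measure" where
  "esscher_measure P F T L \<kappa> =
     density (restr_to_subalg P (F T))
       (\<lambda>\<omega>. ennreal (exp (\<kappa> * L T \<omega>) / (\<integral>\<omega>'. exp (\<kappa> * L T \<omega>') \<partial>P)))"

definition is_EMM ::
    "'a measure \<Rightarrow> (real \<Rightarrow> 'a measure) \<Rightarrow> real \<Rightarrow> (real \<Rightarrow> 'a \<Rightarrow> real) \<Rightarrow> 'a measure \<Rightarrow> bool" where
  "is_EMM P F T L PE \<longleftrightarrow>
     (\<exists>\<kappa>. integrable P (\<lambda>\<omega>. exp (\<kappa> * L T \<omega>)) \<and>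
          PE = esscher_measure P F T L \<kappa> \<and> martingale_on PE F T L)"

end

theory Submission
  imports Defs
begin

text \<open>
  The argument rests on a lower bound for the entropy, one for every Esscher parameter. Let
  \<open>m(\<kappa>)\<close> be the moment generating function of \<open>L\<^sub>T\<close>, suppose \<open>m(\<kappa>) < \<infinity>\<close>, and put
  \<open>c = ln m(\<kappa>) / T\<close>. For a stopping time \<open>\<sigma> \<le> T\<close> the variable
  \<open>X = \<kappa> L\<^sub>\<sigma> - c \<sigma>\<close> satisfies \<open>E\<^sub>P[exp X] \<le> 1\<close>, so the Gibbs variational inequality
  bounds the entropy of \<open>Q\<close> below by \<open>E\<^sub>Q[X]\<close>. Every \<open>Q\<close> in the class, whether it makes \<open>L\<close> a local
  martingale or satisfies the local moment condition, has stopping times \<open>\<sigma>\<^sub>k\<close> that eventually reach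
  \<open>T\<close> and for which \<open>L\<close> has mean zero under \<open>Q\<close>. Hence \<open>E\<^sub>Q[X\<^sub>k] = - c E\<^sub>Q[\<sigma>\<^sub>k] \<longlonglongrightarrow> - ln m(\<kappa>)\<close>, and the
  entropy of \<open>Q\<close> is at least \<open>- ln m(\<kappa>)\<close> for every such \<open>\<kappa>\<close>. The gap in the variational inequality
  dominates a squared Hellinger distance, so equality forces \<open>Q\<close> to be the Esscher measure of \<open>\<kappa>\<close>
  (\<open>entropy_core\<close>).

  An Esscher martingale measure has entropy exactly \<open>- ln m(\<kappa>)\<close>; it is therefore the unique minimizer.
  For the converse one needs some \<open>\<kappa>\<close> for which \<open>- ln m(\<kappa>)\<close> is no less than the infimum of the
  entropies. As \<open>L\<close> is not monotone, \<open>L\<^sub>T\<close> takes both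
  signs (\<open>subordinator_if_terminal_nonneg\<close>). The law of \<open>L\<^sub>T\<close> restricted to \<open>[-n, n]\<close> can then be tilted
  to mean zero, which yields members of the class with entropy \<open>- ln f\<^sub>n(\<kappa>\<^sub>n)\<close>, where \<open>f\<^sub>n\<close> is the
  truncated moment generating function; a limit point of the \<open>\<kappa>\<^sub>n\<close> is the desired \<open>\<kappa>\<close>
  (\<open>entropy_minimizing_tilt\<close>). A minimal measure must then be the Esscher measure of this \<open>\<kappa>\<close>.

  It remains to see that an Esscher measure which belongs to the class makes \<open>L\<close> a true martingale.
  Under it \<open>L\<close> is again a Levy process (\<open>levy_horizon_esscher\<close>), so what is to be shown is that a
  Levy process whose value at a stopping time \<open>\<sigma>\<close> with \<open>E[\<sigma>] > 0\<close> is integrable and centered is itself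
  integrable and centered (\<open>centered_if_stopped_centered\<close>). This follows from the identity
  \<open>E[exp(i u L\<^sub>\<sigma> - \<psi>(u) \<sigma>)] = 1\<close>, where \<open>\<psi>\<close> is the characteristic exponent. The martingale behind it
  is bounded, so optional stopping amounts to bounded convergence. Expanding the identity at \<open>u = 0\<close> controls \<open>\<psi>\<close>
  by the characteristic function of \<open>L\<^sub>\<sigma>\<close>, up to \<open>O(u\<^sup>2)\<close>; both the finiteness of the first moment and
  its value can be read off from that.
\<close>

section \<open>Levy processes through their increments\<close>

text \<open>
  Stationarity and independence of the increments in one formula. It is stable under restricting the
  \<open>\<sigma>\<close>-algebra and under an Esscher change of measure, where both parts have to be verified at once.
\<close>
definition independent_increments ::
    "'a measure \<Rightarrow> (real \<Rightarrow> 'a measure) \<Rightarrow> real \<Rightarrow> (real \<Rightarrow> 'a \<Rightarrow> real) \<Rightarrow> bool" where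
  "independent_increments P F T L \<longleftrightarrow>
     (\<forall>s\<in>{0..T}. \<forall>t\<in>{s..T}. \<forall>A\<in>sets (F s). \<forall>B\<in>sets borel.
        emeasure P (A \<inter> {\<omega>\<in>space P. L t \<omega> - L s \<omega> \<in> B}) =
        emeasure P A * emeasure P {\<omega>\<in>space P. L (t - s) \<omega> \<in> B})"

lemma levy_process_iff:
  assumes "prob_space P" and sub: "\<And>t. t \<in> {0..T} \<Longrightarrow> subalgebra P (F t)"
  shows "levy_process P F T L \<longleftrightarrow>
     (\<forall>\<omega>\<in>space P. cadlag_on T (\<lambda>t. L t \<omega>)) \<and>
     (\<forall>\<omega>\<in>space P. L 0 \<omega> = 0) \<and>
     (\<forall>t\<in>{0..T}. L t \<in> borel_measurable (F t)) \<and> independent_increments P F T L"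
proof -
  interpret prob_space P by fact
  have "(\<forall>s\<in>{0..T}. \<forall>t\<in>{s..T}.
        distr P borel (\<lambda>\<omega>. L t \<omega> - L s \<omega>) = distr P borel (L (t - s)) \<and>
        indep_set (sets (F s)) {(\<lambda>\<omega>. L t \<omega> - L s \<omega>) -` B \<inter> space P | B. B \<in> sets borel})
      \<longleftrightarrow> independent_increments P F T L"
    if ad: "\<forall>t\<in>{0..T}. L t \<in> borel_measurable (F t)"
    unfolding independent_increments_def
  proof (intro ball_cong refl)
    fix s t assume s: "s \<in> {0..T}" and t: "t \<in> {s..T}"
    have [measurable]: "L r \<in> borel_measurable P" if "r \<in> {0..T}" for r
      using measurable_from_subalg[OF sub] ad that by blast
    have [measurable]: "L s \<in> borel_measurable P" "L t \<in> borel_measurable P" "L (t - s) \<in> borel_measurable P"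
      using s t by auto
    have subs: "sets (F s) \<subseteq> events" and sp: "space P \<in> sets (F s)"
      using sub[OF s] sets.top[of "F s"] unfolding subalgebra_def by auto
    let ?D = "\<lambda>\<omega>. L t \<omega> - L s \<omega>"
    have pre: "?D -` B \<inter> space P = {\<omega>\<in>space P. ?D \<omega> \<in> B}" for B by auto
    have pre2: "L (t-s) -` B \<inter> space P = {\<omega>\<in>space P. L (t-s) \<omega> \<in> B}" for B by auto
    show "(distr P borel ?D = distr P borel (L (t - s)) \<and>
        indep_set (sets (F s)) {?D -` B \<inter> space P | B. B \<in> sets borel}) \<longleftrightarrow>
      (\<forall>A\<in>sets (F s). \<forall>B\<in>sets borel.
        emeasure P (A \<inter> {\<omega>\<in>space P. L t \<omega> - L s \<omega> \<in> B}) =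
        emeasure P A * emeasure P {\<omega>\<in>space P. L (t - s) \<omega> \<in> B})" (is "?l \<longleftrightarrow> ?r")
    proof
      assume l: ?l
      show ?r
      proof (intro ballI)
        fix A B assume A: "A \<in> sets (F s)" and B: "B \<in> sets (borel::real measure)"
        have "prob (A \<inter> {\<omega>\<in>space P. ?D \<omega> \<in> B}) = prob A * prob {\<omega>\<in>space P. ?D \<omega> \<in> B}"
          using l A B unfolding indep_sets2_eq pre by blast
        moreover have "emeasure (distr P borel ?D) B = emeasure (distr P borel (L (t - s))) B"
          using l by simp
        ultimately show "emeasure P (A \<inter> {\<omega>\<in>space P. ?D \<omega> \<in> B}) =
            emeasure P A * emeasure P {\<omega>\<in>space P. L (t - s) \<omega> \<in> B}"
          using B by (simp add: emeasure_distr pre pre2 emeasure_eq_measure ennreal_mult)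
      qed
    next
      assume r: ?r
      have d: "emeasure P {\<omega>\<in>space P. ?D \<omega> \<in> B} = emeasure P {\<omega>\<in>space P. L (t - s) \<omega> \<in> B}"
        if "B \<in> sets borel" for B
      proof -
        have "space P \<inter> {\<omega>\<in>space P. ?D \<omega> \<in> B} = {\<omega>\<in>space P. ?D \<omega> \<in> B}" by auto
        then show ?thesis using r[rule_format, OF sp that] by (simp add: emeasure_space_1)
      qed
      have "distr P borel ?D = distr P borel (L (t - s))"
        by (rule measure_eqI) (auto simp: emeasure_distr pre pre2 d)
      moreover have "indep_set (sets (F s)) {?D -` B \<inter> space P | B. B \<in> sets borel}"
        unfolding indep_sets2_eq
      proof (intro conjI ballI)
        fix a b assume a: "a \<in> sets (F s)" and "b \<in> {?D -` B \<inter> space P |B. B \<in> sets borel}"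
        then obtain B where B: "B \<in> sets borel" "b = {\<omega>\<in>space P. ?D \<omega> \<in> B}" by (auto simp: pre)
        have "emeasure P (a \<inter> b) = emeasure P a * emeasure P b"
          using r a B d by simp
        then show "prob (a \<inter> b) = prob a * prob b"
          by (simp add: measure_def enn2real_mult)
      qed (use subs in auto)
      ultimately show ?l ..
    qed
  qed
  then show ?thesis unfolding levy_process_def by (intro conj_cong refl)
qed

text \<open>
  The measure lives on \<open>F T\<close> here, like the measures of the class. Esscher measures then satisfy the
  same assumptions, and every lemma of the locale can be applied to them as well.
\<close>
locale levy_horizon = prob_space P for P :: "'a measure" +
  fixes F :: "real \<Rightarrow> 'a measure" and T :: real and L :: "real \<Rightarrow> 'a \<Rightarrow> real"
  assumes T_pos: "0 < T"
    and filt: "filtration (space P) F"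
    and sets_P: "sets P = sets (F T)"
    and levy: "levy_process P F T L"
begin

lemma subalgebra_F: "t \<le> T \<Longrightarrow> subalgebra P (F t)"
  using filt sets_P by (auto simp: subalgebra_def filtration_def)

lemma sets_F_le: "t \<le> T \<Longrightarrow> A \<in> sets (F t) \<Longrightarrow> A \<in> sets P"
  using subalgebra_F by (auto simp: subalgebra_def)

lemma space_F [simp]: "space (F t) = space P"
  using filt by (simp add: filtration_def)

lemma F_mono: "s \<le> t \<Longrightarrow> A \<in> sets (F s) \<Longrightarrow> A \<in> sets (F t)"
  using filt by (auto simp: filtration_def)

lemma
  shows paths: "\<omega> \<in> space P \<Longrightarrow> cadlag_on T (\<lambda>t. L t \<omega>)"
    and L_0: "\<omega> \<in> space P \<Longrightarrow> L 0 \<omega> = 0"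
    and adapted: "0 \<le> t \<Longrightarrow> t \<le> T \<Longrightarrow> L t \<in> borel_measurable (F t)"
  using levy by (auto simp: levy_process_def)

lemma measurable_F_mono:
  "f \<in> borel_measurable (F s) \<Longrightarrow> s \<le> t \<Longrightarrow> f \<in> borel_measurable (F t)"
  using measurable_from_subalg[of "F t" "F s" f borel] filt by (auto simp: subalgebra_def filtration_def)

lemma measurable_F_P: "f \<in> measurable (F s) N \<Longrightarrow> s \<le> T \<Longrightarrow> f \<in> measurable P N"
  using measurable_from_subalg[OF subalgebra_F] by blast

lemma L_measurable: "0 \<le> t \<Longrightarrow> t \<le> T \<Longrightarrow> L t \<in> borel_measurable P"
  using adapted measurable_F_P by blast

lemma increment_distr:
  assumes "0 \<le> s" "s \<le> t" "t \<le> T"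
  shows "distr P borel (\<lambda>\<omega>. L t \<omega> - L s \<omega>) = distr P borel (L (t - s))"
  using levy assms unfolding levy_process_def by auto

lemma increment_indep_var:
  assumes st: "0 \<le> s" "s \<le> t" "t \<le> T" and Y: "Y \<in> measurable (F s) M"
    and g: "g \<in> measurable borel N"
  shows "indep_var M Y N (\<lambda>\<omega>. g (L t \<omega> - L s \<omega>))"
proof -
  note [measurable] = L_measurable[of s] L_measurable[of t] g
  let ?D = "\<lambda>\<omega>. L t \<omega> - L s \<omega>" and ?S = "\<lambda>X N. {X -` A \<inter> space P |A. A \<in> sets N}"
  have D [measurable]: "?D \<in> borel_measurable P" using st by auto
  have ind: "indep_set (sets (F s)) (?S ?D borel)"
    using levy st unfolding levy_process_def by auto
  have 1: "?S Y M \<subseteq> sets (F s)"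
    using measurable_sets[OF Y] by auto
  have 2: "?S (\<lambda>\<omega>. g (?D \<omega>)) N \<subseteq> ?S ?D borel"
  proof safe
    fix A assume "A \<in> sets N"
    then have "g -` A \<in> sets borel" using measurable_sets[OF g] by auto
    moreover have "(\<lambda>\<omega>. g (?D \<omega>)) -` A \<inter> space P = ?D -` (g -` A) \<inter> space P" by auto
    ultimately show "\<exists>B. (\<lambda>\<omega>. g (?D \<omega>)) -` A \<inter> space P = ?D -` B \<inter> space P \<and> B \<in> sets borel"
      by blast
  qed
  have "indep_set (?S Y M) (?S (\<lambda>\<omega>. g (?D \<omega>)) N)"
    unfolding indep_set_def
  proof (rule indep_sets_mono_sets[OF ind[unfolded indep_set_def]])
    show "case_bool (?S Y M) (?S (\<lambda>\<omega>. g (?D \<omega>)) N) i \<subseteq> case_bool (sets (F s)) (?S ?D borel) i" for i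
      using 1 2 by (cases i) simp_all
  qed
  then have "indep_set (sigma_sets (space P) (?S Y M)) (sigma_sets (space P) (?S (\<lambda>\<omega>. g (?D \<omega>)) N))"
  proof (rule indep_set_sigma_sets)
    have "Int_stable (?S X K)" for X and K :: "'z measure"
      unfolding Int_stable_def
    proof safe
      fix A B assume "A \<in> sets K" "B \<in> sets K"
      then show "\<exists>C. X -` A \<inter> space P \<inter> (X -` B \<inter> space P) = X -` C \<inter> space P \<and> C \<in> sets K"
        by (intro exI[of _ "A \<inter> B"]) auto
    qed
    then show "Int_stable (?S Y M)" "Int_stable (?S (\<lambda>\<omega>. g (?D \<omega>)) N)" by auto
  qed
  moreover have "Y \<in> measurable P M" using measurable_F_P[OF Y] st by simp
  moreover have "(\<lambda>\<omega>. g (?D \<omega>)) \<in> measurable P N" by measurable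
  ultimately show ?thesis unfolding indep_var_eq by blast
qed

lemma integral_increment:
  fixes Y :: "'a \<Rightarrow> 'b::{real_normed_field,banach,second_countable_topology}"
  assumes st: "0 \<le> s" "s \<le> t" "t \<le> T" and Y: "Y \<in> borel_measurable (F s)" "integrable P Y"
    and g: "g \<in> borel_measurable borel" "integrable P (\<lambda>\<omega>. g (L (t - s) \<omega>))"
  shows "integrable P (\<lambda>\<omega>. Y \<omega> * g (L t \<omega> - L s \<omega>))"
    and "(\<integral>\<omega>. Y \<omega> * g (L t \<omega> - L s \<omega>) \<partial>P) = (\<integral>\<omega>. Y \<omega> \<partial>P) * (\<integral>\<omega>. g (L (t - s) \<omega>) \<partial>P)"
proof -
  note [measurable] = L_measurable[of s] L_measurable[of t] L_measurable[of "t - s"] g(1)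
  have m: "(\<lambda>\<omega>. L t \<omega> - L s \<omega>) \<in> borel_measurable P" "L (t - s) \<in> borel_measurable P"
    using st by auto
  have i: "integrable P (\<lambda>\<omega>. g (L t \<omega> - L s \<omega>))"
    using integrable_distr_eq[OF m(1) g(1)] integrable_distr_eq[OF m(2) g(1)] g(2)
      increment_distr[OF st] by simp
  have e: "(\<integral>\<omega>. g (L t \<omega> - L s \<omega>) \<partial>P) = (\<integral>\<omega>. g (L (t - s) \<omega>) \<partial>P)"
    using integral_distr[OF m(1) g(1)] integral_distr[OF m(2) g(1)] increment_distr[OF st] by simp
  note ind = increment_indep_var[OF st Y(1) g(1)]
  show "integrable P (\<lambda>\<omega>. Y \<omega> * g (L t \<omega> - L s \<omega>))"
    by (rule indep_var_integrable[OF ind Y(2) i])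
  show "(\<integral>\<omega>. Y \<omega> * g (L t \<omega> - L s \<omega>) \<partial>P) = (\<integral>\<omega>. Y \<omega> \<partial>P) * (\<integral>\<omega>. g (L (t - s) \<omega>) \<partial>P)"
    using indep_var_lebesgue_integral[OF ind Y(2) i] e by simp
qed

lemma nn_integral_increment:
  fixes Y :: "'a \<Rightarrow> ennreal"
  assumes st: "0 \<le> s" "s \<le> t" "t \<le> T" and Y: "Y \<in> borel_measurable (F s)"
    and g: "g \<in> borel_measurable borel"
  shows "(\<integral>\<^sup>+\<omega>. Y \<omega> * g (L t \<omega> - L s \<omega>) \<partial>P) = (\<integral>\<^sup>+\<omega>. Y \<omega> \<partial>P) * (\<integral>\<^sup>+\<omega>. g (L (t - s) \<omega>) \<partial>P)"
proof -
  have YP: "Y \<in> borel_measurable P" using measurable_F_P[OF Y] st by simp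
  note [measurable] = L_measurable[of s] L_measurable[of t] L_measurable[of "t - s"] g YP
  have m: "(\<lambda>\<omega>. L t \<omega> - L s \<omega>) \<in> borel_measurable P" "L (t - s) \<in> borel_measurable P"
    using st by auto
  let ?G = "\<lambda>\<omega>. g (L t \<omega> - L s \<omega>)"
  have G: "?G \<in> borel_measurable P" using m by auto
  have eq: "distr P borel Y \<Otimes>\<^sub>M distr P borel ?G = distr P (borel \<Otimes>\<^sub>M borel) (\<lambda>\<omega>. (Y \<omega>, ?G \<omega>))"
    using increment_indep_var[OF st Y g] unfolding indep_var_distribution_eq by blast
  interpret D: prob_space "distr P borel ?G" by (rule prob_space_distr) (use G in auto)
  have "(\<integral>\<^sup>+\<omega>. Y \<omega> * ?G \<omega> \<partial>P) = (\<integral>\<^sup>+p. fst p * snd p \<partial>distr P (borel \<Otimes>\<^sub>M borel) (\<lambda>\<omega>. (Y \<omega>, ?G \<omega>)))"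
    using G by (subst nn_integral_distr) auto
  also have "\<dots> = (\<integral>\<^sup>+y. \<integral>\<^sup>+d. y * d \<partial>distr P borel ?G \<partial>distr P borel Y)"
    unfolding eq[symmetric] by (subst D.nn_integral_fst[symmetric]) auto
  also have "\<dots> = (\<integral>\<^sup>+y. y * (\<integral>\<^sup>+d. d \<partial>distr P borel ?G) \<partial>distr P borel Y)"
    by (intro nn_integral_cong nn_integral_cmult) auto
  also have "\<dots> = (\<integral>\<^sup>+y. y \<partial>distr P borel Y) * (\<integral>\<^sup>+d. d \<partial>distr P borel ?G)"
    by (rule nn_integral_multc) auto
  also have "\<dots> = (\<integral>\<^sup>+\<omega>. Y \<omega> \<partial>P) * (\<integral>\<^sup>+\<omega>. ?G \<omega> \<partial>P)"
    using G by (simp add: nn_integral_distr)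
  also have "(\<integral>\<^sup>+\<omega>. ?G \<omega> \<partial>P) = (\<integral>\<^sup>+\<omega>. g (L (t - s) \<omega>) \<partial>P)"
    using nn_integral_distr[OF m(1), of g] nn_integral_distr[OF m(2), of g] g increment_distr[OF st] by simp
  finally show ?thesis .
qed

end

section \<open>Optional stopping of exponentials on finite grids\<close>

context levy_horizon
begin

definition grid :: "nat \<Rightarrow> nat \<Rightarrow> real" where
  "grid N k = real k * T / real N"

text \<open>
  Rounding a time up to the grid: \<open>grid_index N s\<close> is the first \<open>k\<close> with \<open>s \<le> grid N k\<close>. Rounding up
  keeps stopping times adapted and lets right-continuity take the limit \<open>N \<longlonglongrightarrow> \<infinity>\<close>.
\<close>
definition grid_index :: "nat \<Rightarrow> real \<Rightarrow> nat" where
  "grid_index N s = nat \<lceil>real N * s / T\<rceil>"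

lemma grid_nonneg [simp]: "0 \<le> grid N k"
  using T_pos by (simp add: grid_def)

lemma grid_mono: "k \<le> l \<Longrightarrow> grid N k \<le> grid N l"
  using T_pos by (auto simp: grid_def intro!: divide_right_mono mult_right_mono)

lemma grid_top: "0 < N \<Longrightarrow> grid N N = T"
  by (simp add: grid_def)

lemma grid_le_T: "0 < N \<Longrightarrow> k \<le> N \<Longrightarrow> grid N k \<le> T"
  using grid_mono[of k N N] by (simp add: grid_top)

lemma grid_diff: "k \<le> l \<Longrightarrow> grid N l - grid N k = grid N (l - k)"
  by (simp add: grid_def left_diff_distrib diff_divide_distrib)

lemma grid_index_le_iff: "0 < N \<Longrightarrow> grid_index N s \<le> k \<longleftrightarrow> s \<le> grid N k"
proof -
  assume "0 < N"
  have "grid_index N s \<le> k \<longleftrightarrow> real N * s / T \<le> real k"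
    unfolding grid_index_def by linarith
  also have "\<dots> \<longleftrightarrow> s \<le> grid N k"
    using \<open>0 < N\<close> T_pos by (simp add: grid_def field_simps)
  finally show ?thesis .
qed

lemma grid_index_le: "0 < N \<Longrightarrow> s \<le> T \<Longrightarrow> grid_index N s \<le> N"
  by (simp add: grid_index_le_iff grid_top)

lemma grid_index_bounds:
  assumes "0 < N" "0 \<le> s"
  shows "s \<le> grid N (grid_index N s)" "grid N (grid_index N s) \<le> s + T / real N"
proof -
  show "s \<le> grid N (grid_index N s)"
    using grid_index_le_iff[OF assms(1), of s "grid_index N s"] by simp
  have "0 \<le> real N * s / T" using assms T_pos by simp
  then have "real (grid_index N s) \<le> real N * s / T + 1"
    unfolding grid_index_def by linarith
  then show "grid N (grid_index N s) \<le> s + T / real N"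
    using assms T_pos by (simp add: grid_def field_simps)
qed

lemma grid_index_tendsto:
  assumes "0 \<le> s"
  shows "(\<lambda>n. grid (Suc n) (grid_index (Suc n) s)) \<longlonglongrightarrow> s"
proof (rule tendsto_sandwich)
  show "(\<lambda>n. s) \<longlonglongrightarrow> s" by simp
  have "(\<lambda>n. s + T * inverse (real (Suc n))) \<longlonglongrightarrow> s + T * 0"
    by (intro tendsto_intros LIMSEQ_inverse_real_of_nat)
  then show "(\<lambda>n. s + T / real (Suc n)) \<longlonglongrightarrow> s" by (simp add: divide_inverse)
  show "eventually (\<lambda>n. s \<le> grid (Suc n) (grid_index (Suc n) s)) sequentially"
    using grid_index_bounds(1)[OF zero_less_Suc assms] by (intro always_eventually allI)
  show "eventually (\<lambda>n. grid (Suc n) (grid_index (Suc n) s) \<le> s + T / real (Suc n)) sequentially"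
    using grid_index_bounds(2)[OF zero_less_Suc assms] by (intro always_eventually allI)
qed

lemma L_right_limit:
  assumes "\<omega> \<in> space P" "0 \<le> s" "s \<le> T"
  shows "(\<lambda>n. L (grid (Suc n) (grid_index (Suc n) s)) \<omega>) \<longlonglongrightarrow> L s \<omega>"
proof (cases "s = T")
  case True
  have "grid (Suc n) (grid_index (Suc n) s) = T" for n
    using grid_index_bounds(1)[of "Suc n" s] grid_le_T[OF _ grid_index_le, of "Suc n" s] assms True by simp
  then show ?thesis using True by simp
next
  case False
  then have "continuous (at_right s) (\<lambda>t. L t \<omega>)"
    using paths[OF assms(1)] assms unfolding cadlag_on_def by auto
  then have "((\<lambda>t. L t \<omega>) \<longlongrightarrow> L s \<omega>) (at_right s)"
    by (simp add: continuous_within)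
  then have "continuous (at s within {s..}) (\<lambda>t. L t \<omega>)"
    by (simp add: continuous_within at_within_Ici_at_right)
  then show ?thesis
    by (rule continuous_within_tendsto_compose)
       (use grid_index_bounds(1)[OF _ assms(2)] grid_index_tendsto[OF assms(2)] in auto)
qed

lemma stopping_time_bounded:
  assumes "stopping_time F \<tau>" "0 \<le> t"
  shows "{\<omega>\<in>space P. min (\<tau> \<omega>) T \<le> t} \<in> sets (F t)"
proof (cases "t < T")
  case True
  then have "{\<omega>\<in>space P. min (\<tau> \<omega>) T \<le> t} = {\<omega>\<in>space P. \<tau> \<omega> \<le> t}" by auto
  then show ?thesis using stopping_timeD[OF assms(1), of t] by (simp add: pred_def)
next
  case False
  then have "{\<omega>\<in>space P. min (\<tau> \<omega>) T \<le> t} = space (F t)" by auto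
  then show ?thesis using sets.top by metis
qed

lemma measurable_bounded_stopping_time:
  assumes "stopping_time F \<tau>" shows "(\<lambda>\<omega>. min (\<tau> \<omega>) T) \<in> borel_measurable P"
proof (rule borel_measurableI_le)
  fix t
  show "{\<omega>\<in>space P. min (\<tau> \<omega>) T \<le> t} \<in> sets P"
  proof (cases "t < T")
    case True
    then have "{\<omega>\<in>space P. min (\<tau> \<omega>) T \<le> t} = {\<omega>\<in>space P. \<tau> \<omega> \<le> t}" by auto
    then have "{\<omega>\<in>space P. min (\<tau> \<omega>) T \<le> t} \<in> sets (F t)"
      using stopping_timeD[OF assms(1), of t] by (simp add: pred_def)
    then show ?thesis using True by (intro sets_F_le[of t]) auto
  next
    case False
    then have "{\<omega>\<in>space P. min (\<tau> \<omega>) T \<le> t} = space P" by auto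
    then show ?thesis by simp
  qed
qed

lemma grid_index_level_set:
  assumes "stopping_time F \<tau>" "0 < N"
  shows "{\<omega>\<in>space P. grid_index N (min (\<tau> \<omega>) T) = k} \<in> sets (F (grid N k))"
proof (cases k)
  case 0
  then show ?thesis
    using stopping_time_bounded[OF assms(1), of "grid N 0"] grid_index_le_iff[OF assms(2), of _ 0] by simp
next
  case (Suc j)
  have "grid_index N s = k \<longleftrightarrow> s \<le> grid N k \<and> \<not> s \<le> grid N j" for s
    unfolding grid_index_le_iff[OF assms(2), symmetric] Suc by auto
  then have "{\<omega>\<in>space P. grid_index N (min (\<tau> \<omega>) T) = k} =
    {\<omega>\<in>space P. min (\<tau> \<omega>) T \<le> grid N k} - {\<omega>\<in>space P. min (\<tau> \<omega>) T \<le> grid N j}" by auto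
  moreover have "{\<omega>\<in>space P. min (\<tau> \<omega>) T \<le> grid N j} \<in> sets (F (grid N k))"
    using F_mono[OF grid_mono stopping_time_bounded[OF assms(1)]] Suc by simp
  ultimately show ?thesis using stopping_time_bounded[OF assms(1), of "grid N k"] by auto
qed

text \<open>
  The stopped value is \<open>M k\<close> on the event that the rounded time is the \<open>k\<close>-th grid point. This event
  is known at that time, so \<open>M k\<close> may be replaced there by the terminal value \<open>M N\<close>.
\<close>
lemma optional_stopping_grid:
  fixes M :: "nat \<Rightarrow> 'a \<Rightarrow> 'b::{banach,second_countable_topology}"
  assumes tau: "stopping_time F \<tau>" and N: "0 < N"
    and int: "\<And>k. k \<le> N \<Longrightarrow> integrable P (M k)"
    and mart: "\<And>k A. k \<le> N \<Longrightarrow> A \<in> sets (F (grid N k)) \<Longrightarrow>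
      (\<integral>\<omega>. indicator A \<omega> *\<^sub>R M k \<omega> \<partial>P) = (\<integral>\<omega>. indicator A \<omega> *\<^sub>R M N \<omega> \<partial>P)"
  shows "integrable P (\<lambda>\<omega>. M (grid_index N (min (\<tau> \<omega>) T)) \<omega>)"
    and "(\<integral>\<omega>. M (grid_index N (min (\<tau> \<omega>) T)) \<omega> \<partial>P) = (\<integral>\<omega>. M N \<omega> \<partial>P)"
proof -
  define r where "r \<omega> = grid_index N (min (\<tau> \<omega>) T)" for \<omega>
  define E where "E k = {\<omega>\<in>space P. r \<omega> = k}" for k
  have EF: "E k \<in> sets (F (grid N k))" for k
    unfolding E_def r_def by (rule grid_index_level_set[OF tau N])
  have EP: "E k \<in> sets P" if "k \<le> N" for k
    by (rule sets_F_le[OF grid_le_T[OF N that] EF])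
  have split: "f (r \<omega>) = (\<Sum>k\<le>N. indicator (E k) \<omega> *\<^sub>R f k)"
    if "\<omega> \<in> space P" for \<omega> and f :: "nat \<Rightarrow> 'b"
  proof -
    have "(\<Sum>k\<le>N. indicator (E k) \<omega> *\<^sub>R f k) = (\<Sum>k\<le>N. if r \<omega> = k then f k else 0)"
      using that by (intro sum.cong) (auto simp: E_def)
    moreover have "r \<omega> \<le> N" unfolding r_def by (rule grid_index_le[OF N]) simp
    ultimately show ?thesis by simp
  qed
  have i: "integrable P (\<lambda>\<omega>. indicator (E k) \<omega> *\<^sub>R M l \<omega>)" if "k \<le> N" "l \<le> N" for k l
    using integrable_mult_indicator[OF EP[OF that(1)] int[OF that(2)]] .
  have "integrable P (\<lambda>\<omega>. \<Sum>k\<le>N. indicator (E k) \<omega> *\<^sub>R M k \<omega>)"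
    by (intro Bochner_Integration.integrable_sum i) auto
  then show "integrable P (\<lambda>\<omega>. M (grid_index N (min (\<tau> \<omega>) T)) \<omega>)"
    unfolding r_def[symmetric] by (subst Bochner_Integration.integrable_cong[OF refl split]) auto
  have "(\<integral>\<omega>. M (r \<omega>) \<omega> \<partial>P) = (\<integral>\<omega>. (\<Sum>k\<le>N. indicator (E k) \<omega> *\<^sub>R M k \<omega>) \<partial>P)"
    by (intro Bochner_Integration.integral_cong refl split)
  also have "\<dots> = (\<Sum>k\<le>N. \<integral>\<omega>. indicator (E k) \<omega> *\<^sub>R M k \<omega> \<partial>P)"
    by (intro Bochner_Integration.integral_sum i) auto
  also have "\<dots> = (\<Sum>k\<le>N. \<integral>\<omega>. indicator (E k) \<omega> *\<^sub>R M N \<omega> \<partial>P)"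
    by (intro sum.cong refl mart EF) auto
  also have "\<dots> = (\<integral>\<omega>. (\<Sum>k\<le>N. indicator (E k) \<omega> *\<^sub>R M N \<omega>) \<partial>P)"
    by (intro Bochner_Integration.integral_sum[symmetric] i) auto
  also have "\<dots> = (\<integral>\<omega>. M N \<omega> \<partial>P)"
    by (intro Bochner_Integration.integral_cong refl) (rule split[symmetric])
  finally show "(\<integral>\<omega>. M (grid_index N (min (\<tau> \<omega>) T)) \<omega> \<partial>P) = (\<integral>\<omega>. M N \<omega> \<partial>P)"
    unfolding r_def .
qed

lemma exp_moment_power:
  fixes z :: "'b::{real_normed_field,banach,second_countable_topology}"
  assumes int: "\<And>t. 0 \<le> t \<Longrightarrow> t \<le> T \<Longrightarrow> integrable P (\<lambda>\<omega>. exp (z * of_real (L t \<omega>)))"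
    and N: "0 < N" and "k \<le> N"
  shows "(\<integral>\<omega>. exp (z * of_real (L (grid N k) \<omega>)) \<partial>P) = (\<integral>\<omega>. exp (z * of_real (L (grid N 1) \<omega>)) \<partial>P) ^ k"
  using \<open>k \<le> N\<close>
proof (induction k)
  case 0
  have "(\<integral>\<omega>. exp (z * of_real (L (grid N 0) \<omega>)) \<partial>P) = (\<integral>\<omega>. 1 \<partial>P)"
    by (intro Bochner_Integration.integral_cong) (auto simp: grid_def L_0)
  then show ?case by (simp add: prob_space)
next
  case (Suc k)
  let ?s = "grid N k" and ?t = "grid N (Suc k)"
  have st: "0 \<le> ?s" "?s \<le> ?t" "?t \<le> T" "?s \<le> T" using grid_mono[of k "Suc k" N] grid_le_T[OF N Suc.prems] by auto
  have d: "?t - ?s = grid N 1" using grid_diff[of k "Suc k" N] by simp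
  have 1: "grid N 1 \<le> T" using N by (intro grid_le_T) auto
  note [measurable] = adapted[OF st(1,4)]
  have m: "(\<lambda>\<omega>. exp (z * of_real (L ?s \<omega>))) \<in> borel_measurable (F ?s)"
    by measurable
  have "(\<integral>\<omega>. exp (z * of_real (L ?t \<omega>)) \<partial>P) =
      (\<integral>\<omega>. exp (z * of_real (L ?s \<omega>)) * exp (z * of_real (L ?t \<omega> - L ?s \<omega>)) \<partial>P)"
    by (intro Bochner_Integration.integral_cong refl)
       (simp add: exp_add[symmetric] algebra_simps)
  also have "\<dots> = (\<integral>\<omega>. exp (z * of_real (L ?s \<omega>)) \<partial>P) * (\<integral>\<omega>. exp (z * of_real (L (?t - ?s) \<omega>)) \<partial>P)"
    using st 1 m by (intro integral_increment(2)) (auto intro!: int simp: d)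
  also have "\<dots> = (\<integral>\<omega>. exp (z * of_real (L (grid N 1) \<omega>)) \<partial>P) ^ Suc k"
    using Suc by (simp add: d)
  finally show ?case .
qed

text \<open>
  The field \<open>'b\<close> is \<open>real\<close> for exponential moments and \<open>complex\<close> for characteristic functions. All
  times are multiples of the first grid point, so the normalization there propagates to each of them.
\<close>
lemma exp_optional_stopping_grid:
  fixes z \<gamma> :: "'b::{real_normed_field,banach,second_countable_topology}"
  assumes tau: "stopping_time F \<tau>" and N: "0 < N"
    and int: "\<And>t. 0 \<le> t \<Longrightarrow> t \<le> T \<Longrightarrow> integrable P (\<lambda>\<omega>. exp (z * of_real (L t \<omega>)))"
    and gam: "(\<integral>\<omega>. exp (z * of_real (L (grid N 1) \<omega>)) \<partial>P) = exp (\<gamma> * of_real (grid N 1))"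
  defines "\<sigma> \<equiv> \<lambda>\<omega>. grid N (grid_index N (min (\<tau> \<omega>) T))"
  shows "integrable P (\<lambda>\<omega>. exp (z * of_real (L (\<sigma> \<omega>) \<omega>) - \<gamma> * of_real (\<sigma> \<omega>)))" (is ?I)
    and "(\<integral>\<omega>. exp (z * of_real (L (\<sigma> \<omega>) \<omega>) - \<gamma> * of_real (\<sigma> \<omega>)) \<partial>P) = 1" (is ?E)
proof -
  define M where "M k \<omega> = exp (z * of_real (L (grid N k) \<omega>) - \<gamma> * of_real (grid N k))" for k \<omega>
  have gk: "(\<integral>\<omega>. exp (z * of_real (L (grid N k) \<omega>)) \<partial>P) = exp (\<gamma> * of_real (grid N k))" if "k \<le> N" for k
  proof -
    have "exp (\<gamma> * of_real (grid N 1)) ^ k = exp (\<gamma> * of_real (grid N k))"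
      by (simp add: exp_of_nat_mult[symmetric] grid_def mult_ac)
    then show ?thesis using exp_moment_power[OF int N that] gam by simp
  qed
  have Mint: "integrable P (M k)" if "k \<le> N" for k
    unfolding M_def exp_diff using int[of "grid N k"] grid_le_T[OF N that] by simp
  have mart: "(\<integral>\<omega>. indicator A \<omega> *\<^sub>R M k \<omega> \<partial>P) = (\<integral>\<omega>. indicator A \<omega> *\<^sub>R M N \<omega> \<partial>P)"
    if k: "k \<le> N" and A: "A \<in> sets (F (grid N k))" for k A
  proof -
    let ?s = "grid N k"
    have st: "0 \<le> ?s" "?s \<le> T" "T \<le> T" using grid_le_T[OF N k] by auto
    have d: "T - ?s = grid N (N - k)" using grid_diff[OF k, of N] grid_top[OF N] by simp
    note [measurable] = adapted[OF st(1,2)] A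
    have m: "(\<lambda>\<omega>. indicator A \<omega> *\<^sub>R M k \<omega>) \<in> borel_measurable (F ?s)"
      unfolding M_def by measurable
    have AP: "A \<in> sets P" using A sets_F_le[OF st(2)] by blast
    have g1: "integrable P (\<lambda>\<omega>. exp (z * of_real (L (T - ?s) \<omega>) - \<gamma> * of_real (T - ?s)))"
      using int[of "T - ?s"] st by (simp add: exp_diff)
    have gm: "(\<lambda>x. exp (z * of_real x - \<gamma> * of_real (T - ?s))) \<in> borel_measurable borel"
      by measurable
    have g2: "(\<integral>\<omega>. exp (z * of_real (L (T - ?s) \<omega>) - \<gamma> * of_real (T - ?s)) \<partial>P) = 1"
      unfolding exp_diff d using gk[of "N - k"] by simp
    have "(\<integral>\<omega>. indicator A \<omega> *\<^sub>R M N \<omega> \<partial>P) = (\<integral>\<omega>. (indicator A \<omega> *\<^sub>R M k \<omega>) *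
        exp (z * of_real (L T \<omega> - L ?s \<omega>) - \<gamma> * of_real (T - ?s)) \<partial>P)"
    proof (intro Bochner_Integration.integral_cong refl)
      fix \<omega>
      have "M N \<omega> = M k \<omega> * exp (z * of_real (L T \<omega> - L ?s \<omega>) - \<gamma> * of_real (T - ?s))"
        unfolding M_def exp_add[symmetric] grid_top[OF N] by (rule arg_cong[of _ _ exp]) (simp add: algebra_simps)
      then show "indicator A \<omega> *\<^sub>R M N \<omega> = (indicator A \<omega> *\<^sub>R M k \<omega>) *
        exp (z * of_real (L T \<omega> - L ?s \<omega>) - \<gamma> * of_real (T - ?s))"
        unfolding mult_scaleR_left by (rule arg_cong)
    qed
    also have "\<dots> = (\<integral>\<omega>. indicator A \<omega> *\<^sub>R M k \<omega> \<partial>P) *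
        (\<integral>\<omega>. exp (z * of_real (L (T - ?s) \<omega>) - \<gamma> * of_real (T - ?s)) \<partial>P)"
      by (rule integral_increment(2)[OF st m integrable_mult_indicator[OF AP Mint[OF k]] gm g1])
    finally show ?thesis unfolding g2 by simp
  qed
  have eq: "(\<lambda>\<omega>. exp (z * of_real (L (\<sigma> \<omega>) \<omega>) - \<gamma> * of_real (\<sigma> \<omega>))) =
    (\<lambda>\<omega>. M (grid_index N (min (\<tau> \<omega>) T)) \<omega>)" by (simp add: M_def \<sigma>_def)
  show ?I unfolding eq by (rule optional_stopping_grid(1)[where M=M, OF tau N Mint mart])
  have 1: "(\<integral>\<omega>. M N \<omega> \<partial>P) = 1"
    unfolding M_def exp_diff using gk[of N] by simp
  show ?E unfolding eq by (rule trans[OF optional_stopping_grid(2)[where M=M, OF tau N Mint mart] 1])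
qed

end

section \<open>The entropy lower bound\<close>

text \<open>
  The Gibbs variational inequality with a remainder. It comes from
  \<open>z ln z - z x - z + exp x \<ge> (sqrt z - exp (x / 2))\<^sup>2\<close>, that is, from \<open>ln y \<le> y - 1\<close> at
  \<open>y = exp (x / 2) / sqrt z\<close>. The remainder is what identifies the minimizer later.
\<close>
lemma (in prob_space) entropy_gap:
  fixes Z X :: "'a \<Rightarrow> real"
  assumes Z: "\<And>\<omega>. 0 \<le> Z \<omega>" "integrable M Z" "(\<integral>\<omega>. Z \<omega> \<partial>M) = 1"
      "integrable M (\<lambda>\<omega>. Z \<omega> * ln (Z \<omega>))"
    and X: "X \<in> borel_measurable M" "(\<integral>\<^sup>+\<omega>. ennreal (exp (X \<omega>)) \<partial>M) \<le> 1"
      "integrable M (\<lambda>\<omega>. Z \<omega> * X \<omega>)"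
  shows "(\<integral>\<^sup>+\<omega>. ennreal ((sqrt (Z \<omega>) - exp (X \<omega> / 2))\<^sup>2) \<partial>M)
      \<le> ennreal ((\<integral>\<omega>. Z \<omega> * ln (Z \<omega>) \<partial>M) - (\<integral>\<omega>. Z \<omega> * X \<omega> \<partial>M))" (is ?A)
    and "(\<integral>\<omega>. Z \<omega> * X \<omega> \<partial>M) \<le> (\<integral>\<omega>. Z \<omega> * ln (Z \<omega>) \<partial>M)" (is ?B)
proof -
  \<comment> \<open>the integrand of the gap, plus \<open>exp X - Z\<close>, whose mean is at most \<open>0\<close>\<close>
  define h where "h \<omega> = Z \<omega> * ln (Z \<omega>) - Z \<omega> * X \<omega> - Z \<omega> + exp (X \<omega>)" for \<omega>
  have pt: "(sqrt (Z \<omega>) - exp (X \<omega> / 2))\<^sup>2 \<le> h \<omega>" for \<omega>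
  proof (cases "Z \<omega> = 0")
    case True
    have "exp (X \<omega>) = (exp (X \<omega> / 2))\<^sup>2" by (simp add: power2_eq_square exp_add[symmetric])
    then show ?thesis by (simp add: h_def True)
  next
    case False
    define a where "a = sqrt (Z \<omega>)" define b where "b = exp (X \<omega> / 2)"
    have a: "a > 0" and b: "b > 0" using False Z(1)[of \<omega>] by (auto simp: a_def b_def less_le)
    have e: "Z \<omega> = a\<^sup>2" "exp (X \<omega>) = b\<^sup>2" "X \<omega> = 2 * ln b"
      using Z(1)[of \<omega>] by (auto simp: a_def b_def power2_eq_square exp_add[symmetric])
    have l: "ln (a\<^sup>2) = 2 * ln a" using a by (simp add: ln_realpow)
    have "ln (b / a) \<le> b / a - 1" using a b by (intro ln_le_minus_one) simp
    then have "2 * a\<^sup>2 * (ln b - ln a) \<le> 2 * a\<^sup>2 * (b / a - 1)"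
      using a b by (intro mult_left_mono) (auto simp: ln_div)
    also have "\<dots> = 2 * a * b - 2 * a\<^sup>2" using a by (simp add: field_simps power2_eq_square)
    finally have "2 * a\<^sup>2 * (ln b - ln a) \<le> 2 * a * b - 2 * a\<^sup>2" .
    then have "(a - b)\<^sup>2 \<le> a\<^sup>2 * (2 * ln a) - a\<^sup>2 * (2 * ln b) - a\<^sup>2 + b\<^sup>2"
      by (simp add: power2_diff algebra_simps)
    moreover have "h \<omega> = a\<^sup>2 * (2 * ln a) - a\<^sup>2 * (2 * ln b) - a\<^sup>2 + b\<^sup>2"
      unfolding h_def e(2) unfolding e(1) l e(3) by simp
    ultimately show ?thesis by (simp add: a_def b_def)
  qed
  have h0: "0 \<le> h \<omega>" for \<omega> using pt[of \<omega>] zero_le_power2 order_trans by blast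
  have ie: "integrable M (\<lambda>\<omega>. exp (X \<omega>))"
  proof (rule integrableI_nonneg)
    show "(\<integral>\<^sup>+\<omega>. ennreal (exp (X \<omega>)) \<partial>M) < \<infinity>"
      using X(2) by (rule le_less_trans) simp
  qed (use X(1) in auto)
  have "ennreal (\<integral>\<omega>. exp (X \<omega>) \<partial>M) \<le> ennreal 1"
    using X(2) by (subst nn_integral_eq_integral[OF ie, symmetric]) auto
  then have e1: "(\<integral>\<omega>. exp (X \<omega>) \<partial>M) \<le> 1" by (simp del: ennreal_1)
  have ih: "integrable M h" unfolding h_def using Z X ie by auto
  have "(\<integral>\<omega>. h \<omega> \<partial>M) = (\<integral>\<omega>. Z \<omega> * ln (Z \<omega>) \<partial>M) - (\<integral>\<omega>. Z \<omega> * X \<omega> \<partial>M) - 1 + (\<integral>\<omega>. exp (X \<omega>) \<partial>M)"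
    unfolding h_def using Z X ie by simp
  with e1 have hle: "(\<integral>\<omega>. h \<omega> \<partial>M) \<le> (\<integral>\<omega>. Z \<omega> * ln (Z \<omega>) \<partial>M) - (\<integral>\<omega>. Z \<omega> * X \<omega> \<partial>M)"
    by simp
  have "0 \<le> (\<integral>\<omega>. h \<omega> \<partial>M)" using h0 by simp
  with hle show ?B by linarith
  have "(\<integral>\<^sup>+\<omega>. ennreal ((sqrt (Z \<omega>) - exp (X \<omega> / 2))\<^sup>2) \<partial>M) \<le> (\<integral>\<^sup>+\<omega>. ennreal (h \<omega>) \<partial>M)"
    by (intro nn_integral_mono ennreal_leI pt)
  also have "\<dots> = ennreal (\<integral>\<omega>. h \<omega> \<partial>M)" by (rule nn_integral_eq_integral[OF ih]) (simp add: h0)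
  also have "\<dots> \<le> ennreal ((\<integral>\<omega>. Z \<omega> * ln (Z \<omega>) \<partial>M) - (\<integral>\<omega>. Z \<omega> * X \<omega> \<partial>M))"
    using hle by (rule ennreal_leI)
  finally show ?A .
qed

text \<open>
  What local martingale measures and measures with the local moment condition have in common, and the
  only property of the class that the entropy bound uses.
\<close>
definition zero_mean_localization ::
    "'a measure \<Rightarrow> (real \<Rightarrow> 'a measure) \<Rightarrow> real \<Rightarrow> (real \<Rightarrow> 'a \<Rightarrow> real) \<Rightarrow> (nat \<Rightarrow> 'a \<Rightarrow> real) \<Rightarrow> bool" where
  "zero_mean_localization Q F T L \<tau> \<longleftrightarrow>
     (\<forall>k. stopping_time F (\<tau> k) \<and> (\<forall>\<omega>\<in>space Q. 0 \<le> \<tau> k \<omega>)) \<and>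
     (AE \<omega> in Q. eventually (\<lambda>k. T \<le> \<tau> k \<omega>) sequentially) \<and>
     (\<forall>k. integrable Q (\<lambda>\<omega>. L (min (\<tau> k \<omega>) T) \<omega>) \<and> (\<integral>\<omega>. L (min (\<tau> k \<omega>) T) \<omega> \<partial>Q) = 0)"

context levy_horizon
begin

text \<open>
  \<open>E[exp (\<kappa> L\<^sub>T)]\<close> is the product of \<open>E[exp (\<kappa> L\<^sub>t)]\<close> and the positive number
  \<open>E[exp (\<kappa> L\<^sub>T\<^sub>-\<^sub>t)]\<close>.
\<close>
lemma exp_moment_finite:
  fixes \<kappa> :: real
  assumes int: "integrable P (\<lambda>\<omega>. exp (\<kappa> * L T \<omega>))" and t: "0 \<le> t" "t \<le> T"
  shows "integrable P (\<lambda>\<omega>. exp (\<kappa> * L t \<omega>))"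
proof -
  note [measurable] = adapted[OF t] L_measurable[OF t]
  have m2: "L (T - t) \<in> borel_measurable P" using t by (intro L_measurable) auto
  have m: "(\<lambda>\<omega>. ennreal (exp (\<kappa> * L t \<omega>))) \<in> borel_measurable (F t)"
    by measurable
  have "(\<integral>\<^sup>+\<omega>. ennreal (exp (\<kappa> * L T \<omega>)) \<partial>P) =
      (\<integral>\<^sup>+\<omega>. ennreal (exp (\<kappa> * L t \<omega>)) * ennreal (exp (\<kappa> * (L T \<omega> - L t \<omega>))) \<partial>P)"
    by (intro nn_integral_cong) (simp add: ennreal_mult[symmetric] exp_add[symmetric] algebra_simps)
  also have "\<dots> = (\<integral>\<^sup>+\<omega>. ennreal (exp (\<kappa> * L t \<omega>)) \<partial>P) * (\<integral>\<^sup>+\<omega>. ennreal (exp (\<kappa> * L (T - t) \<omega>)) \<partial>P)"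
    using t m by (intro nn_integral_increment) auto
  finally have eq: "(\<integral>\<^sup>+\<omega>. ennreal (exp (\<kappa> * L t \<omega>)) \<partial>P) * (\<integral>\<^sup>+\<omega>. ennreal (exp (\<kappa> * L (T - t) \<omega>)) \<partial>P)
      = (\<integral>\<^sup>+\<omega>. ennreal (exp (\<kappa> * L T \<omega>)) \<partial>P)" ..
  have fin: "(\<integral>\<^sup>+\<omega>. ennreal (exp (\<kappa> * L T \<omega>)) \<partial>P) < \<infinity>"
    using nn_integral_eq_integral[OF int] by simp
  have "(\<integral>\<^sup>+\<omega>. ennreal (exp (\<kappa> * L (T - t) \<omega>)) \<partial>P) \<noteq> 0"
  proof
    assume "(\<integral>\<^sup>+\<omega>. ennreal (exp (\<kappa> * L (T - t) \<omega>)) \<partial>P) = 0"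
    then have "AE \<omega> in P. ennreal (exp (\<kappa> * L (T - t) \<omega>)) = 0"
      using m2 by (subst (asm) nn_integral_0_iff_AE) auto
    then have "AE \<omega> in P. False" by eventually_elim (simp add: ennreal_eq_0_iff not_le)
    then show False using emeasure_space_1 by (simp add: AE_False)
  qed
  with eq fin have "(\<integral>\<^sup>+\<omega>. ennreal (exp (\<kappa> * L t \<omega>)) \<partial>P) \<noteq> top"
    by (auto simp: ennreal_top_mult)
  then show ?thesis by (intro integrableI_nonneg) (auto simp: less_top)
qed

definition mgf :: "real \<Rightarrow> real" where
  "mgf \<kappa> = (\<integral>\<omega>. exp (\<kappa> * L T \<omega>) \<partial>P)"

lemma mgf_pos:
  assumes int: "integrable P (\<lambda>\<omega>. exp (\<kappa> * L T \<omega>))" shows "0 < mgf \<kappa>"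
proof -
  have "mgf \<kappa> \<noteq> 0"
  proof
    assume "mgf \<kappa> = 0"
    then have "AE \<omega> in P. exp (\<kappa> * L T \<omega>) = 0"
      unfolding mgf_def using integral_nonneg_eq_0_iff_AE[OF int] by simp
    then have "AE \<omega> in P. False" by eventually_elim simp
    then show False using emeasure_space_1 by (simp add: AE_False)
  qed
  moreover have "0 \<le> mgf \<kappa>" unfolding mgf_def by simp
  ultimately show ?thesis by simp
qed

definition cumulant_rate :: "real \<Rightarrow> real" where
  "cumulant_rate \<kappa> = ln (mgf \<kappa>) / T"

lemma exp_moment_grid:
  assumes int: "integrable P (\<lambda>\<omega>. exp (\<kappa> * L T \<omega>))" and N: "0 < N"
  shows "(\<integral>\<omega>. exp (\<kappa> * L (grid N 1) \<omega>) \<partial>P) = exp (cumulant_rate \<kappa> * grid N 1)"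
proof (rule power_eq_imp_eq_base[OF _ _ _ N])
  have "(\<integral>\<omega>. exp (\<kappa> * L (grid N 1) \<omega>) \<partial>P) ^ N = (\<integral>\<omega>. exp (\<kappa> * L (grid N N) \<omega>) \<partial>P)"
    using exp_moment_power[of \<kappa> N N] exp_moment_finite[OF int] N by simp
  also have "\<dots> = exp (cumulant_rate \<kappa> * T)"
    using mgf_pos[OF int] T_pos grid_top[OF N] by (simp add: cumulant_rate_def mgf_def)
  also have "\<dots> = exp (cumulant_rate \<kappa> * grid N 1) ^ N"
    using N by (simp add: exp_of_nat_mult[symmetric] grid_def)
  finally show "(\<integral>\<omega>. exp (\<kappa> * L (grid N 1) \<omega>) \<partial>P) ^ N = exp (cumulant_rate \<kappa> * grid N 1) ^ N" .
qed auto

lemma L_stopped_measurable: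
  assumes tau: "stopping_time F \<tau>" and nn: "\<And>\<omega>. \<omega> \<in> space P \<Longrightarrow> 0 \<le> \<tau> \<omega>"
  shows "(\<lambda>\<omega>. L (min (\<tau> \<omega>) T) \<omega>) \<in> borel_measurable P"
proof (rule borel_measurable_LIMSEQ_real)
  fix \<omega> assume "\<omega> \<in> space P"
  then show "(\<lambda>n. L (grid (Suc n) (grid_index (Suc n) (min (\<tau> \<omega>) T))) \<omega>) \<longlonglongrightarrow> L (min (\<tau> \<omega>) T) \<omega>"
    using nn T_pos by (intro L_right_limit) auto
next
  fix n
  let ?N = "Suc n"
  note [measurable] = measurable_bounded_stopping_time[OF tau]
  have [measurable]: "L (grid ?N (min k ?N)) \<in> borel_measurable P" for k
    by (intro L_measurable grid_le_T) auto
  have 1: "(\<lambda>\<omega>. grid_index ?N (min (\<tau> \<omega>) T)) \<in> measurable P (count_space UNIV)"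
    unfolding grid_index_def by measurable
  have "(\<lambda>\<omega>. L (grid ?N (min (grid_index ?N (min (\<tau> \<omega>) T)) ?N)) \<omega>) \<in> borel_measurable P"
    by (rule measurable_compose_countable[OF _ 1]) measurable
  moreover have "min (grid_index ?N (min (\<tau> \<omega>) T)) ?N = grid_index ?N (min (\<tau> \<omega>) T)" for \<omega>
    using grid_index_le[of ?N "min (\<tau> \<omega>) T"] by simp
  ultimately show "(\<lambda>\<omega>. L (grid (Suc n) (grid_index (Suc n) (min (\<tau> \<omega>) T))) \<omega>) \<in> borel_measurable P"
    by simp
qed

text \<open>
  Fatou's lemma along the rounded times turns their equalities into an upper bound, which is the
  direction that the variational inequality asks for.
\<close>
lemma exp_optional_stopping_le:
  assumes int: "integrable P (\<lambda>\<omega>. exp (\<kappa> * L T \<omega>))"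
    and tau: "stopping_time F \<tau>" and nn: "\<And>\<omega>. \<omega> \<in> space P \<Longrightarrow> 0 \<le> \<tau> \<omega>"
  shows "(\<integral>\<^sup>+\<omega>. ennreal (exp (\<kappa> * L (min (\<tau> \<omega>) T) \<omega> - cumulant_rate \<kappa> * min (\<tau> \<omega>) T)) \<partial>P) \<le> 1"
proof -
  define s where "s n \<omega> = grid (Suc n) (grid_index (Suc n) (min (\<tau> \<omega>) T))" for n \<omega>
  define u where "u n \<omega> = ennreal (exp (\<kappa> * L (s n \<omega>) \<omega> - cumulant_rate \<kappa> * s n \<omega>))" for n \<omega>
  have i: "integrable P (\<lambda>\<omega>. exp (\<kappa> * L (s n \<omega>) \<omega> - cumulant_rate \<kappa> * s n \<omega>))"
    and e: "(\<integral>\<omega>. exp (\<kappa> * L (s n \<omega>) \<omega> - cumulant_rate \<kappa> * s n \<omega>) \<partial>P) = 1" for n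
    using exp_optional_stopping_grid[OF tau zero_less_Suc, of \<kappa> n "cumulant_rate \<kappa>"]
      exp_moment_finite[OF int] exp_moment_grid[OF int zero_less_Suc, of n]
    unfolding s_def by simp_all
  have u1: "(\<integral>\<^sup>+\<omega>. u n \<omega> \<partial>P) = 1" for n
    unfolding u_def using nn_integral_eq_integral[OF i] e by simp
  have um: "u n \<in> borel_measurable P" for n
    unfolding u_def using borel_measurable_integrable[OF i] by simp
  have lim: "liminf (\<lambda>n. u n \<omega>) = ennreal (exp (\<kappa> * L (min (\<tau> \<omega>) T) \<omega> - cumulant_rate \<kappa> * min (\<tau> \<omega>) T))"
    if "\<omega> \<in> space P" for \<omega>
  proof (rule lim_imp_Liminf)
    have "0 \<le> min (\<tau> \<omega>) T" using nn[OF that] T_pos by simp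
    then show "(\<lambda>n. u n \<omega>) \<longlonglongrightarrow> ennreal (exp (\<kappa> * L (min (\<tau> \<omega>) T) \<omega> - cumulant_rate \<kappa> * min (\<tau> \<omega>) T))"
      unfolding u_def s_def
      by (intro tendsto_intros tendsto_ennrealI L_right_limit[OF that] grid_index_tendsto) auto
  qed simp
  have "(\<integral>\<^sup>+\<omega>. liminf (\<lambda>n. u n \<omega>) \<partial>P) \<le> liminf (\<lambda>n. \<integral>\<^sup>+\<omega>. u n \<omega> \<partial>P)"
    by (rule nn_integral_liminf[OF um])
  also have "\<dots> = 1" using u1 by (simp add: Liminf_const)
  finally show ?thesis using lim by (simp cong: nn_integral_cong_simp)
qed

lemma localization_mean_time:
  assumes "prob_space Q" "sets Q = sets P" and loc: "zero_mean_localization Q F T L \<tau>"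
  shows "(\<lambda>k. \<integral>\<omega>. min (\<tau> k \<omega>) T \<partial>Q) \<longlonglongrightarrow> T"
proof -
  interpret Q: prob_space Q by fact
  have [simp]: "space Q = space P" using assms(2) by (rule sets_eq_imp_space_eq)
  have [measurable_cong]: "sets Q = sets P" by fact
  have "(\<lambda>k. \<integral>\<omega>. min (\<tau> k \<omega>) T \<partial>Q) \<longlonglongrightarrow> (\<integral>\<omega>. T \<partial>Q)"
  proof (rule integral_dominated_convergence[where w="\<lambda>_. T"])
    show "(\<lambda>\<omega>. min (\<tau> k \<omega>) T) \<in> borel_measurable Q" for k
      using measurable_bounded_stopping_time[of "\<tau> k"] loc by (simp add: zero_mean_localization_def)
    have "AE \<omega> in Q. eventually (\<lambda>k. T \<le> \<tau> k \<omega>) sequentially"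
      using loc by (simp add: zero_mean_localization_def)
    then show "AE \<omega> in Q. (\<lambda>k. min (\<tau> k \<omega>) T) \<longlonglongrightarrow> T"
      by eventually_elim (rule tendsto_eventually, erule eventually_mono, simp)
    show "AE \<omega> in Q. norm (min (\<tau> k \<omega>) T) \<le> T" for k
      using loc T_pos by (intro AE_I2) (auto simp: zero_mean_localization_def)
  qed auto
  moreover have "Q.prob (space P) = 1" using Q.prob_space by simp
  ultimately show ?thesis by simp
qed

text \<open>
  Apply \<open>entropy_gap\<close> with \<open>X\<^sub>k = \<kappa> L - c t\<close> taken at the localizing times. Its right-hand side tends
  to \<open>I + ln (mgf \<kappa>)\<close>, where \<open>I\<close> is the entropy, which gives the bound. If the limit is \<open>0\<close>, then so
  is the limit of the squared distances on the left, and \<open>Z\<close> agrees with the Esscher density \<open>W\<close>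
  wherever \<open>Z > 0\<close>, because there the localizing times do reach \<open>T\<close>. As \<open>Z\<close> and \<open>W\<close> have the same
  integral, they agree almost everywhere.
\<close>
lemma entropy_core:
  fixes Z :: "'a \<Rightarrow> real"
  assumes int: "integrable P (\<lambda>\<omega>. exp (\<kappa> * L T \<omega>))"
    and Zm [measurable]: "Z \<in> borel_measurable P" and Z0: "\<And>\<omega>. 0 \<le> Z \<omega>"
    and Q: "prob_space (density P Z)"
    and ent: "integrable P (\<lambda>\<omega>. Z \<omega> * ln (Z \<omega>))"
    and loc: "zero_mean_localization (density P Z) F T L \<tau>"
  shows "- ln (mgf \<kappa>) \<le> (\<integral>\<omega>. Z \<omega> * ln (Z \<omega>) \<partial>P)"
    and "(\<integral>\<omega>. Z \<omega> * ln (Z \<omega>) \<partial>P) \<le> - ln (mgf \<kappa>) \<Longrightarrow> AE \<omega> in P. Z \<omega> = exp (\<kappa> * L T \<omega>) / mgf \<kappa>"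
proof -
  define I where "I = (\<integral>\<omega>. Z \<omega> * ln (Z \<omega>) \<partial>P)"
  define c where "c = cumulant_rate \<kappa>"
  let ?Q = "density P Z"
  interpret Q: prob_space ?Q by fact
  have tau: "stopping_time F (\<tau> k)" "\<And>\<omega>. \<omega> \<in> space P \<Longrightarrow> 0 \<le> \<tau> k \<omega>"
    and Lint: "integrable ?Q (\<lambda>\<omega>. L (min (\<tau> k \<omega>) T) \<omega>)" "(\<integral>\<omega>. L (min (\<tau> k \<omega>) T) \<omega> \<partial>?Q) = 0" for k
    using loc by (auto simp: zero_mean_localization_def)
  have ev: "AE \<omega> in ?Q. eventually (\<lambda>k. T \<le> \<tau> k \<omega>) sequentially"
    using loc by (simp add: zero_mean_localization_def)
  have cT: "c * T = ln (mgf \<kappa>)" using T_pos by (simp add: c_def cumulant_rate_def)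
  note mp = mgf_pos[OF int]
  have Z1n: "(\<integral>\<^sup>+\<omega>. ennreal (Z \<omega>) \<partial>P) = 1"
    using Q.emeasure_space_1 by (simp add: emeasure_density cong: nn_integral_cong_simp)
  have Zi: "integrable P Z" using Z0 Z1n by (intro integrableI_nonneg) auto
  have Z1: "(\<integral>\<omega>. Z \<omega> \<partial>P) = 1"
    using nn_integral_eq_integral[OF Zi] Z0 Z1n Bochner_Integration.integral_nonneg[of P Z] by simp
  define X where "X k \<omega> = \<kappa> * L (min (\<tau> k \<omega>) T) \<omega> - c * min (\<tau> k \<omega>) T" for k \<omega>
  have Xm [measurable]: "X k \<in> borel_measurable P" for k
    unfolding X_def using L_stopped_measurable[OF tau] measurable_bounded_stopping_time[OF tau(1)]
    by measurable
  have mi: "integrable ?Q (\<lambda>\<omega>. min (\<tau> k \<omega>) T)" for k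
  proof (rule Q.integrable_const_bound[where B=T])
    show "AE \<omega> in ?Q. norm (min (\<tau> k \<omega>) T) \<le> T"
      using tau(2) T_pos by (intro AE_I2) auto
    show "(\<lambda>\<omega>. min (\<tau> k \<omega>) T) \<in> borel_measurable ?Q"
      using measurable_bounded_stopping_time[OF tau(1)] by simp
  qed
  have XiQ: "integrable ?Q (X k)" for k
    unfolding X_def using Lint mi by auto
  have XeQ: "(\<integral>\<omega>. X k \<omega> \<partial>?Q) = - c * (\<integral>\<omega>. min (\<tau> k \<omega>) T \<partial>?Q)" for k
    unfolding X_def using Lint mi by simp
  have Xi: "integrable P (\<lambda>\<omega>. Z \<omega> * X k \<omega>)" for k
    using XiQ[of k] Z0 by (subst (asm) integrable_real_density) auto
  have Xe: "(\<integral>\<omega>. Z \<omega> * X k \<omega> \<partial>P) = - c * (\<integral>\<omega>. min (\<tau> k \<omega>) T \<partial>?Q)" for k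
    using XeQ[of k] Z0 by (subst (asm) integral_real_density) auto
  have X1: "(\<integral>\<^sup>+\<omega>. ennreal (exp (X k \<omega>)) \<partial>P) \<le> 1" for k
    unfolding X_def c_def using exp_optional_stopping_le[OF int tau] .
  note gap = entropy_gap[OF Z0 Zi Z1 ent Xm X1 Xi, folded I_def, unfolded Xe]
  have lim: "(\<lambda>k. I - - c * (\<integral>\<omega>. min (\<tau> k \<omega>) T \<partial>?Q)) \<longlonglongrightarrow> I - - c * T"
    by (intro tendsto_intros localization_mean_time Q loc) simp
  have "0 \<le> I - - c * (\<integral>\<omega>. min (\<tau> k \<omega>) T \<partial>?Q)" for k using gap(2)[of k] by simp
  then have "0 \<le> I - - c * T"
    by (intro LIMSEQ_le_const[OF lim]) blast
  then show "- ln (mgf \<kappa>) \<le> (\<integral>\<omega>. Z \<omega> * ln (Z \<omega>) \<partial>P)"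
    unfolding I_def[symmetric] using cT by simp
  show "AE \<omega> in P. Z \<omega> = exp (\<kappa> * L T \<omega>) / mgf \<kappa>" if "(\<integral>\<omega>. Z \<omega> * ln (Z \<omega>) \<partial>P) \<le> - ln (mgf \<kappa>)"
  proof -
    have I0: "I - - c * T = 0" using that \<open>0 \<le> I - - c * T\<close> cT unfolding I_def[symmetric] by simp
    define u where "u k \<omega> = ennreal ((sqrt (Z \<omega>) - exp (X k \<omega> / 2))\<^sup>2)" for k \<omega>
    have um [measurable]: "u k \<in> borel_measurable P" for k unfolding u_def by measurable
    have "(\<integral>\<^sup>+\<omega>. liminf (\<lambda>k. u k \<omega>) \<partial>P) \<le> liminf (\<lambda>k. \<integral>\<^sup>+\<omega>. u k \<omega> \<partial>P)"
      by (rule nn_integral_liminf[OF um])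
    also have "\<dots> \<le> liminf (\<lambda>k. ennreal (I - - c * (\<integral>\<omega>. min (\<tau> k \<omega>) T \<partial>?Q)))"
      unfolding u_def by (intro Liminf_mono always_eventually allI gap(1))
    also have "\<dots> = 0"
      using tendsto_ennrealI[OF lim] I0 by (intro lim_imp_Liminf) auto
    finally have "(\<integral>\<^sup>+\<omega>. liminf (\<lambda>k. u k \<omega>) \<partial>P) = 0" by simp
    then have u0: "AE \<omega> in P. liminf (\<lambda>k. u k \<omega>) = 0"
      by (subst (asm) nn_integral_0_iff_AE) auto
    have ev': "AE \<omega> in P. 0 < Z \<omega> \<longrightarrow> eventually (\<lambda>k. T \<le> \<tau> k \<omega>) sequentially"
      using ev by (subst (asm) AE_density) auto
    define W where "W \<omega> = exp (\<kappa> * L T \<omega>) / mgf \<kappa>" for \<omega>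
    have W: "W \<omega> = exp (\<kappa> * L T \<omega> - c * T)" for \<omega>
      unfolding W_def exp_diff cT using mp by simp
    have Wi: "integrable P W" and W1: "(\<integral>\<omega>. W \<omega> \<partial>P) = 1"
      unfolding W_def using int mp by (auto simp: mgf_def)
    have le: "AE \<omega> in P. Z \<omega> \<le> W \<omega>"
      using u0 ev'
    proof eventually_elim
      case (elim \<omega>)
      show ?case
      proof (cases "0 < Z \<omega>")
        case True
        have "eventually (\<lambda>k. u k \<omega> = ennreal ((sqrt (Z \<omega>) - exp ((\<kappa> * L T \<omega> - c * T) / 2))\<^sup>2)) sequentially"
          using elim(2)[rule_format, OF True] by eventually_elim (simp add: u_def X_def min_absorb2)
        then have "liminf (\<lambda>k. u k \<omega>) = ennreal ((sqrt (Z \<omega>) - exp ((\<kappa> * L T \<omega> - c * T) / 2))\<^sup>2)"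
          by (intro lim_imp_Liminf tendsto_eventually) auto
        with elim(1) have "sqrt (Z \<omega>) = exp ((\<kappa> * L T \<omega> - c * T) / 2)"
          by (simp add: ennreal_eq_0_iff)
        then have "(sqrt (Z \<omega>))\<^sup>2 = (exp ((\<kappa> * L T \<omega> - c * T) / 2))\<^sup>2" by simp
        then have "Z \<omega> = exp (\<kappa> * L T \<omega> - c * T)"
          using Z0[of \<omega>] by (simp add: exp_double[symmetric])
        then show ?thesis by (simp add: W)
      next
        case False
        then have "Z \<omega> = 0" using Z0[of \<omega>] by simp
        then show ?thesis by (simp add: W)
      qed
    qed
    have "(\<integral>\<omega>. W \<omega> - Z \<omega> \<partial>P) = 0" using Wi Zi W1 Z1 by simp
    then have "AE \<omega> in P. W \<omega> - Z \<omega> = 0"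
      using integral_nonneg_eq_0_iff_AE[of P "\<lambda>\<omega>. W \<omega> - Z \<omega>"] Wi Zi le by auto
    then show ?thesis unfolding W_def by eventually_elim simp
  qed
qed

end

section \<open>Members of the class and their localizing times\<close>

lemma (in prob_space) rel_entropy_density:
  assumes [measurable]: "Z \<in> borel_measurable M" and Z0: "\<And>\<omega>. 0 \<le> Z \<omega>"
    and ent: "integrable M (\<lambda>\<omega>. Z \<omega> * ln (Z \<omega>))"
  shows "rel_entropy (density M (\<lambda>\<omega>. ennreal (Z \<omega>))) M = ereal (\<integral>\<omega>. Z \<omega> * ln (Z \<omega>) \<partial>M)"
proof -
  let ?Q = "density M (\<lambda>\<omega>. ennreal (Z \<omega>))"
  define R where "R \<omega> = enn2real (RN_deriv M ?Q \<omega>)" for \<omega>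
  have [measurable]: "R \<in> borel_measurable M" unfolding R_def by measurable
  have "AE \<omega> in M. ennreal (Z \<omega>) = RN_deriv M ?Q \<omega>"
    by (rule RN_deriv_unique) auto
  then have ae: "AE \<omega> in M. Z \<omega> * ln (Z \<omega>) = R \<omega> * ln (R \<omega>)"
    by eventually_elim (metis R_def Z0 enn2real_ennreal)
  have "integrable M (\<lambda>\<omega>. R \<omega> * ln (R \<omega>))"
    using ent by (subst (asm) integrable_cong_AE[OF _ _ ae]) auto
  moreover have "(\<integral>\<omega>. R \<omega> * ln (R \<omega>) \<partial>M) = (\<integral>\<omega>. Z \<omega> * ln (Z \<omega>) \<partial>M)"
    using ae by (intro integral_cong_AE) auto
  moreover have "absolutely_continuous M ?Q" by (rule absolutely_continuousI_density) simp
  ultimately show ?thesis unfolding rel_entropy_def Let_def R_def[symmetric] by simp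
qed

lemma (in prob_space) finite_rel_entropy_densityE:
  assumes Q: "prob_space Q" "sets Q = sets M" and fin: "rel_entropy Q M < \<infinity>"
  obtains Z :: "'a \<Rightarrow> real" where "Z \<in> borel_measurable M" "\<And>\<omega>. 0 \<le> Z \<omega>"
    "Q = density M (\<lambda>\<omega>. ennreal (Z \<omega>))" "integrable M (\<lambda>\<omega>. Z \<omega> * ln (Z \<omega>))"
    "rel_entropy Q M = ereal (\<integral>\<omega>. Z \<omega> * ln (Z \<omega>) \<partial>M)"
proof -
  interpret Q: prob_space Q by fact
  define Z where "Z \<omega> = enn2real (RN_deriv M Q \<omega>)" for \<omega>
  have ac: "absolutely_continuous M Q" and int: "integrable M (\<lambda>\<omega>. Z \<omega> * ln (Z \<omega>))"
    and r: "rel_entropy Q M = ereal (\<integral>\<omega>. Z \<omega> * ln (Z \<omega>) \<partial>M)"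
    using fin unfolding rel_entropy_def Let_def Z_def[symmetric] by (auto split: if_splits)
  have [measurable]: "Z \<in> borel_measurable M" unfolding Z_def by measurable
  have "AE \<omega> in M. RN_deriv M Q \<omega> \<noteq> \<infinity>"
    by (rule RN_deriv_finite[OF _ ac Q(2)]) unfold_locales
  then have "AE \<omega> in M. ennreal (Z \<omega>) = RN_deriv M Q \<omega>"
    by eventually_elim (simp add: Z_def ennreal_enn2real less_top)
  then have "density M (\<lambda>\<omega>. ennreal (Z \<omega>)) = density M (RN_deriv M Q)"
    by (intro density_cong) auto
  also have "\<dots> = Q" by (rule density_RN_deriv[OF ac Q(2)])
  finally show ?thesis using int r by (intro that[of Z]) (auto simp: Z_def)
qed

lemma cadlag_on_uminus: "cadlag_on T x \<Longrightarrow> cadlag_on T (\<lambda>t. - x t)"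
  unfolding cadlag_on_def
proof (elim conjE, intro conjI ballI)
  fix t assume "\<forall>t\<in>{0<..T}. \<exists>l. (x \<longlongrightarrow> l) (at_left t)" "t \<in> {0<..T}"
  then obtain l where "(x \<longlongrightarrow> l) (at_left t)" by blast
  then have "((\<lambda>t. - x t) \<longlongrightarrow> - l) (at_left t)" by (rule tendsto_minus)
  then show "\<exists>l. ((\<lambda>t. - x t) \<longlongrightarrow> l) (at_left t)" ..
qed (blast intro: continuous_minus)

context levy_horizon
begin

lemma restr_to_F_T: "restr_to_subalg P (F T) = P"
  by (rule measure_eqI)
     (use sets_P subalgebra_F[of T] in \<open>auto simp: sets_restr_to_subalg emeasure_restr_to_subalg\<close>)

lemma independent_increments: "independent_increments P F T L"
  using levy levy_process_iff[OF prob_space_axioms subalgebra_F] by simp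

lemma levy_horizon_uminus: "levy_horizon P F T (\<lambda>t \<omega>. - L t \<omega>)"
proof
  show "levy_process P F T (\<lambda>t \<omega>. - L t \<omega>)"
  proof (subst levy_process_iff[OF prob_space_axioms])
    show "subalgebra P (F t)" if "t \<in> {0..T}" for t using subalgebra_F that by simp
  next
    have "independent_increments P F T (\<lambda>t \<omega>. - L t \<omega>)"
      unfolding independent_increments_def
    proof (intro ballI)
      fix s t A and B :: "real set"
      assume st: "s \<in> {0..T}" "t \<in> {s..T}" "A \<in> sets (F s)" and B: "B \<in> sets borel"
      have "uminus -` B \<in> sets borel" using measurable_sets[OF borel_measurable_uminus[OF measurable_ident] B] by simp
      from independent_increments[unfolded independent_increments_def, rule_format, OF st this]
      show "emeasure P (A \<inter> {\<omega> \<in> space P. - L t \<omega> - - L s \<omega> \<in> B}) =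
        emeasure P A * emeasure P {\<omega> \<in> space P. - L (t - s) \<omega> \<in> B}" by simp
    qed
    then show "(\<forall>\<omega>\<in>space P. cadlag_on T (\<lambda>t. - L t \<omega>)) \<and> (\<forall>\<omega>\<in>space P. - L 0 \<omega> = 0) \<and>
       (\<forall>t\<in>{0..T}. (\<lambda>\<omega>. - L t \<omega>) \<in> borel_measurable (F t)) \<and>
       independent_increments P F T (\<lambda>t \<omega>. - L t \<omega>)"
      using paths L_0 adapted by (auto intro!: cadlag_on_uminus borel_measurable_uminus)
  qed
qed (use T_pos filt sets_P in \<open>auto simp: filtration_def\<close>)

text \<open>
  If the increment over one step of a grid were negative with probability \<open>p > 0\<close>, all \<open>N\<close> increments
  would be negative with probability \<open>p ^ N\<close>, and \<open>L T\<close> with them. So increments between points of a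
  common grid are nonnegative, and right-continuity passes this on to all times.
\<close>
lemma subordinator_if_terminal_nonneg:
  assumes pos: "AE \<omega> in P. 0 \<le> L T \<omega>"
  shows "subordinator P F T L"
proof -
  have [measurable]: "L (grid N k) \<in> borel_measurable P" if "0 < N" "k \<le> N" for N k
    using that by (intro L_measurable grid_le_T) auto
  have nonneg1: "AE \<omega> in P. 0 \<le> L (grid N 1) \<omega>" if N: "0 < N" for N
  proof (rule ccontr)
    assume n: "\<not> ?thesis"
    have 1: "1 \<le> N" using N by simp
    note [measurable] = \<open>\<And>N k. 0 < N \<Longrightarrow> k \<le> N \<Longrightarrow> L (grid N k) \<in> borel_measurable P\<close>[OF N 1]
    define p where "p = emeasure P {\<omega>\<in>space P. L (grid N 1) \<omega> \<in> {..<0}}"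
    have "p \<noteq> 0"
      using n unfolding p_def by (subst (asm) AE_iff_measurable[OF _ refl]) (auto simp: not_le simp del: One_nat_def)
    have "p ^ Suc k \<le> emeasure P {\<omega>\<in>space P. L (grid N (Suc k)) \<omega> < 0}" if "Suc k \<le> N" for k
      using that
    proof (induction k)
      case 0 then show ?case by (simp add: p_def)
    next
      case (Suc k)
      let ?s = "grid N (Suc k)" and ?t = "grid N (Suc (Suc k))"
      have st: "?s \<in> {0..T}" "?t \<in> {?s..T}"
        using grid_mono[of "Suc k" "Suc (Suc k)" N] grid_le_T[OF N Suc.prems] by auto
      have [measurable]: "L ?t \<in> borel_measurable P" using st by (intro L_measurable) auto
      have A: "{\<omega>\<in>space P. L ?s \<omega> < 0} \<in> sets (F ?s)"
        using adapted[of ?s] st unfolding borel_measurable_iff_less by simp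
      have d: "?t - ?s = grid N 1" using grid_diff[of "Suc k" "Suc (Suc k)" N] by simp
      have "p ^ Suc (Suc k) \<le> emeasure P {\<omega>\<in>space P. L ?s \<omega> < 0} * p"
        using Suc by (simp add: mult.commute mult_left_mono)
      also have "\<dots> = emeasure P ({\<omega>\<in>space P. L ?s \<omega> < 0} \<inter> {\<omega>\<in>space P. L ?t \<omega> - L ?s \<omega> \<in> {..<0}})"
        using independent_increments[unfolded independent_increments_def, rule_format, OF st A, of "{..<0}"]
        by (simp add: p_def d)
      also have "\<dots> \<le> emeasure P {\<omega>\<in>space P. L ?t \<omega> < 0}"
        by (rule emeasure_mono) auto
      finally show ?case .
    qed
    from this[of "N - 1"] N have "p ^ N \<le> emeasure P {\<omega>\<in>space P. L T \<omega> < 0}"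
      by (simp add: grid_top)
    also have "\<dots> = 0"
      using pos L_measurable[of T] T_pos by (subst (asm) AE_iff_measurable[OF _ refl]) (auto simp: not_le)
    finally show False using \<open>p \<noteq> 0\<close> by simp
  qed
  have incr: "AE \<omega> in P. L (grid N k) \<omega> \<le> L (grid N (Suc k)) \<omega>" if N: "0 < N" and k: "Suc k \<le> N" for N k
  proof -
    let ?s = "grid N k" and ?t = "grid N (Suc k)"
    have st: "?s \<in> {0..T}" "?t \<in> {?s..T}"
      using grid_mono[of "k" "Suc k" N] grid_le_T[OF N k] by auto
    have m [measurable]: "L ?t \<in> borel_measurable P" "L ?s \<in> borel_measurable P" "L (grid N 1) \<in> borel_measurable P"
      using st N grid_le_T[of N 1] by (auto intro!: L_measurable)
    have d: "?t - ?s = grid N 1" using grid_diff[of k "Suc k" N] by simp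
    have sp: "space P \<in> sets (F ?s)" using sets.top[of "F ?s"] by simp
    have "emeasure P {\<omega>\<in>space P. L ?t \<omega> - L ?s \<omega> < 0} =
        emeasure P (space P \<inter> {\<omega>\<in>space P. L ?t \<omega> - L ?s \<omega> \<in> {..<0}})"
      by (rule arg_cong[of _ _ "emeasure P"]) auto
    also have "\<dots> = emeasure P {\<omega>\<in>space P. L (grid N 1) \<omega> \<in> {..<0}}"
      using independent_increments[unfolded independent_increments_def, rule_format, OF st sp, of "{..<0}"]
      by (simp add: d emeasure_space_1)
    also have "\<dots> = 0"
      using nonneg1[OF N] m by (subst (asm) AE_iff_measurable[OF _ refl]) (auto simp: not_le)
    finally have "AE \<omega> in P. \<not> L ?t \<omega> - L ?s \<omega> < 0"
      using m by (subst AE_iff_measurable[OF _ refl]) auto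
    then show ?thesis by eventually_elim simp
  qed
  have "AE \<omega> in P. \<forall>n. \<forall>k. Suc k \<le> Suc n \<longrightarrow> L (grid (Suc n) k) \<omega> \<le> L (grid (Suc n) (Suc k)) \<omega>"
    unfolding AE_all_countable using incr by auto
  then have "AE \<omega> in P. mono_on {0..T} (\<lambda>t. L t \<omega>)"
  proof (rule AE_mp, intro AE_I2 impI)
    fix \<omega> assume \<omega>: "\<omega> \<in> space P"
      and step: "\<forall>n. \<forall>k. Suc k \<le> Suc n \<longrightarrow> L (grid (Suc n) k) \<omega> \<le> L (grid (Suc n) (Suc k)) \<omega>"
    have mono: "L (grid (Suc n) k) \<omega> \<le> L (grid (Suc n) l) \<omega>" if "k \<le> l" "l \<le> Suc n" for n k l
      using that
    proof (induction l rule: dec_induct)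
      case (step l)
      then show ?case using \<open>\<forall>n. \<forall>k. _ \<longrightarrow> _\<close>[rule_format, of l n] by simp
    qed simp
    show "mono_on {0..T} (\<lambda>t. L t \<omega>)"
    proof (rule mono_onI)
      fix s t assume st: "s \<in> {0..T}" "t \<in> {0..T}" "s \<le> t"
      have "grid_index (Suc n) s \<le> grid_index (Suc n) t" for n
        using st grid_index_bounds(1)[of "Suc n" t] by (simp add: grid_index_le_iff)
      then have "L (grid (Suc n) (grid_index (Suc n) s)) \<omega> \<le> L (grid (Suc n) (grid_index (Suc n) t)) \<omega>" for n
        using st by (intro mono grid_index_le) auto
      then show "L s \<omega> \<le> L t \<omega>"
        using st by (intro LIMSEQ_le[OF L_right_limit[OF \<omega>] L_right_limit[OF \<omega>]]) auto
    qed
  qed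
  then show ?thesis unfolding subordinator_def using levy by simp
qed

lemma martingale_on_mean_zero:
  assumes Q: "prob_space Q" "sets Q = sets P" and X: "martingale_on Q F T X"
    and X0: "\<And>\<omega>. \<omega> \<in> space P \<Longrightarrow> X 0 \<omega> = 0"
  shows "integrable Q (X T)" "(\<integral>\<omega>. X T \<omega> \<partial>Q) = 0"
proof -
  interpret Q: prob_space Q by fact
  have sp: "space Q = space P" using Q(2) by (rule sets_eq_imp_space_eq)
  have "subalgebra Q (F 0)" using subalgebra_F[of 0] T_pos Q(2) sp by (simp add: subalgebra_def)
  then interpret finite_measure_subalgebra Q "F 0" by unfold_locales
  show int: "integrable Q (X T)"
    using X T_pos unfolding martingale_on_def by auto
  have ce: "AE \<omega> in Q. real_cond_exp Q (F 0) (X T) \<omega> = X 0 \<omega>"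
    using X T_pos unfolding martingale_on_def by auto
  have "AE \<omega> in Q. real_cond_exp Q (F 0) (X T) \<omega> = 0"
    using ce AE_space by eventually_elim (simp add: X0 sp)
  then have "(\<integral>\<omega>. real_cond_exp Q (F 0) (X T) \<omega> \<partial>Q) = 0"
    by (rule integral_eq_zero_AE)
  with real_cond_exp_int(2)[OF int] show "(\<integral>\<omega>. X T \<omega> \<partial>Q) = 0" by simp
qed

lemma M_hat_loc_localization:
  assumes "Q \<in> M_hat_loc P F T L"
  shows "prob_space Q" "sets Q = sets P" "\<exists>\<tau>. zero_mean_localization Q F T L \<tau>"
proof -
  have "Q \<in> ac_measures P F T"
    using assms by (auto simp: M_hat_loc_def M_loc_def M_tilde_loc0_def M_tilde_loc_def)
  then show Q: "prob_space Q" "sets Q = sets P"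
    by (auto simp: ac_measures_def sets_P)
  interpret Q: prob_space Q by fact
  have sp [simp]: "space Q = space P" using Q(2) by (rule sets_eq_imp_space_eq)
  consider "local_martingale_on Q F T L" | "local_moment_condition Q F T L"
    using assms by (auto simp: M_hat_loc_def M_loc_def M_tilde_loc0_def M_tilde_loc_def)
  then show "\<exists>\<tau>. zero_mean_localization Q F T L \<tau>"
  proof cases
    case 1
    then obtain \<tau> where tau: "\<And>k. stopping_time F (\<tau> k)" "\<And>k \<omega>. \<omega> \<in> space P \<Longrightarrow> 0 \<le> \<tau> k \<omega>"
      and inc: "AE \<omega> in Q. incseq (\<lambda>k. \<tau> k \<omega>)" and ex: "AE \<omega> in Q. \<exists>k. T \<le> \<tau> k \<omega>"
      and mart: "\<And>k. martingale_on Q F T (\<lambda>t \<omega>. L (min t (\<tau> k \<omega>)) \<omega>)"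
      unfolding local_martingale_on_def by auto
    have ev: "AE \<omega> in Q. eventually (\<lambda>k. T \<le> \<tau> k \<omega>) sequentially"
      using inc ex
    proof eventually_elim
      case (elim \<omega>)
      then obtain k where "T \<le> \<tau> k \<omega>" by blast
      then show ?case using elim(1) unfolding eventually_sequentially incseq_def
        by (meson order_trans)
    qed
    have "integrable Q (\<lambda>\<omega>. L (min (\<tau> k \<omega>) T) \<omega>) \<and> (\<integral>\<omega>. L (min (\<tau> k \<omega>) T) \<omega> \<partial>Q) = 0" for k
    proof -
      have "L (min 0 (\<tau> k \<omega>)) \<omega> = 0" if "\<omega> \<in> space P" for \<omega>
        using tau(2)[OF that, of k] L_0[OF that] by (simp add: min_def)
      from martingale_on_mean_zero[OF Q mart this] show ?thesis by (simp add: min.commute)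
    qed
    with tau ev show ?thesis unfolding zero_mean_localization_def by (intro exI[of _ \<tau>]) auto
  next
    case 2
    then obtain \<tau> where tau: "\<And>k. stopping_time F (\<tau> k)" "\<And>k \<omega>. \<omega> \<in> space P \<Longrightarrow> 0 \<le> \<tau> k \<omega>"
      and inc: "incseq (\<lambda>k. {\<omega>\<in>space P. \<tau> k \<omega> = T})" and un: "(\<Union>k. {\<omega>\<in>space P. \<tau> k \<omega> = T}) = space P"
      and mom: "\<And>k. integrable Q (\<lambda>\<omega>. L (min (\<tau> k \<omega>) T) \<omega>) \<and> (\<integral>\<omega>. L (min (\<tau> k \<omega>) T) \<omega> \<partial>Q) = 0"
      unfolding local_moment_condition_def by auto
    have "eventually (\<lambda>k. T \<le> \<tau> k \<omega>) sequentially" if "\<omega> \<in> space P" for \<omega>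
    proof -
      have "\<omega> \<in> (\<Union>k. {\<omega>\<in>space P. \<tau> k \<omega> = T})" unfolding un by (fact that)
      then obtain k where "\<omega> \<in> {\<omega>\<in>space P. \<tau> k \<omega> = T}" by (rule UN_E)
      then have "\<omega> \<in> {\<omega>\<in>space P. \<tau> l \<omega> = T}" if "k \<le> l" for l
        using incseqD[OF inc that] by (rule rev_subsetD)
      then show ?thesis unfolding eventually_sequentially by auto
    qed
    then have "AE \<omega> in Q. eventually (\<lambda>k. T \<le> \<tau> k \<omega>) sequentially" by (intro AE_I2) simp
    with tau mom show ?thesis unfolding zero_mean_localization_def by (intro exI[of _ \<tau>]) auto
  qed
qed

end

section \<open>Esscher measures\<close>

context levy_horizon
begin

definition esscher :: "real \<Rightarrow> 'a measure" where
  "esscher \<kappa> = density P (\<lambda>\<omega>. ennreal (exp (\<kappa> * L T \<omega>) / mgf \<kappa>))"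

lemma esscher_measure_eq: "esscher_measure P F T L \<kappa> = esscher \<kappa>"
  by (simp add: esscher_measure_def esscher_def restr_to_F_T mgf_def)

lemma rel_entropy_ge:
  assumes int: "integrable P (\<lambda>\<omega>. exp (\<kappa> * L T \<omega>))" and Q: "Q \<in> M_hat_loc P F T L"
  shows "ereal (- ln (mgf \<kappa>)) \<le> rel_entropy Q P"
proof (cases "rel_entropy Q P < \<infinity>")
  case True
  note Q' = M_hat_loc_localization[OF Q]
  from finite_rel_entropy_densityE[OF Q'(1,2) True] obtain Z where Z: "Z \<in> borel_measurable P" "\<And>\<omega>. 0 \<le> Z \<omega>"
    "Q = density P (\<lambda>\<omega>. ennreal (Z \<omega>))" "integrable P (\<lambda>\<omega>. Z \<omega> * ln (Z \<omega>))"
    "rel_entropy Q P = ereal (\<integral>\<omega>. Z \<omega> * ln (Z \<omega>) \<partial>P)" by blast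
  from Q' obtain \<tau> where "zero_mean_localization Q F T L \<tau>" by blast
  then show ?thesis using entropy_core(1)[OF int Z(1,2) _ Z(4), of \<tau>] Q'(1) Z(3,5) by simp
qed simp

lemma rel_entropy_minimal_eq_esscher:
  assumes int: "integrable P (\<lambda>\<omega>. exp (\<kappa> * L T \<omega>))" and Q: "Q \<in> M_hat_loc P F T L"
    and le: "rel_entropy Q P \<le> ereal (- ln (mgf \<kappa>))"
  shows "Q = esscher \<kappa>"
proof -
  have fin: "rel_entropy Q P < \<infinity>" using le by (rule le_less_trans) simp
  note Q' = M_hat_loc_localization[OF Q]
  from finite_rel_entropy_densityE[OF Q'(1,2) fin] obtain Z where Z: "Z \<in> borel_measurable P" "\<And>\<omega>. 0 \<le> Z \<omega>"
    "Q = density P (\<lambda>\<omega>. ennreal (Z \<omega>))" "integrable P (\<lambda>\<omega>. Z \<omega> * ln (Z \<omega>))"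
    "rel_entropy Q P = ereal (\<integral>\<omega>. Z \<omega> * ln (Z \<omega>) \<partial>P)" by blast
  from Q' obtain \<tau> where loc: "zero_mean_localization Q F T L \<tau>" by blast
  have "AE \<omega> in P. Z \<omega> = exp (\<kappa> * L T \<omega>) / mgf \<kappa>"
    using entropy_core(2)[OF int Z(1,2) _ Z(4), of \<tau>] Q'(1) Z(3,5) loc le by simp
  then have "AE \<omega> in P. ennreal (Z \<omega>) = ennreal (exp (\<kappa> * L T \<omega>) / mgf \<kappa>)"
    by eventually_elim simp
  then show ?thesis unfolding Z(3) esscher_def
    using Z(1) L_measurable[of T] T_pos by (intro density_cong) auto
qed

text \<open>
  The density \<open>exp (\<kappa> L\<^sub>T)\<close> splits over \<open>[0, s]\<close>, \<open>[s, t]\<close> and \<open>[t, T]\<close> into independent factors, so the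
  change of measure acts on each increment separately.
\<close>
lemma levy_horizon_esscher:
  assumes int: "integrable P (\<lambda>\<omega>. exp (\<kappa> * L T \<omega>))"
  shows "levy_horizon (esscher \<kappa>) F T L"
proof -
  note mp = mgf_pos[OF int]
  let ?Q = "esscher \<kappa>" and ?e = "\<lambda>t \<omega>. ennreal (exp (\<kappa> * L t \<omega>))"
  define c where "c = ennreal (1 / mgf \<kappa>)"
  define f where "f t = (\<integral>\<^sup>+\<omega>. ?e t \<omega> \<partial>P)" for t
  \<comment> \<open>the law of \<open>L t\<close> after the change of measure, before normalization\<close>
  define G where "G t B = (\<integral>\<^sup>+\<omega>. indicator B (L t \<omega>) * ?e t \<omega> \<partial>P)" for t B
  have [simp]: "space ?Q = space P" "sets ?Q = sets P" by (auto simp: esscher_def)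
  have LTm [measurable]: "L T \<in> borel_measurable P" using L_measurable[of T] T_pos by simp
  have em: "?e t \<in> borel_measurable (F t)" if "0 \<le> t" "t \<le> T" for t
    using adapted[OF that] by measurable
  have ef: "f t = f s * f (t - s)" if "0 \<le> s" "s \<le> t" "t \<le> T" for s t
  proof -
    have "f t = (\<integral>\<^sup>+\<omega>. ?e s \<omega> * ennreal (exp (\<kappa> * (L t \<omega> - L s \<omega>))) \<partial>P)"
      unfolding f_def by (intro nn_integral_cong) (simp add: ennreal_mult[symmetric] exp_add[symmetric] algebra_simps)
    also have "\<dots> = f s * f (t - s)"
      unfolding f_def using that by (intro nn_integral_increment em) auto
    finally show ?thesis .
  qed
  have cf: "c * f T = 1"
    unfolding c_def f_def using nn_integral_eq_integral[OF int] mp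
    by (simp add: mgf_def ennreal_mult[symmetric])
  have emQ: "emeasure ?Q S = c * (\<integral>\<^sup>+\<omega>. indicator S \<omega> * ?e T \<omega> \<partial>P)" if S: "S \<in> sets P" for S
  proof -
    have "emeasure ?Q S = (\<integral>\<^sup>+\<omega>. ennreal (exp (\<kappa> * L T \<omega>) / mgf \<kappa>) * indicator S \<omega> \<partial>P)"
      unfolding esscher_def by (rule emeasure_density) (use S in auto)
    also have "\<dots> = (\<integral>\<^sup>+\<omega>. c * (indicator S \<omega> * ?e T \<omega>) \<partial>P)"
      using mp by (intro nn_integral_cong) (auto simp: c_def ennreal_mult[symmetric] indicator_def)
    also have "\<dots> = c * (\<integral>\<^sup>+\<omega>. indicator S \<omega> * ?e T \<omega> \<partial>P)"
      by (rule nn_integral_cmult) (use S in auto)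
    finally show ?thesis .
  qed
  have key: "emeasure ?Q (A \<inter> {\<omega>\<in>space P. L t \<omega> - L s \<omega> \<in> B}) =
      c * ((\<integral>\<^sup>+\<omega>. indicator A \<omega> * ?e s \<omega> \<partial>P) * G (t - s) B * f (T - t))"
    if st: "0 \<le> s" "s \<le> t" "t \<le> T" and A: "A \<in> sets (F s)" and B: "B \<in> sets borel" for s t A B
  proof -
    have t0: "0 \<le> t" "s \<le> T" using st by auto
    have AP: "A \<in> sets P" using sets_F_le[OF _ A] st by simp
    have AFt: "A \<in> sets (F t)" using F_mono[OF st(2) A] .
    have Lt: "L t \<in> borel_measurable (F t)" and Ls: "L s \<in> borel_measurable (F t)" "L s \<in> borel_measurable (F s)"
      using adapted[OF t0(1) st(3)] measurable_F_mono[OF adapted[OF st(1) t0(2)] st(2)] adapted[OF st(1) t0(2)] by auto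
    have LP [measurable]: "L t \<in> borel_measurable P" "L s \<in> borel_measurable P"
      using L_measurable[of t] L_measurable[of s] st t0 by auto
    let ?D = "\<lambda>\<omega>. L t \<omega> - L s \<omega>"
    have S: "A \<inter> {\<omega>\<in>space P. ?D \<omega> \<in> B} \<in> sets P" using AP B by measurable
    have m1: "(\<lambda>\<omega>. indicator A \<omega> * indicator B (?D \<omega>) * ?e t \<omega> :: ennreal) \<in> borel_measurable (F t)"
      using AFt B Lt Ls(1) by measurable
    have m2: "(\<lambda>\<omega>. indicator A \<omega> * ?e s \<omega> :: ennreal) \<in> borel_measurable (F s)"
      using A Ls(2) by measurable
    have m3: "(\<lambda>x. indicator B x * ennreal (exp (\<kappa> * x)) :: ennreal) \<in> borel_measurable borel"
      using B by measurable
    have "(\<integral>\<^sup>+\<omega>. indicator (A \<inter> {\<omega>\<in>space P. ?D \<omega> \<in> B}) \<omega> * ?e T \<omega> \<partial>P) =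
      (\<integral>\<^sup>+\<omega>. indicator A \<omega> * indicator B (?D \<omega>) * ?e t \<omega> * ennreal (exp (\<kappa> * (L T \<omega> - L t \<omega>))) \<partial>P)"
      by (intro nn_integral_cong)
         (auto simp: indicator_def ennreal_mult[symmetric] exp_add[symmetric] algebra_simps)
    also have "\<dots> = (\<integral>\<^sup>+\<omega>. indicator A \<omega> * indicator B (?D \<omega>) * ?e t \<omega> \<partial>P) * f (T - t)"
      unfolding f_def by (rule nn_integral_increment[OF t0(1) st(3) order_refl m1]) simp
    also have "(\<integral>\<^sup>+\<omega>. indicator A \<omega> * indicator B (?D \<omega>) * ?e t \<omega> \<partial>P) =
      (\<integral>\<^sup>+\<omega>. (indicator A \<omega> * ?e s \<omega>) * (indicator B (?D \<omega>) * ennreal (exp (\<kappa> * ?D \<omega>))) \<partial>P)"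
      by (intro nn_integral_cong)
         (auto simp: indicator_def ennreal_mult[symmetric] exp_add[symmetric] algebra_simps)
    also have "\<dots> = (\<integral>\<^sup>+\<omega>. indicator A \<omega> * ?e s \<omega> \<partial>P) * G (t - s) B"
      unfolding G_def by (rule nn_integral_increment[OF st m2 m3])
    finally show ?thesis by (simp add: emQ[OF S])
  qed
  have GU: "G t UNIV = f t" for t by (simp add: G_def f_def)
  have Q: "prob_space ?Q"
  proof
    have "emeasure ?Q (space P) = c * f T"
      unfolding emQ[OF sets.top] f_def
      by (intro arg_cong[of _ _ "(*) c"] nn_integral_cong) simp
    then show "emeasure ?Q (space ?Q) = 1" using cf by simp
  qed
  have sub: "subalgebra ?Q (F t)" if "t \<in> {0..T}" for t
    using subalgebra_F[of t] that by (simp add: subalgebra_def)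
  have ii: "independent_increments ?Q F T L"
    unfolding independent_increments_def
  proof (intro ballI)
    fix s t A and B :: "real set"
    assume "s \<in> {0..T}" "t \<in> {s..T}" and A: "A \<in> sets (F s)" and B: "B \<in> sets borel"
    then have st: "0 \<le> s" "s \<le> t" "t \<le> T" and st': "0 \<le> t - s" "t - s \<le> T" by auto
    let ?a = "\<integral>\<^sup>+\<omega>. indicator A \<omega> * ?e s \<omega> \<partial>P"
    have "A \<subseteq> space P" using sets.sets_into_space[OF A] by simp
    then have 1: "emeasure ?Q A = c * (?a * f (t - s) * f (T - t))"
      using key[OF st A, of UNIV] by (simp add: GU Int_absorb2)
    have sp: "space P \<in> sets (F 0)" using sets.top[of "F 0"] by simp
    have "(\<integral>\<^sup>+\<omega>. indicator (space P) \<omega> * ?e 0 \<omega> \<partial>P) = (\<integral>\<^sup>+\<omega>. 1 \<partial>P)"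
      by (intro nn_integral_cong) (simp add: L_0)
    then have one: "(\<integral>\<^sup>+\<omega>. indicator (space P) \<omega> * ?e 0 \<omega> \<partial>P) = 1" by (simp add: emeasure_space_1)
    have "{\<omega>\<in>space P. L (t - s) \<omega> \<in> B} = space P \<inter> {\<omega>\<in>space P. L (t - s) \<omega> - L 0 \<omega> \<in> B}"
      by (auto simp: L_0)
    then have 2: "emeasure ?Q {\<omega>\<in>space P. L (t - s) \<omega> \<in> B} = c * (G (t - s) B * f (T - (t - s)))"
      using key[OF order_refl st' sp B] one by simp
    have "emeasure ?Q A * emeasure ?Q {\<omega>\<in>space P. L (t - s) \<omega> \<in> B} =
      c * (?a * G (t - s) B * f (T - t)) * (c * (f (t - s) * f (T - (t - s))))"
      unfolding 1 2 by (simp add: mult_ac)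
    also have "\<dots> = c * (?a * G (t - s) B * f (T - t))"
      using ef[of "t - s" T] st st' cf by simp
    finally show "emeasure ?Q (A \<inter> {\<omega> \<in> space ?Q. L t \<omega> - L s \<omega> \<in> B}) =
        emeasure ?Q A * emeasure ?Q {\<omega> \<in> space ?Q. L (t - s) \<omega> \<in> B}"
      using key[OF st A B] by simp
  qed
  have "levy_process ?Q F T L"
    using levy_process_iff[OF Q sub] ii paths L_0 adapted by auto
  then show ?thesis
    using Q T_pos filt sets_P by (simp add: levy_horizon_def levy_horizon_axioms_def)
qed

end

section \<open>Tilting a truncated law to mean zero\<close>

text \<open>
  The derivative \<open>g\<close> of \<open>f\<close> is continuous and changes sign, hence has a zero, at which the convex
  function \<open>f\<close> is minimal. Together with \<open>f \<kappa> \<le> 1\<close> the last conclusion confines these zeros to a compact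
  interval that depends on \<open>a\<close> and \<open>p\<close> but not on \<open>n\<close>.
\<close>
lemma (in prob_space) truncated_tilt:
  fixes X :: "'a \<Rightarrow> real"
  assumes X [measurable]: "X \<in> borel_measurable M" and pos: "0 < a" "0 < p" "0 < n"
    and up: "p \<le> prob {\<omega>\<in>space M. a \<le> X \<omega> \<and> X \<omega> \<le> n}"
    and dn: "p \<le> prob {\<omega>\<in>space M. - n \<le> X \<omega> \<and> X \<omega> \<le> - a}"
  defines "f \<equiv> \<lambda>\<kappa>. \<integral>\<omega>. indicator {-n..n} (X \<omega>) * exp (\<kappa> * X \<omega>) \<partial>M"
  obtains \<kappa> where "(\<integral>\<omega>. indicator {-n..n} (X \<omega>) * (X \<omega> * exp (\<kappa> * X \<omega>)) \<partial>M) = 0"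
    "f \<kappa> \<le> 1" "p * exp (a * \<bar>\<kappa>\<bar>) \<le> f \<kappa>"
proof -
  define g where "g \<kappa> = (\<integral>\<omega>. indicator {-n..n} (X \<omega>) * (X \<omega> * exp (\<kappa> * X \<omega>)) \<partial>M)" for \<kappa>
  define U where "U = {\<omega>\<in>space M. a \<le> X \<omega> \<and> X \<omega> \<le> n}"
  define D where "D = {\<omega>\<in>space M. - n \<le> X \<omega> \<and> X \<omega> \<le> - a}"
  have [measurable]: "U \<in> sets M" "D \<in> sets M" unfolding U_def D_def by measurable
  have iU: "integrable M (indicator U :: 'a \<Rightarrow> real)" "integrable M (indicator D :: 'a \<Rightarrow> real)"
    by (auto simp: integrable_indicator_iff emeasure_eq_measure)
  have eb: "\<kappa> * x \<le> \<bar>\<kappa>\<bar> * n" if "- n \<le> x" "x \<le> n" for \<kappa> x :: real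
  proof -
    have "\<kappa> * x \<le> \<bar>\<kappa>\<bar> * \<bar>x\<bar>" by (metis abs_ge_self abs_mult)
    also have "\<dots> \<le> \<bar>\<kappa>\<bar> * n" using that by (intro mult_left_mono) auto
    finally show ?thesis .
  qed
  have gb: "norm (indicator {-n..n} x * (x * exp (\<kappa> * x))) \<le> n * exp (K * n)"
    if "\<bar>\<kappa>\<bar> \<le> K" for \<kappa> K x :: real
  proof (cases "x \<in> {-n..n}")
    case True
    have "exp (\<kappa> * x) \<le> exp (\<bar>\<kappa>\<bar> * n)" using eb True by simp
    also have "\<dots> \<le> exp (K * n)" using that pos by (simp add: mult_right_mono)
    finally have "\<bar>x\<bar> * exp (\<kappa> * x) \<le> n * exp (K * n)" using True by (intro mult_mono) auto
    then show ?thesis using True by (simp add: abs_mult)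
  qed (use pos in simp)
  have fi: "integrable M (\<lambda>\<omega>. indicator {-n..n} (X \<omega>) * exp (\<kappa> * X \<omega>))" for \<kappa>
    by (rule integrable_const_bound[where B="exp (\<bar>\<kappa>\<bar> * n)"])
       (auto simp: indicator_def eb)
  have gi: "integrable M (\<lambda>\<omega>. indicator {-n..n} (X \<omega>) * (X \<omega> * exp (\<kappa> * X \<omega>)))" for \<kappa>
    by (rule integrable_const_bound[where B="n * exp (\<bar>\<kappa>\<bar> * n)"])
       (use gb[OF order_refl] in \<open>auto intro!: AE_I2\<close>)
  have cont: "continuous_on UNIV g"
    unfolding continuous_on_sequentially
  proof (intro allI ballI impI)
    fix x :: "nat \<Rightarrow> real" and \<kappa> assume "(\<forall>i. x i \<in> UNIV) \<and> x \<longlonglongrightarrow> \<kappa>"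
    then have lim: "x \<longlonglongrightarrow> \<kappa>" by simp
    then have "Bseq x" by (intro convergent_imp_Bseq convergentI)
    then obtain K where K: "\<And>i. \<bar>x i\<bar> \<le> K" unfolding Bseq_def by auto
    show "(g \<circ> x) \<longlonglongrightarrow> g \<kappa>"
      unfolding o_def g_def
    proof (rule integral_dominated_convergence[where w="\<lambda>_. n * exp (K * n)"])
      show "AE \<omega> in M. (\<lambda>i. indicator {-n..n} (X \<omega>) * (X \<omega> * exp (x i * X \<omega>)))
          \<longlonglongrightarrow> indicator {-n..n} (X \<omega>) * (X \<omega> * exp (\<kappa> * X \<omega>))"
        by (intro AE_I2 tendsto_intros lim)
      show "AE \<omega> in M. norm (indicator {-n..n} (X \<omega>) * (X \<omega> * exp (x i * X \<omega>))) \<le> n * exp (K * n)" for i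
        by (intro AE_I2 gb K)
    qed auto
  qed
  \<comment> \<open>so large that the values of \<open>X\<close> beyond \<open>a\<close> outweigh the others, which contribute at most \<open>n\<close>\<close>
  define K where "K = n / (a * a * p)"
  have K0: "0 \<le> K" using pos by (simp add: K_def)
  have "a * K * p * a = n" using pos by (simp add: K_def field_simps)
  moreover have "a * K \<le> exp (a * K)" using exp_ge_add_one_self[of "a * K"] by linarith
  ultimately have Kn: "n \<le> a * exp (a * K) * p"
    using pos mult_right_mono[of "a * K" "exp (a * K)" "p * a"] by (simp add: mult_ac)
  have gK: "0 \<le> g K"
  proof -
    have "(\<integral>\<omega>. a * exp (a * K) * indicator U \<omega> - n \<partial>M) \<le> g K"
      unfolding g_def
    proof (rule integral_mono)
      fix \<omega> assume \<omega>: "\<omega> \<in> space M"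
      let ?x = "X \<omega>"
      consider "?x \<notin> {-n..n}" | "-n \<le> ?x" "?x < 0" | "0 \<le> ?x" "?x < a" "?x \<le> n" | "a \<le> ?x" "?x \<le> n"
        by fastforce
      then show "a * exp (a * K) * indicator U \<omega> - n \<le> indicator {-n..n} ?x * (?x * exp (K * ?x))"
      proof cases
        case 1 then show ?thesis using pos by (auto simp: U_def indicator_def)
      next
        case 2
        have "exp (K * ?x) \<le> 1" using 2 K0 by (simp add: mult_nonneg_nonpos)
        then have "?x \<le> ?x * exp (K * ?x)" using 2 mult_left_mono_neg[of "exp (K * ?x)" 1 ?x] by simp
        then have "- n \<le> ?x * exp (K * ?x)" using 2 by linarith
        then show ?thesis using 2 pos by (simp add: U_def)
      next
        case 3
        have "0 \<le> ?x * exp (K * ?x)" using 3 by simp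
        then have "- n \<le> ?x * exp (K * ?x)" using pos by linarith
        then show ?thesis using 3 pos by (simp add: U_def)
      next
        case 4
        have "a * exp (a * K) \<le> ?x * exp (K * ?x)"
          using 4 pos K0 by (intro mult_mono) (auto simp: mult.commute mult_left_mono)
        then show ?thesis using 4 pos \<omega> by (simp add: U_def)
      qed
    qed (use iU gi in auto)
    moreover have "(\<integral>\<omega>. a * exp (a * K) * indicator U \<omega> - n \<partial>M) = a * exp (a * K) * prob U - n"
      using iU by (simp add: prob_space)
    moreover have "a * exp (a * K) * p \<le> a * exp (a * K) * prob U"
      using up pos unfolding U_def by (intro mult_left_mono) auto
    ultimately show ?thesis using Kn by linarith
  qed
  have gK': "g (- K) \<le> 0"
  proof -
    have "g (- K) \<le> (\<integral>\<omega>. n - a * exp (a * K) * indicator D \<omega> \<partial>M)"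
      unfolding g_def
    proof (rule integral_mono)
      fix \<omega> assume \<omega>: "\<omega> \<in> space M"
      let ?x = "X \<omega>"
      consider "?x \<notin> {-n..n}" | "0 < ?x" "?x \<le> n" | "-a < ?x" "?x \<le> 0" "-n \<le> ?x" | "-n \<le> ?x" "?x \<le> -a"
        by fastforce
      then show "indicator {-n..n} ?x * (?x * exp (- K * ?x)) \<le> n - a * exp (a * K) * indicator D \<omega>"
      proof cases
        case 1 then show ?thesis using pos by (auto simp: D_def indicator_def)
      next
        case 2
        have "exp (- K * ?x) \<le> 1" using 2 K0 by simp
        then have "?x * exp (- K * ?x) \<le> ?x" using 2 mult_left_mono[of "exp (- K * ?x)" 1 ?x] by simp
        then have "?x * exp (- K * ?x) \<le> n" using 2 by linarith
        then show ?thesis using 2 pos by (simp add: D_def)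
      next
        case 3
        have "?x * exp (- K * ?x) \<le> 0" using 3 by (simp add: mult_nonpos_nonneg)
        then show ?thesis using 3 pos by (simp add: D_def)
      next
        case 4
        have "a * K \<le> - ?x * K" using 4 K0 by (intro mult_right_mono) auto
        then have "a * exp (a * K) \<le> - ?x * exp (- K * ?x)"
          using 4 pos by (intro mult_mono) (auto simp: mult.commute)
        then show ?thesis using 4 pos \<omega> by (simp add: D_def)
      qed
    qed (use iU gi[of "- K"] in auto)
    moreover have "(\<integral>\<omega>. n - a * exp (a * K) * indicator D \<omega> \<partial>M) = n - a * exp (a * K) * prob D"
      using iU by (simp add: prob_space)
    moreover have "a * exp (a * K) * p \<le> a * exp (a * K) * prob D"
      using dn pos unfolding D_def by (intro mult_left_mono) auto
    ultimately show ?thesis using Kn by linarith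
  qed
  obtain \<kappa> where \<kappa>: "g \<kappa> = 0"
    using IVT'[of g "- K" 0 K] gK gK' K0 continuous_on_subset[OF cont] by auto
  \<comment> \<open>the tangent of the convex function \<open>f\<close> at \<open>\<kappa>\<close> is horizontal, so \<open>f \<kappa> \<le> f 0 \<le> 1\<close>\<close>
  have "f \<kappa> \<le> (\<integral>\<omega>. 1 + \<kappa> * (indicator {-n..n} (X \<omega>) * (X \<omega> * exp (\<kappa> * X \<omega>))) \<partial>M)"
    unfolding f_def
  proof (rule integral_mono)
    fix \<omega>
    have "exp (\<kappa> * X \<omega>) * (1 + - (\<kappa> * X \<omega>)) \<le> exp (\<kappa> * X \<omega>) * exp (- (\<kappa> * X \<omega>))"
      by (intro mult_left_mono exp_ge_add_one_self) auto
    also have "\<dots> = 1" by (simp add: exp_minus)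
    finally have "exp (\<kappa> * X \<omega>) \<le> 1 + \<kappa> * (X \<omega> * exp (\<kappa> * X \<omega>))" by (simp add: algebra_simps)
    then show "indicator {-n..n} (X \<omega>) * exp (\<kappa> * X \<omega>)
        \<le> 1 + \<kappa> * (indicator {-n..n} (X \<omega>) * (X \<omega> * exp (\<kappa> * X \<omega>)))"
      by (simp add: indicator_def)
  qed (use fi gi in auto)
  also have "\<dots> = 1 + \<kappa> * g \<kappa>" using gi by (simp add: g_def prob_space)
  finally have f1: "f \<kappa> \<le> 1" by (simp add: \<kappa>)
  have "p * exp (a * \<bar>\<kappa>\<bar>) \<le> f \<kappa>"
  proof (cases "0 \<le> \<kappa>")
    case True
    have "p * exp (a * \<bar>\<kappa>\<bar>) \<le> prob U * exp (a * \<bar>\<kappa>\<bar>)"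
      using up unfolding U_def by (intro mult_right_mono) auto
    also have "\<dots> = (\<integral>\<omega>. indicator U \<omega> * exp (a * \<bar>\<kappa>\<bar>) \<partial>M)" using iU by simp
    also have "\<dots> \<le> f \<kappa>" unfolding f_def
    proof (rule integral_mono)
      fix \<omega>
      have "exp (a * \<bar>\<kappa>\<bar>) \<le> exp (\<kappa> * X \<omega>)" if "a \<le> X \<omega>"
        using mult_left_mono[OF that True] True by (simp add: mult.commute)
      then show "indicator U \<omega> * exp (a * \<bar>\<kappa>\<bar>) \<le> indicator {-n..n} (X \<omega>) * exp (\<kappa> * X \<omega>)"
        using pos by (auto simp: U_def indicator_def)
    qed (use iU fi in auto)
    finally show ?thesis .
  next
    case False
    have "p * exp (a * \<bar>\<kappa>\<bar>) \<le> prob D * exp (a * \<bar>\<kappa>\<bar>)"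
      using dn unfolding D_def by (intro mult_right_mono) auto
    also have "\<dots> = (\<integral>\<omega>. indicator D \<omega> * exp (a * \<bar>\<kappa>\<bar>) \<partial>M)" using iU by simp
    also have "\<dots> \<le> f \<kappa>" unfolding f_def
    proof (rule integral_mono)
      fix \<omega>
      have "exp (a * \<bar>\<kappa>\<bar>) \<le> exp (\<kappa> * X \<omega>)" if "X \<omega> \<le> - a"
        using mult_left_mono_neg[OF that, of \<kappa>] False by (simp add: mult.commute)
      then show "indicator D \<omega> * exp (a * \<bar>\<kappa>\<bar>) \<le> indicator {-n..n} (X \<omega>) * exp (\<kappa> * X \<omega>)"
        using pos by (auto simp: D_def indicator_def)
    qed (use iU fi in auto)
    finally show ?thesis .
  qed
  with \<kappa> f1 show ?thesis by (intro that) (auto simp: g_def)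
qed

lemma (in prob_space) prob_shell_pos:
  fixes X :: "'a \<Rightarrow> real"
  assumes [measurable]: "X \<in> borel_measurable M" and n: "\<not> (AE \<omega> in M. X \<omega> \<le> 0)"
  obtains j :: nat where "0 < prob {\<omega>\<in>space M. 1 / Suc j \<le> X \<omega> \<and> X \<omega> \<le> Suc j}"
proof (rule ccontr)
  assume "\<not> thesis"
  then have "\<not> 0 < prob {\<omega>\<in>space M. 1 / Suc j \<le> X \<omega> \<and> X \<omega> \<le> Suc j}" for j using that by blast
  then have "prob {\<omega>\<in>space M. 1 / Suc j \<le> X \<omega> \<and> X \<omega> \<le> Suc j} = 0" for j
    by (meson measure_nonneg not_le_imp_less order_antisym_conv not_less)
  then have "AE \<omega> in M. \<not> (1 / Suc j \<le> X \<omega> \<and> X \<omega> \<le> Suc j)" for j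
    by (subst AE_iff_measurable[OF _ refl]) (auto simp: emeasure_eq_measure)
  then have "AE \<omega> in M. \<forall>j. \<not> (1 / Suc j \<le> X \<omega> \<and> X \<omega> \<le> Suc j)"
    by (simp only: AE_all_countable) blast
  then have "AE \<omega> in M. X \<omega> \<le> 0"
  proof eventually_elim
    case (elim \<omega>)
    show ?case
    proof (rule ccontr)
      assume "\<not> X \<omega> \<le> 0"
      then have x: "0 < X \<omega>" by simp
      obtain j1 where j1: "inverse (real (Suc j1)) < X \<omega>" using reals_Archimedean[OF x] by blast
      obtain j2 where j2: "X \<omega> \<le> real j2" using real_arch_simple by blast
      define j where "j = max j1 j2"
      have "1 / Suc j \<le> 1 / Suc j1" by (rule divide_left_mono) (auto simp: j_def)
      then have "1 / Suc j \<le> X \<omega>" using j1 by (simp add: inverse_eq_divide)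
      moreover have "X \<omega> \<le> Suc j" using j2 by (simp add: j_def)
      ultimately show False using elim by blast
    qed
  qed
  with n show False by blast
qed

context levy_horizon
begin

text \<open>
  Under the tilted measure \<open>L T\<close> is bounded and centered, so the constant time \<open>T\<close> is a localizing
  sequence for the moment condition.
\<close>
lemma tilted_truncation_in_M_hat_loc:
  fixes n \<kappa> :: real
  defines "f \<equiv> \<integral>\<omega>. indicator {-n..n} (L T \<omega>) * exp (\<kappa> * L T \<omega>) \<partial>P"
  assumes f: "0 < f" and n: "0 \<le> n"
    and g: "(\<integral>\<omega>. indicator {-n..n} (L T \<omega>) * (L T \<omega> * exp (\<kappa> * L T \<omega>)) \<partial>P) = 0"
  obtains Q where "Q \<in> M_hat_loc P F T L" "rel_entropy Q P = ereal (- ln f)"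
proof -
  have X [measurable]: "L T \<in> borel_measurable P" using L_measurable[of T] T_pos by simp
  define Z where "Z \<omega> = indicator {-n..n} (L T \<omega>) * exp (\<kappa> * L T \<omega>) / f" for \<omega>
  have Zm [measurable]: "Z \<in> borel_measurable P" unfolding Z_def by measurable
  have Z0: "0 \<le> Z \<omega>" for \<omega> using f by (simp add: Z_def)
  have eb: "\<kappa> * x \<le> \<bar>\<kappa>\<bar> * n" if "- n \<le> x" "x \<le> n" for x :: real
  proof -
    have "\<kappa> * x \<le> \<bar>\<kappa>\<bar> * \<bar>x\<bar>" by (metis abs_ge_self abs_mult)
    also have "\<dots> \<le> \<bar>\<kappa>\<bar> * n" using that by (intro mult_left_mono) auto
    finally show ?thesis .
  qed
  have Zi: "integrable P Z"
    by (rule integrable_const_bound[where B="exp (\<bar>\<kappa>\<bar> * n) / f"])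
       (use f in \<open>auto simp: Z_def indicator_def eb divide_right_mono\<close>)
  have Z1: "(\<integral>\<omega>. Z \<omega> \<partial>P) = 1" using f by (simp add: Z_def f_def)
  have ZXi: "integrable P (\<lambda>\<omega>. Z \<omega> * L T \<omega>)"
  proof (rule Bochner_Integration.integrable_bound[where f="\<lambda>\<omega>. Z \<omega> * n"])
    show "integrable P (\<lambda>\<omega>. Z \<omega> * n)" using Zi by simp
    have "norm (Z \<omega> * L T \<omega>) \<le> norm (Z \<omega> * n)" for \<omega>
      using n Z0[of \<omega>] by (cases "L T \<omega> \<in> {-n..n}") (auto simp: abs_mult Z_def abs_le_iff intro!: mult_left_mono divide_right_mono)
    then show "AE \<omega> in P. norm (Z \<omega> * L T \<omega>) \<le> norm (Z \<omega> * n)" by simp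
  qed simp
  have ZX: "(\<integral>\<omega>. Z \<omega> * L T \<omega> \<partial>P) = 0"
  proof -
    have "(\<integral>\<omega>. Z \<omega> * L T \<omega> \<partial>P) =
        (\<integral>\<omega>. indicator {-n..n} (L T \<omega>) * (L T \<omega> * exp (\<kappa> * L T \<omega>)) / f \<partial>P)"
      by (intro Bochner_Integration.integral_cong) (auto simp: Z_def)
    then show ?thesis using g by simp
  qed
  have Zln: "Z \<omega> * ln (Z \<omega>) = \<kappa> * (Z \<omega> * L T \<omega>) - ln f * Z \<omega>" for \<omega>
    using f by (cases "L T \<omega> \<in> {-n..n}") (auto simp: Z_def ln_div algebra_simps diff_divide_distrib)
  have ent: "integrable P (\<lambda>\<omega>. Z \<omega> * ln (Z \<omega>))"
    unfolding Zln using Zi ZXi by auto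
  define Q where "Q = density P (\<lambda>\<omega>. ennreal (Z \<omega>))"
  have sQ: "space Q = space P" "sets Q = sets P" by (auto simp: Q_def)
  have "(\<integral>\<^sup>+\<omega>. ennreal (Z \<omega>) \<partial>P) = 1"
    using nn_integral_eq_integral[OF Zi] Z0 Z1 by simp
  then have "prob_space Q"
    unfolding Q_def by (intro prob_spaceI) (simp add: emeasure_density cong: nn_integral_cong_simp)
  moreover have "absolutely_continuous P Q" unfolding Q_def by (rule absolutely_continuousI_density) simp
  ultimately have ac: "Q \<in> ac_measures P F T" by (simp add: ac_measures_def restr_to_F_T sQ sets_P)
  have LQ: "integrable Q (L T)" "(\<integral>\<omega>. L T \<omega> \<partial>Q) = 0"
    using ZXi ZX Z0 by (auto simp: Q_def integrable_real_density integral_real_density)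
  have "local_moment_condition Q F T L"
    unfolding local_moment_condition_def
    by (rule exI[of _ "\<lambda>_ _. T"]) (use LQ T_pos in \<open>auto simp: stopping_time_const incseq_def\<close>)
  with ac LQ have "Q \<in> M_hat_loc P F T L"
    by (simp add: M_hat_loc_def M_tilde_loc0_def M_tilde_loc_def)
  moreover have "rel_entropy Q P = ereal (- ln f)"
    unfolding Q_def by (subst rel_entropy_density[OF Zm Z0 ent]) (use Zi ZXi ZX Z1 in \<open>simp add: Zln\<close>)
  ultimately show ?thesis by (rule that)
qed

text \<open>
  The tilts \<open>k l\<close> of the truncations stay bounded, and Fatou's lemma along a convergent subsequence with
  limit \<open>\<kappa>\<close> gives \<open>mgf \<kappa> \<le> liminf f l (k l)\<close>. This shows both that \<open>\<kappa>\<close> has a finite exponential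
  moment and that the entropies \<open>- ln (f l (k l))\<close> come down to \<open>- ln (mgf \<kappa>)\<close>. The mean of
  \<open>L T\<close> can be lost in the limit if \<open>\<kappa>\<close> is an end point of the interval on which the moment generating
  function is finite; the Esscher measure of \<open>\<kappa>\<close> is then no martingale measure.
\<close>
lemma entropy_minimizing_tilt:
  assumes up: "\<not> (AE \<omega> in P. L T \<omega> \<le> 0)" and dn: "\<not> (AE \<omega> in P. 0 \<le> L T \<omega>)"
  obtains \<kappa> where "integrable P (\<lambda>\<omega>. exp (\<kappa> * L T \<omega>))"
    "(INF Q\<in>M_hat_loc P F T L. rel_entropy Q P) \<le> ereal (- ln (mgf \<kappa>))"
proof -
  define X where "X = L T"
  have X [measurable]: "X \<in> borel_measurable P" using L_measurable[of T] T_pos by (simp add: X_def)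
  obtain i where i: "0 < prob {\<omega>\<in>space P. 1 / Suc i \<le> X \<omega> \<and> X \<omega> \<le> Suc i}"
    using prob_shell_pos[OF X] up unfolding X_def by blast
  obtain j where j: "0 < prob {\<omega>\<in>space P. 1 / Suc j \<le> - X \<omega> \<and> - X \<omega> \<le> Suc j}"
    using prob_shell_pos[of "\<lambda>\<omega>. - X \<omega>"] dn unfolding X_def by (auto simp: X_def[symmetric])
  define m where "m = max i j"
  define a where "a = 1 / real (Suc m)"
  define p where "p = min (prob {\<omega>\<in>space P. 1 / Suc i \<le> X \<omega> \<and> X \<omega> \<le> Suc i})
     (prob {\<omega>\<in>space P. 1 / Suc j \<le> - X \<omega> \<and> - X \<omega> \<le> Suc j})"
  define N where "N l = real (Suc (m + l))" for l
  have a: "0 < a" "a \<le> 1 / Suc i" "a \<le> 1 / Suc j"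
    unfolding a_def by (auto intro!: divide_left_mono simp: m_def)
  have N: "0 < N l" "real (Suc i) \<le> N l" "real (Suc j) \<le> N l" for l by (auto simp: N_def m_def)
  have p: "0 < p" using i j by (simp add: p_def)
  have pu: "p \<le> prob {\<omega>\<in>space P. a \<le> X \<omega> \<and> X \<omega> \<le> N l}" for l
  proof -
    have "p \<le> prob {\<omega>\<in>space P. 1 / Suc i \<le> X \<omega> \<and> X \<omega> \<le> Suc i}" by (simp add: p_def)
    also have "\<dots> \<le> prob {\<omega>\<in>space P. a \<le> X \<omega> \<and> X \<omega> \<le> N l}"
      by (rule finite_measure_mono) (use a N[of l] in auto)
    finally show ?thesis .
  qed
  have pd: "p \<le> prob {\<omega>\<in>space P. - N l \<le> X \<omega> \<and> X \<omega> \<le> - a}" for l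
  proof -
    have "p \<le> prob {\<omega>\<in>space P. 1 / Suc j \<le> - X \<omega> \<and> - X \<omega> \<le> Suc j}" by (simp add: p_def)
    also have "\<dots> \<le> prob {\<omega>\<in>space P. - N l \<le> X \<omega> \<and> X \<omega> \<le> - a}"
      by (rule finite_measure_mono) (use a N[of l] in auto)
    finally show ?thesis .
  qed
  define f where "f l \<kappa> = (\<integral>\<omega>. indicator {-N l..N l} (X \<omega>) * exp (\<kappa> * X \<omega>) \<partial>P)" for l \<kappa>
  have "\<exists>\<kappa>. (\<integral>\<omega>. indicator {-N l..N l} (X \<omega>) * (X \<omega> * exp (\<kappa> * X \<omega>)) \<partial>P) = 0 \<and>
     f l \<kappa> \<le> 1 \<and> p * exp (a * \<bar>\<kappa>\<bar>) \<le> f l \<kappa>" for l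
    using truncated_tilt[OF X a(1) p N(1) pu pd, of l] unfolding f_def by blast
  then obtain k where k: "\<And>l. (\<integral>\<omega>. indicator {-N l..N l} (X \<omega>) * (X \<omega> * exp (k l * X \<omega>)) \<partial>P) = 0"
    "\<And>l. f l (k l) \<le> 1" "\<And>l. p * exp (a * \<bar>k l\<bar>) \<le> f l (k l)" by metis
  have fpos: "0 < f l (k l)" for l
    using k(3)[of l] p mult_pos_pos[OF p exp_gt_zero[of "a * \<bar>k l\<bar>"]] by linarith
  have kb: "k l \<in> {- (1 / (a * p))..1 / (a * p)}" for l
  proof -
    have "p * (a * \<bar>k l\<bar>) \<le> p * exp (a * \<bar>k l\<bar>)"
      using p exp_ge_add_one_self[of "a * \<bar>k l\<bar>"] by (intro mult_left_mono) linarith+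
    also have "\<dots> \<le> 1" using k(2,3)[of l] by linarith
    finally have "\<bar>k l\<bar> \<le> 1 / (a * p)" using p a by (simp add: field_simps)
    then show ?thesis by auto
  qed
  have "seq_compact {- (1 / (a * p))..1 / (a * p)}" by (rule compact_imp_seq_compact) simp
  then obtain \<kappa> r where r: "strict_mono (r :: nat \<Rightarrow> nat)" "(k \<circ> r) \<longlonglongrightarrow> \<kappa>"
    using kb unfolding seq_compact_def by metis
  have rl: "l \<le> r l" for l using r(1) by (rule seq_suble)
  define u where "u l \<omega> = ennreal (indicator {-N (r l)..N (r l)} (X \<omega>) * exp (k (r l) * X \<omega>))" for l \<omega>
  have um [measurable]: "u l \<in> borel_measurable P" for l unfolding u_def by measurable
  have ui: "(\<integral>\<^sup>+\<omega>. u l \<omega> \<partial>P) = ennreal (f (r l) (k (r l)))" for l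
    unfolding u_def f_def
  proof (rule nn_integral_eq_integral)
    show "integrable P (\<lambda>\<omega>. indicator {-N (r l)..N (r l)} (X \<omega>) * exp (k (r l) * X \<omega>))"
      using fpos[of "r l"] unfolding f_def by (metis not_integrable_integral_eq less_irrefl)
  qed simp
  have lim: "liminf (\<lambda>l. u l \<omega>) = ennreal (exp (\<kappa> * X \<omega>))" for \<omega>
  proof (rule lim_imp_Liminf)
    have "(\<lambda>l. ennreal (exp (k (r l) * X \<omega>))) \<longlonglongrightarrow> ennreal (exp (\<kappa> * X \<omega>))"
      using r(2) unfolding o_def by (intro tendsto_intros tendsto_ennrealI)
    moreover obtain l0 :: nat where l0: "\<bar>X \<omega>\<bar> \<le> real l0" using real_arch_simple by blast
    have "eventually (\<lambda>l. ennreal (exp (k (r l) * X \<omega>)) = u l \<omega>) sequentially"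
      unfolding eventually_sequentially
    proof (intro exI allI impI)
      fix l assume "l0 \<le> l"
      then have "\<bar>X \<omega>\<bar> \<le> N (r l)" using l0 rl[of l] unfolding N_def by linarith
      then show "ennreal (exp (k (r l) * X \<omega>)) = u l \<omega>" unfolding u_def by (simp add: abs_le_iff)
    qed
    ultimately show "(\<lambda>l. u l \<omega>) \<longlonglongrightarrow> ennreal (exp (\<kappa> * X \<omega>))" by (rule Lim_transform_eventually)
  qed simp
  have fatou: "(\<integral>\<^sup>+\<omega>. ennreal (exp (\<kappa> * X \<omega>)) \<partial>P) \<le> liminf (\<lambda>l. ennreal (f (r l) (k (r l))))"
    using nn_integral_liminf[of u P, OF um] unfolding lim ui .
  also have "\<dots> \<le> liminf (\<lambda>l. 1)"
    using k(2) by (intro Liminf_mono always_eventually allI) (simp add: ennreal_le_1)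
  finally have le1: "(\<integral>\<^sup>+\<omega>. ennreal (exp (\<kappa> * X \<omega>)) \<partial>P) \<le> 1" by (simp add: Liminf_const)
  have int: "integrable P (\<lambda>\<omega>. exp (\<kappa> * X \<omega>))"
    by (rule integrableI_nonneg) (use le_less_trans[OF le1] in auto)
  have mp: "0 < mgf \<kappa>" using mgf_pos int by (simp add: X_def)
  have mgf: "(\<integral>\<^sup>+\<omega>. ennreal (exp (\<kappa> * X \<omega>)) \<partial>P) = ennreal (mgf \<kappa>)"
    using nn_integral_eq_integral[OF int] by (simp add: mgf_def X_def)
  have "(INF Q\<in>M_hat_loc P F T L. rel_entropy Q P) \<le> ereal (- ln (mgf \<kappa>))"
  proof (rule ereal_le_epsilon2)
    fix e :: real assume e: "0 < e"
    have "mgf \<kappa> * exp (- e) < mgf \<kappa>" using mp e by simp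
    then have "ennreal (mgf \<kappa> * exp (- e)) < liminf (\<lambda>l. ennreal (f (r l) (k (r l))))"
      using fatou unfolding mgf using mp by (intro less_le_trans[OF _ fatou[unfolded mgf]]) (simp add: ennreal_less_iff)
    then have "eventually (\<lambda>l. ennreal (mgf \<kappa> * exp (- e)) < ennreal (f (r l) (k (r l)))) sequentially"
      by (rule less_LiminfD)
    then obtain l where "ennreal (mgf \<kappa> * exp (- e)) < ennreal (f (r l) (k (r l)))"
      using eventually_happens'[OF sequentially_bot] by (metis (no_types, lifting))
    then have l: "mgf \<kappa> * exp (- e) < f (r l) (k (r l))" using mp by (simp add: ennreal_less_iff)
    have "ln (mgf \<kappa> * exp (- e)) < ln (f (r l) (k (r l)))"
      using l mp fpos by (intro ln_less_cancel_iff[THEN iffD2]) auto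
    then have l': "- ln (f (r l) (k (r l))) \<le> - ln (mgf \<kappa>) + e" using mp by (simp add: ln_mult)
    note tilt = tilted_truncation_in_M_hat_loc[of "N (r l)" "k (r l)", folded X_def, folded f_def]
    obtain Q where "Q \<in> M_hat_loc P F T L" "rel_entropy Q P = ereal (- ln (f (r l) (k (r l))))"
      by (rule tilt[OF fpos less_imp_le[OF N(1)] k(1)])
    then show "(INF Q\<in>M_hat_loc P F T L. rel_entropy Q P) \<le> ereal (- ln (mgf \<kappa>)) + ereal e"
      using l' by (intro INF_lower2[of Q]) auto
  qed
  with int show ?thesis by (intro that[of \<kappa>]) (auto simp: X_def)
qed

end

section \<open>Integrability and characteristic functions at zero\<close>

lemma one_minus_cos_nonneg: "0 \<le> 1 - cos (x::real)"
  using cos_le_one[of x] by linarith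

lemma one_minus_cos_le: "1 - cos (w::real) \<le> w\<^sup>2 / 2"
proof -
  have "cos w = 1 - 2 * (sin (w / 2))\<^sup>2" using cos_double_sin[of "w / 2"] by simp
  moreover have "(sin (w / 2))\<^sup>2 \<le> (w / 2)\<^sup>2"
    using abs_sin_x_le_abs_x[of "w / 2"] by (simp only: abs_le_square_iff)
  ultimately show ?thesis by (simp add: power2_eq_square)
qed

text \<open>
  A function of linear growth whose defect from homogeneity, \<open>K w - 2 K (w / 2)\<close>, dominates
  \<open>1 - cos w\<close>. It bounds the dyadic sum \<open>\<Sum>j. 2 ^ j * (1 - cos (v / 2 ^ j))\<close> by a telescoping one.
\<close>
definition cos_majorant :: "real \<Rightarrow> real" where
  "cos_majorant w = 12 * w\<^sup>2 / (1 + \<bar>w\<bar>)"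

lemma cos_majorant_bounds: "0 \<le> cos_majorant w" "cos_majorant w \<le> 12 * \<bar>w\<bar>"
proof -
  show "0 \<le> cos_majorant w" by (simp add: cos_majorant_def)
  have "12 * w\<^sup>2 \<le> 12 * \<bar>w\<bar> * (1 + \<bar>w\<bar>)" by (simp add: algebra_simps power2_eq_square)
  then show "cos_majorant w \<le> 12 * \<bar>w\<bar>"
    unfolding cos_majorant_def by (simp add: pos_divide_le_eq add_pos_nonneg)
qed

lemma one_minus_cos_le_majorant_diff:
  "1 - cos w \<le> cos_majorant w - 2 * cos_majorant (w / 2)"
proof -
  define x where "x = \<bar>w\<bar>"
  have x: "0 \<le> x" by (simp add: x_def)
  have w2: "w\<^sup>2 = x\<^sup>2" by (simp add: x_def)
  have "cos_majorant w - 2 * cos_majorant (w / 2) = 12 * x\<^sup>2 / (1 + x) - 2 * (12 * (x\<^sup>2 / 4) / (1 + x / 2))"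
    by (simp add: cos_majorant_def power_divide x_def)
  also have "\<dots> = 12 * x\<^sup>2 / ((1 + x) * (2 + x))"
    using x by (simp add: divide_simps) (simp add: algebra_simps power2_eq_square)
  finally have eq: "cos_majorant w - 2 * cos_majorant (w / 2) = 12 * x\<^sup>2 / ((1 + x) * (2 + x))" .
  show ?thesis
  proof (cases "x \<le> 1")
    case True
    have "(1 + x) * (2 + x) \<le> 2 * 3" using x True by (intro mult_mono) auto
    then have "12 * x\<^sup>2 / 6 \<le> 12 * x\<^sup>2 / ((1 + x) * (2 + x))"
      using x by (intro divide_left_mono) auto
    then show ?thesis unfolding eq using one_minus_cos_le[of w] w2 zero_le_power2[of x] by linarith
  next
    case False
    have "(1 + x) * (2 + x) \<le> (2 * x) * (3 * x)" using False by (intro mult_mono) auto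
    then have "2 * ((1 + x) * (2 + x)) \<le> 12 * x\<^sup>2" by (simp add: power2_eq_square)
    then have "2 \<le> 12 * x\<^sup>2 / ((1 + x) * (2 + x))"
      using x by (simp add: le_divide_eq)
    then show ?thesis unfolding eq using cos_ge_minus_one[of w] by linarith
  qed
qed

lemma dyadic_cos_sum_le:
  fixes v :: real
  shows "(\<Sum>j<n. 2 ^ j * (1 - cos (v / 2 ^ j))) \<le> 12 * \<bar>v\<bar>"
proof -
  have "(\<Sum>j<n. 2 ^ j * (1 - cos (v / 2 ^ j))) \<le> cos_majorant v - 2 ^ n * cos_majorant (v / 2 ^ n)"
  proof (induction n)
    case (Suc n)
    have "2 ^ n * (1 - cos (v / 2 ^ n)) \<le> 2 ^ n * (cos_majorant (v / 2 ^ n) - 2 * cos_majorant (v / 2 ^ n / 2))"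
      by (intro mult_left_mono one_minus_cos_le_majorant_diff) auto
    also have "\<dots> = 2 ^ n * cos_majorant (v / 2 ^ n) - 2 ^ Suc n * cos_majorant (v / 2 ^ Suc n)"
      by (simp add: algebra_simps)
    finally show ?case using Suc by simp
  qed simp
  also have "\<dots> \<le> 12 * \<bar>v\<bar>"
    using cos_majorant_bounds(2)[of v] mult_nonneg_nonneg[OF _ cos_majorant_bounds(1), of "2 ^ n" "v / 2 ^ n"]
    by simp
  finally show ?thesis .
qed

text \<open>
  One term of the dyadic sum is enough: the one with \<open>\<bar>v\<bar> / 2 ^ j\<close> in \<open>[1, 2]\<close>, an interval on which
  \<open>1 - cos\<close> is bounded below by \<open>1 - cos 1\<close>.
\<close>
lemma abs_le_dyadic_cos:
  fixes v :: real assumes "1 \<le> \<bar>v\<bar>"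
  obtains j where "\<bar>v\<bar> \<le> 2 / (1 - cos 1) * (2 ^ j * (1 - cos (v / 2 ^ j)))"
proof -
  have "1 \<le> nat \<lfloor>\<bar>v\<bar>\<rfloor>" using assms by linarith
  then obtain j where j: "2 ^ j \<le> nat \<lfloor>\<bar>v\<bar>\<rfloor>" "nat \<lfloor>\<bar>v\<bar>\<rfloor> < 2 ^ (j + 1)"
    using ex_power_ivl1[of 2 "nat \<lfloor>\<bar>v\<bar>\<rfloor>"] by auto
  have "real (2 ^ j) \<le> real (nat \<lfloor>\<bar>v\<bar>\<rfloor>)" using j(1) by (simp only: of_nat_le_iff)
  then have 1: "2 ^ j \<le> \<bar>v\<bar>" using assms by (simp add: le_floor_iff)
  have "real (nat \<lfloor>\<bar>v\<bar>\<rfloor> + 1) \<le> real (2 ^ (j + 1))" using j(2) by (intro of_nat_mono) simp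
  then have 2: "\<bar>v\<bar> \<le> 2 * 2 ^ j" using assms real_nat_ceiling_ge[of "\<bar>v\<bar>"] by simp linarith
  define w where "w = \<bar>v\<bar> / 2 ^ j"
  have w: "1 \<le> w" "w \<le> 2" using 1 2 by (auto simp: w_def field_simps)
  have "cos w \<le> cos 1" using w pi_ge_two by (intro cos_monotone_0_pi_le) auto
  moreover have "cos w = cos (v / 2 ^ j)" unfolding w_def by (cases "0 \<le> v") auto
  ultimately have c: "1 - cos 1 \<le> 1 - cos (v / 2 ^ j)" by simp
  have c1: "(0::real) < 1 - cos 1"
    using cos_monotone_0_pi[of 0 1] pi_ge_two by simp
  have "\<bar>v\<bar> \<le> 2 * 2 ^ j * 1" using 2 by simp
  also have "\<dots> \<le> 2 * 2 ^ j * ((1 - cos (v / 2 ^ j)) / (1 - cos 1))"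
    using c c1 by (intro mult_left_mono) (auto simp: le_divide_eq)
  also have "\<dots> = 2 / (1 - cos 1) * (2 ^ j * (1 - cos (v / 2 ^ j)))" by simp
  finally show ?thesis by (rule that)
qed

lemma (in prob_space) integrable_one_minus_cos:
  assumes [measurable]: "X \<in> borel_measurable M"
  shows "integrable M (\<lambda>\<omega>. 1 - cos (u * X \<omega> :: real))"
proof (rule integrable_const_bound[where B=2])
  have "norm (1 - cos (u * X \<omega>)) \<le> 2" for \<omega>
    using cos_ge_minus_one[of "u * X \<omega>"] cos_le_one[of "u * X \<omega>"] by (simp add: abs_le_iff)
  then show "AE \<omega> in M. norm (1 - cos (u * X \<omega>)) \<le> 2" by simp
qed simp

text \<open>
  The dyadic sum is at most of order \<open>\<bar>v\<bar>\<close>, and for \<open>\<bar>v\<bar> \<ge> 1\<close> also at least, so a first moment is finite exactly if the means of the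
  terms are summable. This is the discrete form of the criterion that
  \<open>(1 - Re \<phi>(u)) / u\<^sup>2\<close> be integrable at \<open>0\<close>, \<open>\<phi>\<close> being the characteristic function. This lemma and
  the next are its two halves.
\<close>
lemma (in prob_space) summable_dyadic_cos:
  fixes Y :: "'a \<Rightarrow> real" assumes Y: "integrable M Y"
  shows "summable (\<lambda>j. 2 ^ j * (\<integral>\<omega>. 1 - cos (a / 2 ^ j * Y \<omega>) \<partial>M))"
proof (rule summableI_nonneg_bounded)
  have i: "integrable M (\<lambda>\<omega>. 1 - cos (u * Y \<omega>))" for u
    using integrable_one_minus_cos Y by auto
  have i': "integrable M (\<lambda>\<omega>. 1 - cos (a * Y \<omega> / 2 ^ j))" for j using i[of "a / 2 ^ j"] by simp
  show "0 \<le> 2 ^ j * (\<integral>\<omega>. 1 - cos (a / 2 ^ j * Y \<omega>) \<partial>M)" for j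
    by (intro mult_nonneg_nonneg Bochner_Integration.integral_nonneg one_minus_cos_nonneg) simp
  fix n
  have "(\<Sum>j<n. 2 ^ j * (\<integral>\<omega>. 1 - cos (a / 2 ^ j * Y \<omega>) \<partial>M)) =
      (\<integral>\<omega>. (\<Sum>j<n. 2 ^ j * (1 - cos (a / 2 ^ j * Y \<omega>))) \<partial>M)"
    using i' by (subst Bochner_Integration.integral_sum) auto
  also have "\<dots> \<le> (\<integral>\<omega>. 12 * \<bar>a * Y \<omega>\<bar> \<partial>M)"
  proof (rule integral_mono)
    show "(\<Sum>j<n. 2 ^ j * (1 - cos (a / 2 ^ j * Y \<omega>))) \<le> 12 * \<bar>a * Y \<omega>\<bar>" for \<omega>
      using dyadic_cos_sum_le[of "a * Y \<omega>" n] by simp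
  qed (use i' Y in auto)
  finally show "(\<Sum>j<n. 2 ^ j * (\<integral>\<omega>. 1 - cos (a / 2 ^ j * Y \<omega>) \<partial>M)) \<le> (\<integral>\<omega>. 12 * \<bar>a * Y \<omega>\<bar> \<partial>M)" .
qed

lemma (in prob_space) integrable_if_summable_dyadic_cos:
  fixes X :: "'a \<Rightarrow> real"
  assumes X [measurable]: "X \<in> borel_measurable M" and a: "0 < a"
    and le: "\<And>j. (\<integral>\<omega>. 1 - cos (a / 2 ^ j * X \<omega>) \<partial>M) \<le> b j"
    and b: "summable (\<lambda>j. 2 ^ j * b j)"
  shows "integrable M X"
proof -
  define C :: real where "C = 2 / (1 - cos 1)"
  have C: "0 \<le> C" using cos_le_one[of 1] by (simp add: C_def)
  have b0: "0 \<le> b j" for j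
    using le[of j] Bochner_Integration.integral_nonneg[of M "\<lambda>\<omega>. 1 - cos (a / 2 ^ j * X \<omega>)"] one_minus_cos_nonneg
    by (meson order_trans)
  let ?k = "\<lambda>j \<omega>. ennreal (2 ^ j * (1 - cos (a / 2 ^ j * X \<omega>)))"
  have pt: "ennreal \<bar>a * X \<omega>\<bar> \<le> 1 + ennreal C * (\<Sum>j. ?k j \<omega>)" for \<omega>
  proof (cases "1 \<le> \<bar>a * X \<omega>\<bar>")
    case True
    then obtain j where j: "\<bar>a * X \<omega>\<bar> \<le> C * (2 ^ j * (1 - cos (a * X \<omega> / 2 ^ j)))"
      unfolding C_def by (rule abs_le_dyadic_cos)
    have nn: "0 \<le> 2 ^ j * (1 - cos (a / 2 ^ j * X \<omega>))"
      by (rule mult_nonneg_nonneg[OF _ one_minus_cos_nonneg]) simp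
    have "(\<Sum>i\<in>{j}. ?k i \<omega>) \<le> (\<Sum>i. ?k i \<omega>)"
      by (rule sum_le_suminf[OF summableI]) auto
    then have single: "?k j \<omega> \<le> (\<Sum>i. ?k i \<omega>)"
      by (simp only: sum.insert sum.empty finite.emptyI empty_iff not_False_eq_True add_0_right)
    have "ennreal \<bar>a * X \<omega>\<bar> \<le> ennreal (C * (2 ^ j * (1 - cos (a / 2 ^ j * X \<omega>))))"
      using j by (intro ennreal_leI) simp
    also have "\<dots> = ennreal C * ?k j \<omega>"
      by (rule ennreal_mult[OF C nn])
    also have "\<dots> \<le> ennreal C * (\<Sum>j. ?k j \<omega>)"
      by (rule mult_left_mono[OF single]) simp
    finally show ?thesis by (rule order_trans) simp
  next
    case False
    then have "ennreal \<bar>a * X \<omega>\<bar> \<le> ennreal 1" by (intro ennreal_leI) simp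
    then show ?thesis by (simp add: add_increasing2)
  qed
  have kj: "(\<integral>\<^sup>+\<omega>. ?k j \<omega> \<partial>M) \<le> ennreal (2 ^ j * b j)" for j
  proof -
    have i: "integrable M (\<lambda>\<omega>. 2 ^ j * (1 - cos (a / 2 ^ j * X \<omega>)))"
      using integrable_one_minus_cos[OF X, of "a / 2 ^ j"] by auto
    have "(\<integral>\<^sup>+\<omega>. ?k j \<omega> \<partial>M) = ennreal (\<integral>\<omega>. 2 ^ j * (1 - cos (a / 2 ^ j * X \<omega>)) \<partial>M)"
      by (rule nn_integral_eq_integral[OF i]) (simp add: one_minus_cos_nonneg)
    also have "(\<integral>\<omega>. 2 ^ j * (1 - cos (a / 2 ^ j * X \<omega>)) \<partial>M) = 2 ^ j * (\<integral>\<omega>. 1 - cos (a / 2 ^ j * X \<omega>) \<partial>M)"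
      by (rule integral_mult_right_zero)
    also have "ennreal \<dots> \<le> ennreal (2 ^ j * b j)"
      using le[of j] by (intro ennreal_leI mult_left_mono) auto
    finally show ?thesis .
  qed
  have "(\<integral>\<^sup>+\<omega>. ennreal \<bar>a * X \<omega>\<bar> \<partial>M) \<le> (\<integral>\<^sup>+\<omega>. 1 + ennreal C * (\<Sum>j. ?k j \<omega>) \<partial>M)"
    by (intro nn_integral_mono pt)
  also have "\<dots> = 1 + ennreal C * (\<Sum>j. \<integral>\<^sup>+\<omega>. ?k j \<omega> \<partial>M)"
    by (subst nn_integral_add) (auto simp: nn_integral_cmult nn_integral_suminf emeasure_space_1)
  also have "\<dots> \<le> 1 + ennreal C * (\<Sum>j. ennreal (2 ^ j * b j))"
    by (intro add_left_mono mult_left_mono suminf_le kj) auto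
  also have "(\<Sum>j. ennreal (2 ^ j * b j)) = ennreal (\<Sum>j. 2 ^ j * b j)"
    using b b0 by (intro suminf_ennreal2) auto
  also have "1 + ennreal C * ennreal (\<Sum>j. 2 ^ j * b j) < \<infinity>"
    by (simp add: ennreal_mult_less_top)
  finally have fin: "(\<integral>\<^sup>+\<omega>. ennreal \<bar>a * X \<omega>\<bar> \<partial>M) < \<infinity>" .
  have "integrable M (\<lambda>\<omega>. a * X \<omega>)"
    by (rule integrableI_bounded) (use fin in auto)
  then show ?thesis using a by simp
qed

lemma norm_exp_minus_one_minus_le:
  fixes z :: complex assumes "norm z \<le> 1"
  shows "norm (exp z - 1 - z) \<le> 3 * (norm z)\<^sup>2"
proof -
  have "norm (exp z - (\<Sum>i\<le>1. z ^ i / fact i)) \<le> exp (norm z) * (norm z ^ Suc 1) / fact 1"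
    by (rule Taylor_exp_field)
  also have "exp (norm z) * (norm z ^ Suc 1) / fact 1 \<le> 3 * (norm z)\<^sup>2"
    using assms exp_le order_trans[of "exp (norm z)" "exp 1" 3]
    by (auto simp: power2_eq_square intro!: mult_right_mono)
  finally show ?thesis by (simp add: diff_diff_eq)
qed

lemma norm_iexp_minus_one_le: "norm (exp (\<i> * complex_of_real x) - 1) \<le> \<bar>x\<bar>"
  using iexp_approx1[of x 0] by simp

lemma (in prob_space) char_difference_quotient:
  fixes X :: "'a \<Rightarrow> real" and u :: "nat \<Rightarrow> real"
  assumes X: "integrable M X" and u: "u \<longlonglongrightarrow> 0" "\<And>n. u n \<noteq> 0"
  shows "(\<lambda>n. ((\<integral>\<omega>. exp (\<i> * u n * X \<omega>) \<partial>M) - 1) / u n) \<longlonglongrightarrow> \<i> * (\<integral>\<omega>. X \<omega> \<partial>M)"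
proof -
  have [measurable]: "X \<in> borel_measurable M" using X by auto
  have i: "integrable M (\<lambda>\<omega>. exp (\<i> * u n * X \<omega>))" for n
    by (rule integrable_const_bound[where B=1]) auto
  have "((\<integral>\<omega>. exp (\<i> * u n * X \<omega>) \<partial>M) - 1) / u n = (\<integral>\<omega>. (exp (\<i> * u n * X \<omega>) - 1) / u n \<partial>M)" for n
    unfolding integral_divide_zero using i by (subst Bochner_Integration.integral_diff) (auto simp: prob_space)
  moreover have "(\<lambda>n. \<integral>\<omega>. (exp (\<i> * u n * X \<omega>) - 1) / u n \<partial>M) \<longlonglongrightarrow> (\<integral>\<omega>. \<i> * X \<omega> \<partial>M)"
  proof (rule integral_dominated_convergence[where w="\<lambda>\<omega>. \<bar>X \<omega>\<bar>"])
    show "AE \<omega> in M. norm ((exp (\<i> * u n * X \<omega>) - 1) / u n) \<le> \<bar>X \<omega>\<bar>" for n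
    proof (rule AE_I2)
      fix \<omega>
      have "norm (exp (\<i> * u n * X \<omega>) - 1) \<le> \<bar>u n * X \<omega>\<bar>"
        using norm_iexp_minus_one_le[of "u n * X \<omega>"] by (simp add: mult.assoc)
      then show "norm ((exp (\<i> * u n * X \<omega>) - 1) / u n) \<le> \<bar>X \<omega>\<bar>"
        using u(2)[of n] by (simp add: norm_divide abs_mult divide_le_eq mult.commute)
    qed
    show "AE \<omega> in M. (\<lambda>n. (exp (\<i> * u n * X \<omega>) - 1) / u n) \<longlonglongrightarrow> \<i> * X \<omega>"
    proof (rule AE_I2)
      fix \<omega>
      have "((\<lambda>z. exp (\<i> * X \<omega> * z)) has_field_derivative \<i> * X \<omega>) (at 0)"
        by (auto intro!: derivative_eq_intros)
      then have "((\<lambda>z. (exp (\<i> * X \<omega> * z) - 1) / z) \<longlongrightarrow> \<i> * X \<omega>) (at 0)"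
        by (simp add: has_field_derivative_iff)
      moreover have "filterlim (\<lambda>n. complex_of_real (u n)) (at 0) sequentially"
        unfolding filterlim_at using u tendsto_of_real[OF u(1), where 'a=complex] by auto
      ultimately have "(\<lambda>n. (exp (\<i> * X \<omega> * u n) - 1) / u n) \<longlonglongrightarrow> \<i> * X \<omega>"
        by (rule filterlim_compose)
      then show "(\<lambda>n. (exp (\<i> * u n * X \<omega>) - 1) / u n) \<longlonglongrightarrow> \<i> * X \<omega>"
        by (simp add: mult_ac)
    qed
  qed (use X in auto)
  moreover have "(\<integral>\<omega>. \<i> * X \<omega> \<partial>M) = \<i> * (\<integral>\<omega>. X \<omega> \<partial>M)" using X by simp
  ultimately show ?thesis by (simp only:)
qed

section \<open>The characteristic exponent at a stopping time\<close>

context levy_horizon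
begin

definition chf :: "real \<Rightarrow> real \<Rightarrow> complex" where
  "chf t u = (\<integral>\<omega>. exp (\<i> * u * complex_of_real (L t \<omega>)) \<partial>P)"

lemma chf_integrable:
  assumes "0 \<le> t" "t \<le> T"
  shows "integrable P (\<lambda>\<omega>. exp (\<i> * complex_of_real u * complex_of_real (L t \<omega>)))"
proof (rule integrable_const_bound[where B=1])
  note [measurable] = L_measurable[OF assms]
  show "(\<lambda>\<omega>. exp (\<i> * complex_of_real u * complex_of_real (L t \<omega>))) \<in> borel_measurable P"
    by measurable
qed simp

lemma chf_0 [simp]: "chf t 0 = 1"
  by (simp add: chf_def prob_space)

lemma chf_continuous:
  assumes "0 \<le> t" "t \<le> T" shows "continuous_on UNIV (chf t)"
  unfolding continuous_on_sequentially
proof (intro allI ballI impI)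
  fix x :: "nat \<Rightarrow> real" and u assume "(\<forall>i. x i \<in> UNIV) \<and> x \<longlonglongrightarrow> u"
  then have lim: "x \<longlonglongrightarrow> u" by simp
  show "(chf t \<circ> x) \<longlonglongrightarrow> chf t u"
    unfolding o_def chf_def
    by (rule integral_dominated_convergence[where w="\<lambda>_. 1"])
       (auto intro!: AE_I2 tendsto_intros lim borel_measurable_integrable[OF chf_integrable[OF assms]])
qed

lemma chf_right_continuous:
  assumes "0 \<le> t" "t \<le> T"
  shows "(\<lambda>n. chf (grid (Suc n) (grid_index (Suc n) t)) u) \<longlonglongrightarrow> chf t u"
  unfolding chf_def
proof (rule integral_dominated_convergence[where w="\<lambda>_. 1"])
  show "(\<lambda>\<omega>. exp (\<i> * complex_of_real u * complex_of_real (L (grid (Suc n) (grid_index (Suc n) t)) \<omega>)))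
      \<in> borel_measurable P" for n
    using assms(2)
    by (intro borel_measurable_integrable[OF chf_integrable] grid_le_T grid_index_le) auto
  show "AE \<omega> in P. (\<lambda>n. exp (\<i> * complex_of_real u * complex_of_real (L (grid (Suc n) (grid_index (Suc n) t)) \<omega>)))
      \<longlonglongrightarrow> exp (\<i> * complex_of_real u * complex_of_real (L t \<omega>))"
    by (intro AE_I2 tendsto_intros L_right_limit assms)
qed (auto intro: borel_measurable_integrable[OF chf_integrable[OF assms]])

text \<open>
  Near \<open>0\<close> the characteristic function of \<open>L T\<close> avoids the negative half-line, so \<open>\<psi>\<close> can be taken as a
  principal logarithm. The point is that \<open>chf (T / N)\<close> is the right branch of the \<open>N\<close>-th root: the
  quotient \<open>h\<close> of the two candidates is an \<open>N\<close>-th root of unity that depends continuously on \<open>u\<close> and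
  equals \<open>1\<close> at \<open>0\<close>, so it is constant. Right-continuity in time covers the times off the grids.
\<close>
lemma characteristic_exponent:
  obtains \<psi> :: "real \<Rightarrow> complex" and \<delta> :: real where "0 < \<delta>" "\<psi> \<midarrow>0\<rightarrow> 0"
    "\<And>N u. 0 < N \<Longrightarrow> \<bar>u\<bar> < \<delta> \<Longrightarrow> chf (grid N 1) u = exp (\<psi> u * of_real (grid N 1))"
    "\<And>t u. 0 \<le> t \<Longrightarrow> t \<le> T \<Longrightarrow> \<bar>u\<bar> < \<delta> \<Longrightarrow> chf t u = exp (\<psi> u * of_real t)"
proof -
  have T: "0 \<le> T" "T \<le> T" using T_pos by auto
  have "isCont (chf T) 0"
    using chf_continuous[OF T] by (simp add: continuous_on_eq_continuous_at)
  then have "chf T \<midarrow>0\<rightarrow> 1" unfolding isCont_def chf_0 .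
  then obtain \<delta> where \<delta>: "0 < \<delta>" and near: "\<And>u. u \<noteq> 0 \<Longrightarrow> norm u < \<delta> \<Longrightarrow> norm (chf T u - 1) < 1"
    using LIM_D[of "chf T" 1 0 1] by auto
  have notneg: "chf T u \<notin> \<real>\<^sub>\<le>\<^sub>0" if "\<bar>u\<bar> < \<delta>" for u
  proof (cases "u = 0")
    case False
    then have "norm (chf T u - 1) < 1" using near that by simp
    then have "\<bar>Re (chf T u - 1)\<bar> < 1" using abs_Re_le_cmod le_less_trans by blast
    then have "0 < Re (chf T u)" by simp
    then show ?thesis by (auto simp: complex_nonpos_Reals_iff)
  qed simp
  define \<psi> where "\<psi> u = Ln (chf T u) / of_real T" for u
  have psiT: "exp (\<psi> u * of_real T) = chf T u" if "\<bar>u\<bar> < \<delta>" for u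
    using notneg[OF that] T_pos exp_Ln[of "chf T u"] by (cases "chf T u = 0") (auto simp: \<psi>_def)
  have contpsi: "continuous_on {-\<delta><..<\<delta>} \<psi>"
    unfolding \<psi>_def using T_pos notneg
    by (intro continuous_intros continuous_on_subset[OF chf_continuous[OF T]]) (auto simp: abs_less_iff)
  have "isCont \<psi> 0"
    using contpsi \<delta> by (simp add: continuous_on_eq_continuous_at)
  then have psi0: "\<psi> \<midarrow>0\<rightarrow> 0" by (simp add: isCont_def \<psi>_def)
  have grid1: "chf (grid N 1) u = exp (\<psi> u * of_real (grid N 1))" if N: "0 < N" and u: "\<bar>u\<bar> < \<delta>" for N u
  proof -
    define h where "h u = chf (grid N 1) u / exp (\<psi> u * of_real (grid N 1))" for u
    have g1: "0 \<le> grid N 1" "grid N 1 \<le> T" using N by (auto intro!: grid_le_T)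
    have root: "h v ^ N = 1" if v: "\<bar>v\<bar> < \<delta>" for v
    proof -
      have "chf (grid N 1) v ^ N = chf (grid N N) v"
        unfolding chf_def by (rule exp_moment_power[symmetric, OF chf_integrable N]) auto
      also have "\<dots> = exp (\<psi> v * of_real T)" using psiT[OF v] by (simp add: grid_top[OF N])
      also have "\<dots> = exp (\<psi> v * of_real (grid N 1)) ^ N"
        using N by (simp add: exp_of_nat_mult[symmetric] grid_def)
      finally show ?thesis by (simp add: h_def power_divide)
    qed
    have "continuous_on {-\<delta><..<\<delta>} h"
      unfolding h_def by (intro continuous_intros continuous_on_subset[OF chf_continuous[OF g1]] contpsi) auto
    moreover have "finite (h ` {-\<delta><..<\<delta>})"
    proof (rule finite_subset)
      show "h ` {-\<delta><..<\<delta>} \<subseteq> {z. z ^ N = 1}" using root by (auto simp: abs_less_iff)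
      show "finite {z::complex. z ^ N = 1}" using N by (intro finite_roots_unity) simp
    qed
    ultimately have "h constant_on {-\<delta><..<\<delta>}"
      by (intro continuous_finite_range_constant) auto
    then have "h u = h 0" using u \<delta> unfolding constant_on_def by (auto simp: abs_less_iff)
    also have "h 0 = 1" by (simp add: h_def \<psi>_def)
    finally show ?thesis by (simp add: h_def)
  qed
  have gen: "chf t u = exp (\<psi> u * of_real t)" if t: "0 \<le> t" "t \<le> T" and u: "\<bar>u\<bar> < \<delta>" for t u
  proof (rule LIMSEQ_unique[OF chf_right_continuous[OF t]])
    have "chf (grid (Suc n) (grid_index (Suc n) t)) u = exp (\<psi> u * of_real (grid (Suc n) (grid_index (Suc n) t)))" for n
    proof -
      let ?k = "grid_index (Suc n) t"
      have k: "?k \<le> Suc n" using t by (intro grid_index_le) auto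
      have "chf (grid (Suc n) ?k) u = chf (grid (Suc n) 1) u ^ ?k"
        unfolding chf_def by (rule exp_moment_power[OF chf_integrable _ k]) auto
      also have "\<dots> = exp (\<psi> u * of_real (grid (Suc n) 1)) ^ ?k"
        by (subst grid1[OF _ u]) auto
      also have "\<dots> = exp (\<psi> u * of_real (grid (Suc n) ?k))"
        by (simp add: exp_of_nat_mult[symmetric] grid_def mult_ac)
      finally show ?thesis .
    qed
    moreover have "(\<lambda>n. exp (\<psi> u * of_real (grid (Suc n) (grid_index (Suc n) t)))) \<longlonglongrightarrow> exp (\<psi> u * of_real t)"
      by (intro tendsto_intros grid_index_tendsto t)
    ultimately show "(\<lambda>n. chf (grid (Suc n) (grid_index (Suc n) t)) u) \<longlonglongrightarrow> exp (\<psi> u * of_real t)"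
      by simp
  qed
  show ?thesis by (rule that[OF \<delta> psi0 grid1 gen])
qed

lemma chf_optional_stopping:
  fixes p :: complex
  assumes p: "\<And>N. 0 < N \<Longrightarrow> chf (grid N 1) u = exp (p * of_real (grid N 1))"
    and tau: "stopping_time F \<tau>" and nn: "\<And>\<omega>. \<omega> \<in> space P \<Longrightarrow> 0 \<le> \<tau> \<omega>"
  shows "(\<integral>\<omega>. exp (\<i> * u * of_real (L (min (\<tau> \<omega>) T) \<omega>) - p * of_real (min (\<tau> \<omega>) T)) \<partial>P) = 1"
proof -
  define s where "s n \<omega> = grid (Suc n) (grid_index (Suc n) (min (\<tau> \<omega>) T))" for n \<omega>
  note st = exp_optional_stopping_grid[OF tau zero_less_Suc chf_integrable p[unfolded chf_def, OF zero_less_Suc], folded s_def]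
  have sb: "0 \<le> s n \<omega>" "s n \<omega> \<le> T" for n \<omega>
    unfolding s_def by (auto intro!: grid_le_T grid_index_le)
  have 1: "(\<integral>\<omega>. exp (\<i> * u * of_real (L (s n \<omega>) \<omega>) - p * of_real (s n \<omega>)) \<partial>P) = 1" for n
    by (rule st(2)) auto
  have m: "(\<lambda>\<omega>. exp (\<i> * u * of_real (L (s n \<omega>) \<omega>) - p * of_real (s n \<omega>))) \<in> borel_measurable P" for n
    by (rule borel_measurable_integrable, rule st(1)) auto
  note [measurable] = L_stopped_measurable[OF tau nn] measurable_bounded_stopping_time[OF tau]
  have "(\<lambda>n. \<integral>\<omega>. exp (\<i> * u * of_real (L (s n \<omega>) \<omega>) - p * of_real (s n \<omega>)) \<partial>P)
      \<longlonglongrightarrow> (\<integral>\<omega>. exp (\<i> * u * of_real (L (min (\<tau> \<omega>) T) \<omega>) - p * of_real (min (\<tau> \<omega>) T)) \<partial>P)"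
  proof (rule integral_dominated_convergence[where w="\<lambda>_. exp (\<bar>Re p\<bar> * T)"])
    show "AE \<omega> in P. (\<lambda>n. exp (\<i> * u * of_real (L (s n \<omega>) \<omega>) - p * of_real (s n \<omega>)))
      \<longlonglongrightarrow> exp (\<i> * u * of_real (L (min (\<tau> \<omega>) T) \<omega>) - p * of_real (min (\<tau> \<omega>) T))"
    proof (rule AE_I2)
      fix \<omega> assume \<omega>: "\<omega> \<in> space P"
      have "0 \<le> min (\<tau> \<omega>) T" using nn[OF \<omega>] T_pos by simp
      then show "(\<lambda>n. exp (\<i> * u * of_real (L (s n \<omega>) \<omega>) - p * of_real (s n \<omega>)))
        \<longlonglongrightarrow> exp (\<i> * u * of_real (L (min (\<tau> \<omega>) T) \<omega>) - p * of_real (min (\<tau> \<omega>) T))"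
        unfolding s_def by (intro tendsto_intros L_right_limit[OF \<omega>] grid_index_tendsto) auto
    qed
    show "AE \<omega> in P. norm (exp (\<i> * u * of_real (L (s n \<omega>) \<omega>) - p * of_real (s n \<omega>))) \<le> exp (\<bar>Re p\<bar> * T)" for n
    proof (rule AE_I2)
      fix \<omega>
      have "- (Re p * s n \<omega>) \<le> \<bar>Re p\<bar> * s n \<omega>"
        using mult_right_mono[of "- Re p" "\<bar>Re p\<bar>" "s n \<omega>"] sb by simp
      also have "\<dots> \<le> \<bar>Re p\<bar> * T" using sb by (intro mult_left_mono) auto
      finally show "norm (exp (\<i> * u * of_real (L (s n \<omega>) \<omega>) - p * of_real (s n \<omega>))) \<le> exp (\<bar>Re p\<bar> * T)"
        by simp
    qed
  qed (use m in auto)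
  then show ?thesis unfolding 1 by (simp add: LIMSEQ_const_iff)
qed

text \<open>
  The identity \<open>E[exp (i u Y - p \<sigma>)] = 1\<close> for \<open>Y = L\<^sub>\<sigma>\<close>, expanded to first order in \<open>p\<close>. The error
  consists of the second order term of \<open>exp (- p \<sigma>)\<close> and of the replacement of \<open>exp (i u Y)\<close> by \<open>1\<close>
  in front of \<open>p \<sigma>\<close>.
\<close>
lemma chf_stopped_expansion:
  fixes p :: complex
  assumes p: "\<And>N. 0 < N \<Longrightarrow> chf (grid N 1) u = exp (p * of_real (grid N 1))" and small: "norm p * T \<le> 1"
    and tau: "stopping_time F \<tau>" and nn: "\<And>\<omega>. \<omega> \<in> space P \<Longrightarrow> 0 \<le> \<tau> \<omega>"
    and Y: "integrable P (\<lambda>\<omega>. L (min (\<tau> \<omega>) T) \<omega>)"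
  shows "norm (1 - (\<integral>\<omega>. exp (\<i> * u * of_real (L (min (\<tau> \<omega>) T) \<omega>)) \<partial>P)
        + p * of_real (\<integral>\<omega>. min (\<tau> \<omega>) T \<partial>P))
      \<le> 3 * (norm p * T)\<^sup>2 + norm p * T * \<bar>u\<bar> * (\<integral>\<omega>. \<bar>L (min (\<tau> \<omega>) T) \<omega>\<bar> \<partial>P)"
proof -
  define Y where "Y \<omega> = L (min (\<tau> \<omega>) T) \<omega>" for \<omega>
  define s where "s \<omega> = min (\<tau> \<omega>) T" for \<omega>
  define e where "e \<omega> = exp (\<i> * u * of_real (Y \<omega>))" for \<omega>
  define q where "q \<omega> = exp (- (p * of_real (s \<omega>)))" for \<omega>
  have Yi: "integrable P Y" using Y by (simp add: Y_def[abs_def])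
  have sm [measurable]: "s \<in> borel_measurable P" unfolding s_def by (rule measurable_bounded_stopping_time[OF tau])
  have Ym [measurable]: "Y \<in> borel_measurable P" using Yi by auto
  have em [measurable]: "e \<in> borel_measurable P" "q \<in> borel_measurable P" unfolding e_def q_def by auto
  have sb: "0 \<le> s \<omega>" "s \<omega> \<le> T" if "\<omega> \<in> space P" for \<omega>
    using nn[OF that] T_pos by (auto simp: s_def)
  have ne: "norm (e \<omega>) = 1" for \<omega> by (simp add: e_def)
  have ie: "integrable P e" by (rule integrable_const_bound[where B=1]) (auto simp: ne)
  have si: "integrable P s" by (rule integrable_const_bound[where B=T]) (use sb in \<open>auto intro!: AE_I2\<close>)
  have np: "norm (p * of_real (s \<omega>)) \<le> norm p * T" if "\<omega> \<in> space P" for \<omega>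
    using sb[OF that] by (simp add: norm_mult mult_left_mono)
  have nq: "norm (q \<omega> - 1 + p * of_real (s \<omega>)) \<le> 3 * (norm p * T)\<^sup>2" if "\<omega> \<in> space P" for \<omega>
  proof -
    have "norm (exp (- (p * of_real (s \<omega>))) - 1 - - (p * of_real (s \<omega>))) \<le> 3 * (norm (- (p * of_real (s \<omega>))))\<^sup>2"
      using np[OF that] small by (intro norm_exp_minus_one_minus_le) simp
    also have "\<dots> \<le> 3 * (norm p * T)\<^sup>2"
      using np[OF that] by (intro mult_left_mono power_mono) auto
    finally show ?thesis by (simp add: q_def)
  qed
  define R where "R \<omega> = e \<omega> * (q \<omega> - 1 + p * of_real (s \<omega>)) - p * of_real (s \<omega>) * (e \<omega> - 1)" for \<omega>
  have Rn: "norm (R \<omega>) \<le> 3 * (norm p * T)\<^sup>2 + norm p * T * \<bar>u\<bar> * \<bar>Y \<omega>\<bar>" if \<omega>: "\<omega> \<in> space P" for \<omega>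
  proof -
    have "norm (e \<omega> - 1) \<le> \<bar>u\<bar> * \<bar>Y \<omega>\<bar>"
      using norm_iexp_minus_one_le[of "u * Y \<omega>"] by (simp add: e_def abs_mult mult.assoc)
    then have "norm (p * of_real (s \<omega>)) * norm (e \<omega> - 1) \<le> (norm p * T) * (\<bar>u\<bar> * \<bar>Y \<omega>\<bar>)"
      using np[OF \<omega>] T_pos by (intro mult_mono) auto
    moreover have "norm (R \<omega>) \<le> norm (e \<omega> * (q \<omega> - 1 + p * of_real (s \<omega>))) + norm (p * of_real (s \<omega>) * (e \<omega> - 1))"
      unfolding R_def by (rule norm_triangle_ineq4)
    ultimately show ?thesis using nq[OF \<omega>] by (simp add: norm_mult ne mult.assoc)
  qed
  have iB: "integrable P (\<lambda>\<omega>. 3 * (norm p * T)\<^sup>2 + norm p * T * \<bar>u\<bar> * \<bar>Y \<omega>\<bar>)" using Yi by auto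
  have Re: "R \<omega> = exp (\<i> * u * of_real (Y \<omega>) - p * of_real (s \<omega>)) - e \<omega> + p * of_real (s \<omega>)" for \<omega>
    by (simp add: R_def e_def q_def exp_diff exp_minus field_simps)
  have ieq: "integrable P (\<lambda>\<omega>. exp (\<i> * u * of_real (Y \<omega>) - p * of_real (s \<omega>)))"
  proof (rule integrable_const_bound[where B="exp (norm p * T)"])
    have "norm (exp (\<i> * u * of_real (Y \<omega>) - p * of_real (s \<omega>))) \<le> exp (norm p * T)" if "\<omega> \<in> space P" for \<omega>
    proof -
      have "- (Re p * s \<omega>) \<le> norm (p * of_real (s \<omega>))"
        using abs_Re_le_cmod[of "p * of_real (s \<omega>)"] by simp
      then show ?thesis using np[OF that] by simp
    qed
    then show "AE \<omega> in P. norm (exp (\<i> * u * of_real (Y \<omega>) - p * of_real (s \<omega>))) \<le> exp (norm p * T)"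
      by (rule AE_I2)
  qed measurable
  have "(\<integral>\<omega>. R \<omega> \<partial>P) = 1 - (\<integral>\<omega>. e \<omega> \<partial>P) + p * of_real (\<integral>\<omega>. s \<omega> \<partial>P)"
    unfolding Re using chf_optional_stopping[OF p tau nn, folded s_def Y_def] ieq ie si
    by (simp add: Y_def[symmetric])
  moreover have "norm (\<integral>\<omega>. R \<omega> \<partial>P) \<le> (\<integral>\<omega>. 3 * (norm p * T)\<^sup>2 + norm p * T * \<bar>u\<bar> * \<bar>Y \<omega>\<bar> \<partial>P)"
  proof (rule order_trans[OF integral_norm_bound integral_mono[OF integrable_norm iB Rn]])
    show "integrable P R" unfolding Re using ieq ie si by auto
  qed
  moreover have "(\<integral>\<omega>. 3 * (norm p * T)\<^sup>2 + norm p * T * \<bar>u\<bar> * \<bar>Y \<omega>\<bar> \<partial>P) =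
     3 * (norm p * T)\<^sup>2 + norm p * T * \<bar>u\<bar> * (\<integral>\<omega>. \<bar>Y \<omega>\<bar> \<partial>P)"
    using Yi by (simp add: prob_space)
  ultimately show ?thesis unfolding e_def s_def Y_def by simp
qed

end

section \<open>From a centered stopped value to the martingale property\<close>

lemma (in prob_space) one_minus_Re_char:
  fixes X :: "'a \<Rightarrow> real"
  assumes [measurable]: "X \<in> borel_measurable M"
  shows "1 - Re (\<integral>\<omega>. exp (\<i> * complex_of_real u * complex_of_real (X \<omega>)) \<partial>M) = (\<integral>\<omega>. 1 - cos (u * X \<omega>) \<partial>M)"
proof -
  have i: "integrable M (\<lambda>\<omega>. exp (\<i> * complex_of_real u * complex_of_real (X \<omega>)))"
    by (rule integrable_const_bound[where B=1]) auto
  have ic: "integrable M (\<lambda>\<omega>. cos (u * X \<omega>))"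
    by (rule integrable_const_bound[where B=1]) auto
  have "Re (\<integral>\<omega>. exp (\<i> * complex_of_real u * complex_of_real (X \<omega>)) \<partial>M) =
      (\<integral>\<omega>. Re (exp (\<i> * complex_of_real u * complex_of_real (X \<omega>))) \<partial>M)"
    by (rule integral_Re[OF i, symmetric])
  also have "\<dots> = (\<integral>\<omega>. cos (u * X \<omega>) \<partial>M)"
    by (intro Bochner_Integration.integral_cong) (auto simp: Re_exp)
  finally show ?thesis using ic by (simp add: prob_space)
qed

context levy_horizon
begin

text \<open>
  Let \<open>Y = L\<^sub>\<sigma>\<close> with \<open>\<sigma> = min \<tau> T\<close>, let \<open>\<eta>\<close> be its characteristic function and \<open>s = E[\<sigma>]\<close>. Since
  \<open>1 - \<eta>(u) = O(u)\<close>, the expansion above gives first \<open>\<psi>(u) = O(u)\<close> and then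
  \<open>1 - \<eta>(u) + \<psi>(u) s = O(u\<^sup>2)\<close>. The real part of this bounds \<open>E[1 - cos (u L\<^sub>t)]\<close> by a multiple of
  \<open>E[1 - cos (u Y)]\<close> plus \<open>O(u\<^sup>2)\<close>, and the integrability of \<open>Y\<close> carries over to \<open>L\<^sub>t\<close> by the dyadic
  criterion. As \<open>Y\<close> is centered, \<open>1 - \<eta>(u) = o(u)\<close>, hence \<open>\<psi>(u) = o(u)\<close>, which is to say that the
  characteristic function of \<open>L\<^sub>t\<close> has derivative \<open>0\<close> at \<open>0\<close>.
\<close>
lemma centered_if_stopped_centered:
  assumes tau: "stopping_time F \<tau>" and nn: "\<And>\<omega>. \<omega> \<in> space P \<Longrightarrow> 0 \<le> \<tau> \<omega>"
    and Yi: "integrable P (\<lambda>\<omega>. L (min (\<tau> \<omega>) T) \<omega>)" and Y0: "(\<integral>\<omega>. L (min (\<tau> \<omega>) T) \<omega> \<partial>P) = 0"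
    and S: "0 < (\<integral>\<omega>. min (\<tau> \<omega>) T \<partial>P)" and t: "0 \<le> t" "t \<le> T"
  shows "integrable P (L t)" "(\<integral>\<omega>. L t \<omega> \<partial>P) = 0"
proof -
  obtain \<psi> \<delta> where \<delta>: "0 < \<delta>" and psi0: "\<psi> \<midarrow>0\<rightarrow> 0"
    and grid1: "\<And>N u. 0 < N \<Longrightarrow> \<bar>u\<bar> < \<delta> \<Longrightarrow> chf (grid N 1) u = exp (\<psi> u * of_real (grid N 1))"
    and chf_eq: "\<And>t u. 0 \<le> t \<Longrightarrow> t \<le> T \<Longrightarrow> \<bar>u\<bar> < \<delta> \<Longrightarrow> chf t u = exp (\<psi> u * of_real t)"
    by (rule characteristic_exponent) (rule that)
  define Y where "Y \<omega> = L (min (\<tau> \<omega>) T) \<omega>" for \<omega>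
  define s where "s = (\<integral>\<omega>. min (\<tau> \<omega>) T \<partial>P)"
  define A where "A = (\<integral>\<omega>. \<bar>Y \<omega>\<bar> \<partial>P)"
  define \<eta> where "\<eta> u = (\<integral>\<omega>. exp (\<i> * complex_of_real u * complex_of_real (Y \<omega>)) \<partial>P)" for u
  have Y: "integrable P Y" using Yi by (simp add: Y_def[abs_def])
  have Ym [measurable]: "Y \<in> borel_measurable P" using Y by auto
  have s: "0 < s" using S by (simp add: s_def)
  have A: "0 \<le> A" by (simp add: A_def)
  have "((\<lambda>u. T * \<bar>u\<bar> * A + 3 * T\<^sup>2 * norm (\<psi> u)) \<longlongrightarrow> T * \<bar>0\<bar> * A + 3 * T\<^sup>2 * norm (0::complex)) (at 0)"
    by (intro tendsto_intros psi0)
  then have "eventually (\<lambda>u. T * \<bar>u\<bar> * A + 3 * T\<^sup>2 * norm (\<psi> u) < s / 2) (at 0)"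
    using s by (intro order_tendstoD) auto
  moreover have "((\<lambda>u. norm (\<psi> u) * T) \<longlongrightarrow> norm (0::complex) * T) (at 0)"
    by (intro tendsto_intros psi0)
  then have "eventually (\<lambda>u. norm (\<psi> u) * T < 1) (at 0)" by (intro order_tendstoD) auto
  ultimately have "eventually (\<lambda>u. T * \<bar>u\<bar> * A + 3 * T\<^sup>2 * norm (\<psi> u) < s / 2 \<and> norm (\<psi> u) * T < 1) (at 0)"
    by (rule eventually_conj)
  then obtain \<delta>1 where \<delta>1: "0 < \<delta>1" "\<And>u. u \<noteq> 0 \<Longrightarrow> \<bar>u\<bar> < \<delta>1 \<Longrightarrow>
      T * \<bar>u\<bar> * A + 3 * T\<^sup>2 * norm (\<psi> u) < s / 2 \<and> norm (\<psi> u) * T < 1"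
    unfolding eventually_at by (auto simp: dist_real_def)
  \<comment> \<open>the scale of the dyadic sequence \<open>a / 2 ^ j\<close> at which all estimates are evaluated\<close>
  define a where "a = min \<delta> \<delta>1 / 2"
  have a: "0 < a" "a < \<delta>" "a < \<delta>1" using \<delta> \<delta>1 by (auto simp: a_def)
  define B where "B = 2 * A / s"
  define C where "C = 3 * T\<^sup>2 * B\<^sup>2 + B * T * A"
  have B0: "0 \<le> B" and C0: "0 \<le> C" using A s T_pos by (auto simp: B_def C_def)
  have est: "norm (1 - \<eta> u + \<psi> u * of_real s) \<le> C * u\<^sup>2" "norm (chf t u - 1 - \<psi> u * of_real t) \<le> 3 * T\<^sup>2 * B\<^sup>2 * u\<^sup>2"
    "norm (chf t u - 1) \<le> 4 * T * norm (\<psi> u)" if u: "0 < u" "u \<le> a" for u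
  proof -
    have ud: "\<bar>u\<bar> < \<delta>" and small: "T * \<bar>u\<bar> * A + 3 * T\<^sup>2 * norm (\<psi> u) < s / 2" "norm (\<psi> u) * T < 1"
      using u a \<delta>1(2)[of u] by auto
    define p where "p = norm (\<psi> u)"
    have p0: "0 \<le> p" by (simp add: p_def)
    have "norm (\<integral>\<omega>. exp (\<i> * complex_of_real u * complex_of_real (Y \<omega>)) - 1 \<partial>P) \<le> (\<integral>\<omega>. u * \<bar>Y \<omega>\<bar> \<partial>P)"
    proof (rule order_trans[OF integral_norm_bound integral_mono[OF integrable_norm]])
      show "norm (exp (\<i> * complex_of_real u * complex_of_real (Y \<omega>)) - 1) \<le> u * \<bar>Y \<omega>\<bar>" for \<omega>
        using norm_iexp_minus_one_le[of "u * Y \<omega>"] u by (simp add: abs_mult mult.assoc)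
      show "integrable P (\<lambda>\<omega>. exp (\<i> * complex_of_real u * complex_of_real (Y \<omega>)) - 1)"
        by (rule integrable_const_bound[where B=2]) (auto intro!: order_trans[OF norm_triangle_ineq4])
    qed (use Y in auto)
    also have "(\<integral>\<omega>. exp (\<i> * complex_of_real u * complex_of_real (Y \<omega>)) - 1 \<partial>P) = \<eta> u - 1"
    proof -
      have "integrable P (\<lambda>\<omega>. exp (\<i> * complex_of_real u * complex_of_real (Y \<omega>)))"
        by (rule integrable_const_bound[where B=1]) auto
      then show ?thesis by (simp add: \<eta>_def prob_space)
    qed
    finally have e1: "norm (1 - \<eta> u) \<le> u * A" by (simp add: A_def norm_minus_commute)
    have e2: "norm (1 - \<eta> u + \<psi> u * of_real s) \<le> 3 * (p * T)\<^sup>2 + p * T * u * A"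
      using chf_stopped_expansion[OF grid1[OF _ ud] _ tau nn Yi] small(2) u
      by (simp add: \<eta>_def Y_def s_def A_def p_def)
    \<comment> \<open>for small \<open>u\<close> the error is at most half of the left-hand side and can be absorbed\<close>
    have "p * s = norm (\<psi> u * of_real s)" using s by (simp add: p_def norm_mult)
    also have "\<dots> \<le> norm (1 - \<eta> u + \<psi> u * of_real s) + norm (1 - \<eta> u)"
      using norm_triangle_ineq4[of "1 - \<eta> u + \<psi> u * of_real s" "1 - \<eta> u"] by simp
    also have "\<dots> \<le> p * (T * u * A + 3 * T\<^sup>2 * p) + u * A"
      using e1 e2 by (simp add: power_mult_distrib algebra_simps power2_eq_square)
    also have "\<dots> \<le> p * (s / 2) + u * A"
      using small(1) u p0 unfolding p_def by (intro add_right_mono mult_left_mono) auto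
    finally have "p * s \<le> 2 * A * u" by (simp add: algebra_simps)
    then have pB: "p \<le> B * u" using s by (simp add: B_def field_simps)
    have pB2: "p\<^sup>2 \<le> B\<^sup>2 * u\<^sup>2"
      using power_mono[OF pB p0, of 2] by (simp add: power_mult_distrib)
    have "p * (T * u * A) \<le> B * u * (T * u * A)"
      using pB T_pos u A by (intro mult_right_mono) auto
    moreover have "3 * T\<^sup>2 * p\<^sup>2 \<le> 3 * T\<^sup>2 * (B\<^sup>2 * u\<^sup>2)" using pB2 by (intro mult_left_mono) auto
    ultimately show "norm (1 - \<eta> u + \<psi> u * of_real s) \<le> C * u\<^sup>2"
      using e2 unfolding C_def by (simp add: power_mult_distrib algebra_simps power2_eq_square)
    define z where "z = \<psi> u * of_real t"
    have zp: "norm z \<le> p * T" using t p0 by (simp add: z_def p_def norm_mult mult_left_mono)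
    then have z1: "norm z \<le> 1" using small(2) by (simp add: p_def)
    have chz: "chf t u = exp z" using chf_eq[OF t ud] by (simp add: z_def)
    note ez = norm_exp_minus_one_minus_le[OF z1]
    have "(norm z)\<^sup>2 \<le> (p * T)\<^sup>2" using zp by (intro power_mono) auto
    also have "\<dots> \<le> B\<^sup>2 * u\<^sup>2 * T\<^sup>2" using pB2 by (simp add: power_mult_distrib mult_right_mono)
    finally show "norm (chf t u - 1 - \<psi> u * of_real t) \<le> 3 * T\<^sup>2 * B\<^sup>2 * u\<^sup>2"
      using ez unfolding chz z_def[symmetric] by (simp add: mult_ac)
    have "(norm z)\<^sup>2 \<le> norm z" using z1 mult_left_le[of "norm z" "norm z"] by (simp add: power2_eq_square)
    then have "norm (exp z - 1) \<le> 4 * norm z"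
      using ez norm_triangle_ineq[of "exp z - 1 - z" z] by simp
    then show "norm (chf t u - 1) \<le> 4 * T * norm (\<psi> u)"
      using zp unfolding chz p_def by (simp add: mult_ac)
  qed
  define K where "K = T / s * C + 3 * T\<^sup>2 * B\<^sup>2"
  have cos_le: "(\<integral>\<omega>. 1 - cos (u * L t \<omega>) \<partial>P) \<le> T / s * (\<integral>\<omega>. 1 - cos (u * Y \<omega>) \<partial>P) + K * u\<^sup>2"
    if u: "0 < u" "u \<le> a" for u
  proof -
    define J where "J = (\<integral>\<omega>. 1 - cos (u * Y \<omega>) \<partial>P)"
    have J0: "0 \<le> J" unfolding J_def by (intro Bochner_Integration.integral_nonneg one_minus_cos_nonneg)
    have J: "1 - Re (\<eta> u) = J" unfolding \<eta>_def J_def by (rule one_minus_Re_char[OF Ym])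
    have "(\<integral>\<omega>. 1 - cos (u * L t \<omega>) \<partial>P) = 1 - Re (chf t u)"
      unfolding chf_def by (rule one_minus_Re_char[OF L_measurable[OF t], symmetric])
    also have "\<dots> = - Re (\<psi> u) * t - Re (chf t u - 1 - \<psi> u * of_real t)" by simp
    also have "\<dots> \<le> - Re (\<psi> u) * t + 3 * T\<^sup>2 * B\<^sup>2 * u\<^sup>2"
      using est(2)[OF u] abs_Re_le_cmod[of "chf t u - 1 - \<psi> u * of_real t"] by linarith
    finally have 1: "(\<integral>\<omega>. 1 - cos (u * L t \<omega>) \<partial>P) \<le> - Re (\<psi> u) * t + 3 * T\<^sup>2 * B\<^sup>2 * u\<^sup>2" .
    have "- Re (1 - \<eta> u + \<psi> u * of_real s) \<le> C * u\<^sup>2"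
      using est(1)[OF u] abs_Re_le_cmod[of "1 - \<eta> u + \<psi> u * of_real s"] by linarith
    then have "- Re (\<psi> u) * s \<le> J + C * u\<^sup>2" using J by simp
    then have "- Re (\<psi> u) \<le> (J + C * u\<^sup>2) / s" using s by (simp add: le_divide_eq)
    then have "- Re (\<psi> u) * t \<le> (J + C * u\<^sup>2) / s * t" using t by (intro mult_right_mono) auto
    also have "\<dots> \<le> (J + C * u\<^sup>2) / s * T" using t J0 C0 s by (intro mult_left_mono) auto
    finally show ?thesis using 1 unfolding K_def J_def[symmetric] by (simp add: algebra_simps add_divide_distrib)
  qed
  have dy: "0 < a / 2 ^ j" "a / 2 ^ j \<le> a" for j :: nat
    using a by (auto simp: divide_le_eq)
  show Lt: "integrable P (L t)"
  proof (rule integrable_if_summable_dyadic_cos[OF L_measurable[OF t] a(1) cos_le[OF dy]])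
    have "summable (\<lambda>j. T / s * (2 ^ j * (\<integral>\<omega>. 1 - cos (a / 2 ^ j * Y \<omega>) \<partial>P)) + K * a\<^sup>2 * (1 / 2) ^ j)"
      by (intro summable_add summable_mult summable_dyadic_cos Y summable_geometric) simp
    moreover have "T / s * (2 ^ j * (\<integral>\<omega>. 1 - cos (a / 2 ^ j * Y \<omega>) \<partial>P)) + K * a\<^sup>2 * (1 / 2) ^ j =
        2 ^ j * (T / s * (\<integral>\<omega>. 1 - cos (a / 2 ^ j * Y \<omega>) \<partial>P) + K * (a / 2 ^ j)\<^sup>2)" for j
      by (simp add: distrib_left power_divide power2_eq_square)
    ultimately show "summable (\<lambda>j. 2 ^ j * (T / s * (\<integral>\<omega>. 1 - cos (a / 2 ^ j * Y \<omega>) \<partial>P) + K * (a / 2 ^ j)\<^sup>2))"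
      by (simp only:)
  qed
  define u where "u n = a / 2 ^ n" for n :: nat
  have u0: "u \<longlonglongrightarrow> 0" unfolding u_def
    using LIMSEQ_power_zero[of "1/2::real", THEN tendsto_mult_left[of _ _ _ a]] by (simp add: power_divide)
  have upos: "0 < u n" "u n \<le> a" "u n \<noteq> 0" for n using dy[of n] by (auto simp: u_def)
  have l1: "(\<lambda>n. (chf t (u n) - 1) / u n) \<longlonglongrightarrow> \<i> * (\<integral>\<omega>. L t \<omega> \<partial>P)"
    unfolding chf_def by (rule char_difference_quotient[OF Lt u0 upos(3)])
  have l2: "(\<lambda>n. (\<eta> (u n) - 1) / u n) \<longlonglongrightarrow> 0"
    using char_difference_quotient[OF Y u0 upos(3)] Y0 unfolding \<eta>_def by (simp add: Y_def)
  have "(\<lambda>n. (chf t (u n) - 1) / u n) \<longlonglongrightarrow> 0"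
  proof (rule Lim_null_comparison[OF always_eventually])
    show "\<forall>n. norm ((chf t (u n) - 1) / u n) \<le> 4 * T / s * (norm ((\<eta> (u n) - 1) / u n) + C * u n)"
    proof
      fix n
      let ?u = "u n"
      have "norm (\<psi> ?u) * s = norm (\<psi> ?u * of_real s)" using s by (simp add: norm_mult)
      also have "\<dots> \<le> norm (1 - \<eta> ?u + \<psi> ?u * of_real s) + norm (\<eta> ?u - 1)"
        using norm_triangle_ineq[of "1 - \<eta> ?u + \<psi> ?u * of_real s" "\<eta> ?u - 1"] by simp
      also have "\<dots> \<le> C * ?u\<^sup>2 + norm (\<eta> ?u - 1)" using est(1)[OF upos(1,2)[of n]] by simp
      finally have "norm (\<psi> ?u) \<le> (C * ?u\<^sup>2 + norm (\<eta> ?u - 1)) / s" using s by (simp add: le_divide_eq)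
      then have "4 * T * norm (\<psi> ?u) \<le> 4 * T * ((C * ?u\<^sup>2 + norm (\<eta> ?u - 1)) / s)"
        using T_pos by (intro mult_left_mono) auto
      with est(3)[OF upos(1,2)[of n]] have "norm (chf t ?u - 1) \<le> 4 * T * ((C * ?u\<^sup>2 + norm (\<eta> ?u - 1)) / s)"
        by linarith
      then have "norm (chf t ?u - 1) / ?u \<le> 4 * T * ((C * ?u\<^sup>2 + norm (\<eta> ?u - 1)) / s) / ?u"
        using upos(1)[of n] by (intro divide_right_mono) auto
      also have "\<dots> = 4 * T / s * (norm (\<eta> ?u - 1) / ?u + C * ?u)"
        using upos(1)[of n] s by (simp add: field_simps power2_eq_square)
      finally show "norm ((chf t ?u - 1) / ?u) \<le> 4 * T / s * (norm ((\<eta> ?u - 1) / ?u) + C * ?u)"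
        using upos(1)[of n] by (simp add: norm_divide)
    qed
    have "(\<lambda>n. 4 * T / s * (norm ((\<eta> (u n) - 1) / u n) + C * u n)) \<longlonglongrightarrow> 4 * T / s * (norm (0::complex) + C * 0)"
      by (intro tendsto_intros l2 u0)
    then show "(\<lambda>n. 4 * T / s * (norm ((\<eta> (u n) - 1) / u n) + C * u n)) \<longlonglongrightarrow> 0" by simp
  qed
  from LIMSEQ_unique[OF l1 this] show "(\<integral>\<omega>. L t \<omega> \<partial>P) = 0" by simp
qed

lemma martingale_if_centered:
  assumes int: "\<And>t. 0 \<le> t \<Longrightarrow> t \<le> T \<Longrightarrow> integrable P (L t)"
    and mean: "\<And>t. 0 \<le> t \<Longrightarrow> t \<le> T \<Longrightarrow> (\<integral>\<omega>. L t \<omega> \<partial>P) = 0"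
  shows "martingale_on P F T L"
  unfolding martingale_on_def
proof (intro conjI ballI)
  fix s t assume "s \<in> {0..T}" "t \<in> {s..T}"
  then have st: "0 \<le> s" "s \<le> t" "t \<le> T" and t0: "0 \<le> t" "s \<le> T" "0 \<le> t - s" "t - s \<le> T" by auto
  interpret finite_measure_subalgebra P "F s"
    by (unfold_locales) (rule subalgebra_F[OF t0(2)])
  show "AE \<omega> in P. real_cond_exp P (F s) (L t) \<omega> = L s \<omega>"
  proof (rule real_cond_exp_charact)
    fix A assume A: "A \<in> sets (F s)"
    then have AP: "A \<in> sets P" by (rule sets_F_le[OF t0(2)])
    have i: "integrable P (\<lambda>\<omega>. indicator A \<omega> * L t \<omega>)" "integrable P (\<lambda>\<omega>. indicator A \<omega> * L s \<omega>)"
      using integrable_mult_indicator[OF AP int[OF t0(1) st(3)]] integrable_mult_indicator[OF AP int[OF st(1) t0(2)]]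
      by simp_all
    have "(\<integral>\<omega>. indicator A \<omega> * (L t \<omega> - L s \<omega>) \<partial>P) = (\<integral>\<omega>. indicator A \<omega> \<partial>P) * (\<integral>\<omega>. L (t - s) \<omega> \<partial>P)"
      by (rule integral_increment(2)[OF st _ _ _ int[OF t0(3,4)]])
         (use A AP in \<open>auto simp: integrable_indicator_iff emeasure_eq_measure\<close>)
    then have "(\<integral>\<omega>. indicator A \<omega> * L t \<omega> - indicator A \<omega> * L s \<omega> \<partial>P) = 0"
      using mean[OF t0(3,4)] by (simp add: right_diff_distrib)
    then show "(\<integral>\<omega>\<in>A. L t \<omega> \<partial>P) = (\<integral>\<omega>\<in>A. L s \<omega> \<partial>P)"
      using i by (simp add: set_lebesgue_integral_def)
  qed (use int st t0 adapted in auto)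
qed (use int adapted in auto)

lemma martingale_if_localized:
  assumes loc: "zero_mean_localization P F T L \<tau>"
  shows "martingale_on P F T L"
proof -
  have "eventually (\<lambda>k. 0 < (\<integral>\<omega>. min (\<tau> k \<omega>) T \<partial>P)) sequentially"
    using localization_mean_time[OF prob_space_axioms refl loc] T_pos by (rule order_tendstoD(1))
  then have "\<exists>k. 0 < (\<integral>\<omega>. min (\<tau> k \<omega>) T \<partial>P)"
    by (rule eventually_happens'[OF sequentially_bot])
  then obtain k where k: "0 < (\<integral>\<omega>. min (\<tau> k \<omega>) T \<partial>P)" ..
  have tau: "stopping_time F (\<tau> k)" "\<And>\<omega>. \<omega> \<in> space P \<Longrightarrow> 0 \<le> \<tau> k \<omega>"
    and m: "integrable P (\<lambda>\<omega>. L (min (\<tau> k \<omega>) T) \<omega>)" "(\<integral>\<omega>. L (min (\<tau> k \<omega>) T) \<omega> \<partial>P) = 0"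
    using loc by (auto simp: zero_mean_localization_def)
  show ?thesis
    by (rule martingale_if_centered) (rule centered_if_stopped_centered[OF tau m k]; assumption)+
qed

end

section \<open>Minimal entropy and Esscher martingale measures\<close>

context levy_horizon
begin

lemma esscher_martingale:
  assumes int: "integrable P (\<lambda>\<omega>. exp (\<kappa> * L T \<omega>))" and M: "esscher \<kappa> \<in> M_hat_loc P F T L"
  shows "martingale_on (esscher \<kappa>) F T L"
proof -
  interpret Q: levy_horizon "esscher \<kappa>" F T L by (rule levy_horizon_esscher[OF int])
  obtain \<tau> where "zero_mean_localization (esscher \<kappa>) F T L \<tau>"
    using M_hat_loc_localization(3)[OF M] ..
  then show ?thesis by (rule Q.martingale_if_localized)
qed

lemma esscher_martingale_measure:
  assumes int: "integrable P (\<lambda>\<omega>. exp (\<kappa> * L T \<omega>))" and mart: "martingale_on (esscher \<kappa>) F T L"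
  shows "esscher \<kappa> \<in> M_hat_loc P F T L" "rel_entropy (esscher \<kappa>) P = ereal (- ln (mgf \<kappa>))"
proof -
  interpret Q: levy_horizon "esscher \<kappa>" F T L by (rule levy_horizon_esscher[OF int])
  note mp = mgf_pos[OF int]
  have [measurable]: "L T \<in> borel_measurable P" using L_measurable[of T] T_pos by simp
  have sp: "space (esscher \<kappa>) = space P" "sets (esscher \<kappa>) = sets P" by (auto simp: esscher_def)
  have "absolutely_continuous P (esscher \<kappa>)"
    unfolding esscher_def by (rule absolutely_continuousI_density) measurable
  then have ac: "esscher \<kappa> \<in> ac_measures P F T"
    using Q.prob_space_axioms Q.sets_P by (simp add: ac_measures_def restr_to_F_T)
  have "local_martingale_on (esscher \<kappa>) F T L"
    unfolding local_martingale_on_def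
  proof (intro exI[of _ "\<lambda>_ _. T"] conjI allI)
    show "martingale_on (esscher \<kappa>) F T (\<lambda>t \<omega>. L (min t T) \<omega>)"
      using mart unfolding martingale_on_def by (simp add: min_absorb1)
  qed (use T_pos in \<open>auto simp: stopping_time_const incseq_def\<close>)
  with ac show "esscher \<kappa> \<in> M_hat_loc P F T L" by (simp add: M_hat_loc_def M_loc_def)
  define W where "W \<omega> = exp (\<kappa> * L T \<omega>) / mgf \<kappa>" for \<omega>
  have W0: "0 \<le> W \<omega>" for \<omega> using mp by (simp add: W_def)
  have Wm [measurable]: "W \<in> borel_measurable P" unfolding W_def by measurable
  have E: "esscher \<kappa> = density P (\<lambda>\<omega>. ennreal (W \<omega>))" by (simp add: esscher_def W_def)
  note LT = martingale_on_mean_zero[OF Q.prob_space_axioms sp(2) mart L_0]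
  have WLi: "integrable P (\<lambda>\<omega>. W \<omega> * L T \<omega>)" and WL: "(\<integral>\<omega>. W \<omega> * L T \<omega> \<partial>P) = 0"
    using LT W0 unfolding E by (auto simp: integrable_real_density integral_real_density)
  have Wi: "integrable P W" and W1: "(\<integral>\<omega>. W \<omega> \<partial>P) = 1"
    unfolding W_def using int mp by (auto simp: mgf_def)
  have Wln: "W \<omega> * ln (W \<omega>) = \<kappa> * (W \<omega> * L T \<omega>) - ln (mgf \<kappa>) * W \<omega>" for \<omega>
    using mp by (simp add: W_def ln_div algebra_simps diff_divide_distrib)
  have ent: "integrable P (\<lambda>\<omega>. W \<omega> * ln (W \<omega>))" unfolding Wln using WLi Wi by auto
  show "rel_entropy (esscher \<kappa>) P = ereal (- ln (mgf \<kappa>))"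
    unfolding E by (subst rel_entropy_density[OF Wm W0 ent]) (use WLi Wi WL W1 in \<open>simp add: Wln\<close>)
qed

lemma MEMM_iff_EMM:
  assumes up: "\<not> (AE \<omega> in P. L T \<omega> \<le> 0)" and dn: "\<not> (AE \<omega> in P. 0 \<le> L T \<omega>)"
  shows "is_MEMM_in (M_hat_loc P F T L) P F T Q \<longleftrightarrow> is_EMM P F T L Q"
proof
  assume "is_MEMM_in (M_hat_loc P F T L) P F T Q"
  then have Q: "Q \<in> M_hat_loc P F T L" and inf: "rel_entropy Q P = (INF Q\<in>M_hat_loc P F T L. rel_entropy Q P)"
    by (auto simp: is_MEMM_in_def restr_to_F_T)
  obtain \<kappa> where int: "integrable P (\<lambda>\<omega>. exp (\<kappa> * L T \<omega>))"
    and le: "(INF Q\<in>M_hat_loc P F T L. rel_entropy Q P) \<le> ereal (- ln (mgf \<kappa>))"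
    by (rule entropy_minimizing_tilt[OF up dn])
  have eq: "Q = esscher \<kappa>"
    by (rule rel_entropy_minimal_eq_esscher[OF int Q]) (simp add: inf le)
  have "martingale_on (esscher \<kappa>) F T L"
    using Q unfolding eq by (rule esscher_martingale[OF int])
  with int eq show "is_EMM P F T L Q" unfolding is_EMM_def esscher_measure_eq by blast
next
  assume "is_EMM P F T L Q"
  then obtain \<kappa> where int: "integrable P (\<lambda>\<omega>. exp (\<kappa> * L T \<omega>))" and Q: "Q = esscher \<kappa>"
    and mart: "martingale_on Q F T L"
    unfolding is_EMM_def esscher_measure_eq by blast
  note E = esscher_martingale_measure[OF int mart[unfolded Q], folded Q]
  have "rel_entropy Q P = (INF Q\<in>M_hat_loc P F T L. rel_entropy Q P)"
  proof (rule antisym)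
    show "rel_entropy Q P \<le> (INF Q\<in>M_hat_loc P F T L. rel_entropy Q P)"
      unfolding E(2) by (intro INF_greatest rel_entropy_ge int)
    show "(INF Q\<in>M_hat_loc P F T L. rel_entropy Q P) \<le> rel_entropy Q P"
      using E(1) by (rule INF_lower)
  qed
  with E(1) show "is_MEMM_in (M_hat_loc P F T L) P F T Q" by (simp add: is_MEMM_in_def restr_to_F_T)
qed

text \<open>
  The two measures may belong to different Esscher parameters. Each measure obeys the entropy bound of the
  other parameter, so their entropies agree, and the equality case of the bound identifies them.
\<close>
lemma EMM_unique:
  assumes "is_EMM P F T L Q" "is_EMM P F T L Q'" shows "Q = Q'"
proof -
  obtain \<kappa> where 1: "integrable P (\<lambda>\<omega>. exp (\<kappa> * L T \<omega>))" "Q = esscher \<kappa>" "martingale_on Q F T L"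
    using assms(1) unfolding is_EMM_def esscher_measure_eq by blast
  obtain \<kappa>' where 2: "integrable P (\<lambda>\<omega>. exp (\<kappa>' * L T \<omega>))" "Q' = esscher \<kappa>'" "martingale_on Q' F T L"
    using assms(2) unfolding is_EMM_def esscher_measure_eq by blast
  note E1 = esscher_martingale_measure[OF 1(1) 1(3)[unfolded 1(2)], folded 1(2)]
  note E2 = esscher_martingale_measure[OF 2(1) 2(3)[unfolded 2(2)], folded 2(2)]
  have "rel_entropy Q' P \<le> ereal (- ln (mgf \<kappa>))"
    using rel_entropy_ge[OF 2(1) E1(1)] unfolding E1(2) E2(2) by simp
  then show ?thesis using rel_entropy_minimal_eq_esscher[OF 1(1) E2(1)] 1(2) by simp
qed

end

text \<open>
  Lets the given measure be replaced by its restriction to \<open>F T\<close>, on which the locale is stated.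
\<close>
lemma levy_process_restr:
  assumes "prob_space P" and filt: "filtration (space P) F" and sub: "\<And>t. t \<in> {0..T} \<Longrightarrow> subalgebra P (F t)"
    and T: "0 < T"
  shows "levy_process (restr_to_subalg P (F T)) F T L \<longleftrightarrow> levy_process P F T L"
proof -
  interpret prob_space P by fact
  let ?P = "restr_to_subalg P (F T)"
  have subT: "subalgebra P (F T)" using sub T by simp
  have sp: "space ?P = space P" by (rule space_restr_to_subalg)
  have mono: "sets (F t) \<subseteq> sets (F T)" if "t \<le> T" for t
    using filtration.sets_F_mono[OF filt that] .
  have sub': "subalgebra ?P (F t)" if "t \<in> {0..T}" for t
    using sub[OF that] mono[of t] that by (auto simp: subalgebra_def sp sets_restr_to_subalg[OF subT])
  have "independent_increments ?P F T L \<longleftrightarrow> independent_increments P F T L"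
    if ad: "\<forall>t\<in>{0..T}. L t \<in> borel_measurable (F t)"
    unfolding independent_increments_def sp
  proof (intro ball_cong refl)
    fix s t A and B :: "real set"
    assume st: "s \<in> {0..T}" "t \<in> {s..T}" and A: "A \<in> sets (F s)" and B: "B \<in> sets borel"
    have m: "L r \<in> borel_measurable (F T)" if "r \<in> {0..T}" for r
    proof (rule measurable_from_subalg)
      show "subalgebra (F T) (F r)"
        using mono[of r] that filtration.space_F[OF filt] by (auto simp: subalgebra_def)
    qed (use ad that in auto)
    have spT: "space (F T) = space P" using filtration.space_F[OF filt] .
    have [measurable]: "L t \<in> borel_measurable (F T)" "L s \<in> borel_measurable (F T)" "L (t - s) \<in> borel_measurable (F T)"
      using st by (auto intro!: m)
    have AT: "A \<in> sets (F T)" using mono[of s] st A by auto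
    have 1: "{\<omega> \<in> space P. L t \<omega> - L s \<omega> \<in> B} \<in> sets (F T)" "{\<omega> \<in> space P. L (t - s) \<omega> \<in> B} \<in> sets (F T)"
      unfolding spT[symmetric] using B by measurable
    show "(emeasure ?P (A \<inter> {\<omega> \<in> space P. L t \<omega> - L s \<omega> \<in> B}) = emeasure ?P A * emeasure ?P {\<omega> \<in> space P. L (t - s) \<omega> \<in> B})
      \<longleftrightarrow> (emeasure P (A \<inter> {\<omega> \<in> space P. L t \<omega> - L s \<omega> \<in> B}) = emeasure P A * emeasure P {\<omega> \<in> space P. L (t - s) \<omega> \<in> B})"
      using 1 AT by (simp add: emeasure_restr_to_subalg[OF subT] sets.Int)
  qed
  moreover have "levy_process P F T L \<longleftrightarrow>
     (\<forall>\<omega>\<in>space P. cadlag_on T (\<lambda>t. L t \<omega>)) \<and> (\<forall>\<omega>\<in>space P. L 0 \<omega> = 0) \<and>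
     (\<forall>t\<in>{0..T}. L t \<in> borel_measurable (F t)) \<and> independent_increments P F T L"
    by (rule levy_process_iff[OF assms(1) sub])
  moreover have "levy_process ?P F T L \<longleftrightarrow>
     (\<forall>\<omega>\<in>space ?P. cadlag_on T (\<lambda>t. L t \<omega>)) \<and> (\<forall>\<omega>\<in>space ?P. L 0 \<omega> = 0) \<and>
     (\<forall>t\<in>{0..T}. L t \<in> borel_measurable (F t)) \<and> independent_increments ?P F T L"
    by (rule levy_process_iff[OF prob_space_restr_to_subalg[OF subT assms(1)] sub'])
  ultimately show ?thesis unfolding sp by argo
qed

theorem theorem4p6:
  fixes P :: "'a measure" and F :: "real \<Rightarrow> 'a measure" and T :: real
    and L :: "real \<Rightarrow> 'a \<Rightarrow> real"
  assumes "prob_space P"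
    and "T > 0"
    and "filtration (space P) F"
    and "\<forall>t\<in>{0..T}. subalgebra P (F t)"
    and "levy_process P F T L"
    and "\<not> subordinator P F T L"
    and "\<not> subordinator P F T (\<lambda>t \<omega>. - L t \<omega>)"
  shows "((\<exists>Pmin. is_MEMM_in (M_hat_loc P F T L) P F T Pmin) \<longleftrightarrow> (\<exists>PE. is_EMM P F T L PE)) \<and>
    (\<forall>Pmin PE. is_MEMM_in (M_hat_loc P F T L) P F T Pmin \<longrightarrow> is_EMM P F T L PE \<longrightarrow> Pmin = PE)"
proof -
  let ?P = "restr_to_subalg P (F T)"
  have sub: "subalgebra P (F t)" if "t \<in> {0..T}" for t using assms(4) that by blast
  have subT: "subalgebra P (F T)" using sub assms(2) by simp
  note restr = levy_process_restr[OF assms(1,3) sub assms(2)]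
  interpret R: levy_horizon ?P F T L
    unfolding levy_horizon_def levy_horizon_axioms_def
    using prob_space_restr_to_subalg[OF subT assms(1)] assms(2,3,5) restr
    by (simp add: space_restr_to_subalg sets_restr_to_subalg[OF subT])
  have sub_P: "subordinator P F T X" if "subordinator ?P F T X" for X
    using that restr AE_restr_to_subalg[OF subT] unfolding subordinator_def by blast
  have dn: "\<not> (AE \<omega> in ?P. 0 \<le> L T \<omega>)"
    using R.subordinator_if_terminal_nonneg sub_P assms(6) by blast
  have up: "\<not> (AE \<omega> in ?P. L T \<omega> \<le> 0)"
    using levy_horizon.subordinator_if_terminal_nonneg[OF R.levy_horizon_uminus] sub_P assms(7) by auto
  have [measurable]: "L T \<in> borel_measurable (F T)" using R.adapted[of T] assms(2) by simp
  have LT: "(\<lambda>\<omega>. exp (\<kappa> * L T \<omega>)) \<in> borel_measurable (F T)" for \<kappa>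
    by measurable
  have M: "M_hat_loc P F T L = M_hat_loc ?P F T L"
    unfolding M_hat_loc_def M_loc_def M_tilde_loc0_def M_tilde_loc_def ac_measures_def R.restr_to_F_T ..
  have MEMM: "is_MEMM_in (M_hat_loc P F T L) P F T Q \<longleftrightarrow> is_MEMM_in (M_hat_loc ?P F T L) ?P F T Q" for Q
    unfolding is_MEMM_in_def M R.restr_to_F_T ..
  have "integrable P (\<lambda>\<omega>. exp (\<kappa> * L T \<omega>)) \<longleftrightarrow> integrable ?P (\<lambda>\<omega>. exp (\<kappa> * L T \<omega>))" for \<kappa>
    using integrable_from_subalg[OF subT] integrable_in_subalg[OF subT LT] by blast
  moreover have "esscher_measure P F T L \<kappa> = esscher_measure ?P F T L \<kappa>" for \<kappa>
    unfolding esscher_measure_def R.restr_to_F_T integral_subalgebra2[OF subT LT] ..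
  ultimately have EMM: "is_EMM P F T L Q \<longleftrightarrow> is_EMM ?P F T L Q" for Q
    unfolding is_EMM_def by simp
  have "is_MEMM_in (M_hat_loc P F T L) P F T Q \<longleftrightarrow> is_EMM P F T L Q" for Q
    unfolding MEMM EMM by (rule R.MEMM_iff_EMM[OF up dn])
  moreover have "Q = Q'" if "is_EMM P F T L Q" "is_EMM P F T L Q'" for Q Q'
    using that unfolding EMM by (rule R.EMM_unique)
  ultimately show ?thesis by blast
qed

end
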